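(* Let $\mathcal{Q}$ be a small quantaloid. Then $\mathbf{D}(\mathcal{Q}\text{-}\mathbf{Rel})$ and $(\mathcal{Q}\text{-}\mathbf{IntRel})_{\mathsf o}$ are equivalent quantaloids.
   Context: **Quantaloids.** A quantaloid is a (possibly large) category whose hom-sets are complete lattices and whose composition preserves arbitrary joins in each variable. For arrows $u:p\to q$, $v:q\to r$, $w:p\to r$ the arrows $w\swarrow u:q\to r$ and $v\searrow w:p\to q$ are determined by $v\circ u\le w\iff v\le w\swarrow u\iff u\le v\searrow w$. A homomorphism of quantaloids is a functor preserving joins of arrows; it is an equivalence of quantaloids if the underlying functor is an equivalence of categories. A congruence on a quantaloid is a family of equivalence relations on the hom-sets compatible with composition and arbitrary joins; it induces a quotient quantaloid with the same objects and with equivalence classes as arrows. A quantaloid is small if its objects form a set. Throughout, $\mathcal{Q}$ is a small quantaloid. **$\mathcal{Q}$-relations.** A set over $\mathrm{ob}\,\mathcal{Q}$ is a set $X$ with a type map $|\cdot|:X\to\mathrm{ob}\,\mathcal{Q}$. A $\mathcal{Q}$-relation $\phi:X\nrightarrow Y$ between such sets is any family of arrows $\phi(x,y)\in\mathcal{Q}(|x|,|y|)$, $x\in X,y\in Y$. They form a quantaloid $\mathcal{Q}\text{-}\mathbf{Rel}$ with pointwise order, $(\psi\circ\phi)(x,z)=\bigvee_y\psi(y,z)\circ\phi(x,y)$, identities $\mathrm{id}_X$ with $\mathrm{id}_X(x,x)=1_{|x|}$ and $\mathrm{id}_X(x,y)=\bot$ for $x\ne y$, and $(\xi\swarrow\phi)(y,z)=\bigwedge_x\xi(x,z)\swarrow\phi(x,y)$.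 (These are exactly the $\mathcal{Q}$-distributors between discrete $\mathcal{Q}$-categories $(X,\mathrm{id}_X)$.) **Diagonals.** $\mathbf{Arr}(\mathcal{Q}\text{-}\mathbf{Rel})$ has $\mathcal{Q}$-relations as objects; arrows from $\phi:X\nrightarrow Y$ to $\psi:X'\nrightarrow Y'$ are pairs $(\zeta:X\nrightarrow X',\eta:Y\nrightarrow Y')$ of $\mathcal{Q}$-relations with $\psi\circ\zeta=\eta\circ\phi$, composed and ordered componentwise. Put $(\zeta,\eta)\sim(\zeta',\eta')$ iff $\psi\circ\zeta=\psi\circ\zeta'$ (equivalently $\eta\circ\phi=\eta'\circ\phi$); this is a congruence, and $\mathbf{D}(\mathcal{Q}\text{-}\mathbf{Rel}):=\mathbf{Arr}(\mathcal{Q}\text{-}\mathbf{Rel})/\!\sim$. **Interior spaces on discrete $\mathcal{Q}$-categories.** For a set $X$ over $\mathrm{ob}\,\mathcal{Q}$, $\mathsf{P}X$ is the set of all $\mathcal{Q}$-relations $\mu:X\nrightarrow\{q\}$, $q\in\mathrm{ob}\,\mathcal{Q}$, where $\{q\}$ is a singleton of type $q$; $\mu$ has type $q$, and $\mathsf{P}X$ carries the hom-arrows $\mu'\swarrow\mu$ from $\mu$ to $\mu'$. A $\mathcal{Q}$-interior operator on $\mathsf{P}X$ is a type-preserving map $a:\mathsf{P}X\to\mathsf{P}X$ with $\mu'\swarrow\mu\le a\mu'\swarrow a\mu$, $a\mu\le\mu$ and $aa\mu=a\mu$ for all $\mu,\mu'$. A $\mathcal{Q}$-relation $\zeta:X\nrightarrow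 Y$ induces $\zeta^*:\mathsf{P}Y\to\mathsf{P}X$, $\zeta^*\lambda=\lambda\circ\zeta$. Objects of $\mathcal{Q}\text{-}\mathbf{IntRel}$ are pairs $(X,a)$ with $X$ a set over $\mathrm{ob}\,\mathcal{Q}$ and $a$ a $\mathcal{Q}$-interior operator on $\mathsf{P}X$; arrows $(X,a)\nrightarrow(Y,b)$ are continuous $\mathcal{Q}$-relations, i.e. $\mathcal{Q}$-relations $\zeta:X\nrightarrow Y$ with $\zeta^*b\lambda\le a\zeta^*\lambda$ for all $\lambda\in\mathsf{P}Y$; order, composition and identities are as in $\mathcal{Q}\text{-}\mathbf{Rel}$. For continuous $\zeta,\zeta':(X,a)\nrightarrow(Y,b)$ put $\zeta\sim\zeta'$ iff $\zeta^*b=\zeta'^*b$; this is a congruence, and $(\mathcal{Q}\text{-}\mathbf{IntRel})_{\mathsf o}:=\mathcal{Q}\text{-}\mathbf{IntRel}/\!\sim$. *)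

theory Defs
  imports "HOL-Algebra.Complete_Lattice" "HOL-Library.FuncSet"
begin

section \<open>Quantaloids\<close>

text \<open>
  Composition and identities are indexed by objects, so different hom-sets may overlap as
  HOL sets: \<open>Comp Q p q r v u\<close> is \<open>v \<circ> u : p \<rightarrow> r\<close> for \<open>u : p \<rightarrow> q\<close> and \<open>v : q \<rightarrow> r\<close>.
  The objects form a set of HOL type \<open>'o set\<close>; whether this is a small set or a large one is
  a matter of the universe below.
\<close>

record ('o, 'a) qtld =
  Ob :: "'o set"
  Hom :: "'o \<Rightarrow> 'o \<Rightarrow> 'a gorder"
  Comp :: "'o \<Rightarrow> 'o \<Rightarrow> 'o \<Rightarrow> 'a \<Rightarrow> 'a \<Rightarrow> 'a"
  One :: "'o \<Rightarrow> 'a"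

abbreviation arr :: "('o, 'a) qtld \<Rightarrow> 'o \<Rightarrow> 'o \<Rightarrow> 'a set" where
  "arr Q p q \<equiv> carrier (Hom Q p q)"

locale quantaloid =
  fixes Q :: "('o, 'a) qtld"
  assumes hom_complete_lattice:
      "\<lbrakk>p \<in> Ob Q; q \<in> Ob Q\<rbrakk> \<Longrightarrow> complete_lattice (Hom Q p q)"
    and comp_closed:
      "\<lbrakk>p \<in> Ob Q; q \<in> Ob Q; r \<in> Ob Q; u \<in> arr Q p q; v \<in> arr Q q r\<rbrakk>
        \<Longrightarrow> Comp Q p q r v u \<in> arr Q p r"
    and one_closed: "p \<in> Ob Q \<Longrightarrow> One Q p \<in> arr Q p p"
    and comp_assoc:
      "\<lbrakk>p \<in> Ob Q; q \<in> Ob Q; r \<in> Ob Q; s \<in> Ob Q;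
        u \<in> arr Q p q; v \<in> arr Q q r; w \<in> arr Q r s\<rbrakk>
        \<Longrightarrow> Comp Q p r s w (Comp Q p q r v u) = Comp Q p q s (Comp Q q r s w v) u"
    and comp_one_right:
      "\<lbrakk>p \<in> Ob Q; q \<in> Ob Q; u \<in> arr Q p q\<rbrakk> \<Longrightarrow> Comp Q p p q u (One Q p) = u"
    and comp_one_left:
      "\<lbrakk>p \<in> Ob Q; q \<in> Ob Q; u \<in> arr Q p q\<rbrakk> \<Longrightarrow> Comp Q p q q (One Q q) u = u"
    and comp_Sup_right:
      "\<lbrakk>p \<in> Ob Q; q \<in> Ob Q; r \<in> Ob Q; U \<subseteq> arr Q p q; v \<in> arr Q q r\<rbrakk>
        \<Longrightarrow> Comp Q p q r v (\<Squnion>\<^bsub>Hom Q p q\<^esub> U)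
            = \<Squnion>\<^bsub>Hom Q p r\<^esub> ((\<lambda>u. Comp Q p q r v u) ` U)"
    and comp_Sup_left:
      "\<lbrakk>p \<in> Ob Q; q \<in> Ob Q; r \<in> Ob Q; u \<in> arr Q p q; V \<subseteq> arr Q q r\<rbrakk>
        \<Longrightarrow> Comp Q p q r (\<Squnion>\<^bsub>Hom Q q r\<^esub> V) u
            = \<Squnion>\<^bsub>Hom Q p r\<^esub> ((\<lambda>v. Comp Q p q r v u) ` V)"

text \<open>\<open>lres Q p q r w u\<close> is \<open>w \<swarrow> u : q \<rightarrow> r\<close> for \<open>u : p \<rightarrow> q\<close> and \<open>w : p \<rightarrow> r\<close>.\<close>

definition lres :: "('o, 'a) qtld \<Rightarrow> 'o \<Rightarrow> 'o \<Rightarrow> 'o \<Rightarrow> 'a \<Rightarrow> 'a \<Rightarrow> 'a" where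
  "lres Q p q r w u =
     (THE x. x \<in> arr Q q r \<and>
        (\<forall>v \<in> arr Q q r. Comp Q p q r v u \<sqsubseteq>\<^bsub>Hom Q p r\<^esub> w \<longleftrightarrow> v \<sqsubseteq>\<^bsub>Hom Q q r\<^esub> x))"

section \<open>Functors, homomorphisms and equivalences\<close>

record ('o1, 'a1, 'o2, 'a2) qfun =
  omap :: "'o1 \<Rightarrow> 'o2"
  amap :: "'o1 \<Rightarrow> 'o1 \<Rightarrow> 'a1 \<Rightarrow> 'a2"

definition is_functor ::
  "('o1, 'a1) qtld \<Rightarrow> ('o2, 'a2) qtld \<Rightarrow> ('o1, 'a1, 'o2, 'a2) qfun \<Rightarrow> bool" where
  "is_functor A B F \<longleftrightarrow>
     (\<forall>p \<in> Ob A. omap F p \<in> Ob B) \<and>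
     (\<forall>p \<in> Ob A. \<forall>q \<in> Ob A. \<forall>u \<in> arr A p q. amap F p q u \<in> arr B (omap F p) (omap F q)) \<and>
     (\<forall>p \<in> Ob A. amap F p p (One A p) = One B (omap F p)) \<and>
     (\<forall>p \<in> Ob A. \<forall>q \<in> Ob A. \<forall>r \<in> Ob A. \<forall>u \<in> arr A p q. \<forall>v \<in> arr A q r.
        amap F p r (Comp A p q r v u)
        = Comp B (omap F p) (omap F q) (omap F r) (amap F q r v) (amap F p q u))"

definition id_functor :: "('o, 'a, 'o, 'a) qfun" where
  "id_functor = \<lparr>omap = (\<lambda>p. p), amap = (\<lambda>p q u. u)\<rparr>"

definition comp_functor ::
  "('o2, 'a2, 'o3, 'a3) qfun \<Rightarrow> ('o1, 'a1, 'o2, 'a2) qfun \<Rightarrow> ('o1, 'a1, 'o3, 'a3) qfun" where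
  "comp_functor G F =
     \<lparr>omap = (\<lambda>p. omap G (omap F p)),
      amap = (\<lambda>p q u. amap G (omap F p) (omap F q) (amap F p q u))\<rparr>"

definition is_iso :: "('o, 'a) qtld \<Rightarrow> 'o \<Rightarrow> 'o \<Rightarrow> 'a \<Rightarrow> bool" where
  "is_iso A p q u \<longleftrightarrow>
     u \<in> arr A p q \<and>
     (\<exists>v \<in> arr A q p. Comp A p q p v u = One A p \<and> Comp A q p q u v = One A q)"

definition naturally_isomorphic ::
  "('o1, 'a1) qtld \<Rightarrow> ('o2, 'a2) qtld \<Rightarrow>
   ('o1, 'a1, 'o2, 'a2) qfun \<Rightarrow> ('o1, 'a1, 'o2, 'a2) qfun \<Rightarrow> bool" where
  "naturally_isomorphic A B F G \<longleftrightarrow>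
     (\<exists>\<sigma>. (\<forall>p \<in> Ob A. is_iso B (omap F p) (omap G p) (\<sigma> p)) \<and>
          (\<forall>p \<in> Ob A. \<forall>q \<in> Ob A. \<forall>u \<in> arr A p q.
             Comp B (omap F p) (omap F q) (omap G q) (\<sigma> q) (amap F p q u)
             = Comp B (omap F p) (omap G p) (omap G q) (amap G p q u) (\<sigma> p)))"

definition is_category_equivalence ::
  "('o1, 'a1) qtld \<Rightarrow> ('o2, 'a2) qtld \<Rightarrow> ('o1, 'a1, 'o2, 'a2) qfun \<Rightarrow> bool" where
  "is_category_equivalence A B F \<longleftrightarrow>
     is_functor A B F \<and>
     (\<exists>G. is_functor B A G \<and>
          naturally_isomorphic A A id_functor (comp_functor G F) \<and>
          naturally_isomorphic B B (comp_functor F G) id_functor)"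

definition is_quantaloid_hom ::
  "('o1, 'a1) qtld \<Rightarrow> ('o2, 'a2) qtld \<Rightarrow> ('o1, 'a1, 'o2, 'a2) qfun \<Rightarrow> bool" where
  "is_quantaloid_hom A B F \<longleftrightarrow>
     is_functor A B F \<and>
     (\<forall>p \<in> Ob A. \<forall>q \<in> Ob A. \<forall>U \<subseteq> arr A p q.
        amap F p q (\<Squnion>\<^bsub>Hom A p q\<^esub> U)
        = \<Squnion>\<^bsub>Hom B (omap F p) (omap F q)\<^esub> (amap F p q ` U))"

definition equivalent_quantaloids :: "('o1, 'a1) qtld \<Rightarrow> ('o2, 'a2) qtld \<Rightarrow> bool" where
  "equivalent_quantaloids A B \<longleftrightarrow>
     quantaloid A \<and> quantaloid B \<and>
     (\<exists>F. is_quantaloid_hom A B F \<and> is_category_equivalence A B F)"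

section \<open>Quotients\<close>

text \<open>
  In the quotient by a congruence \<open>R\<close>, joins are computed on representatives; the order is the
  one this forces, namely \<open>[u] \<le> [v]\<close> iff \<open>u \<squnion> v\<close> lies in \<open>[v]\<close>. When \<open>R\<close> is a congruence,
  the union defining the composite runs over copies of one and the same class.
\<close>

definition Quot :: "('o, 'a) qtld \<Rightarrow> ('o \<Rightarrow> 'o \<Rightarrow> ('a \<times> 'a) set) \<Rightarrow> ('o, 'a set) qtld" where
  "Quot Q R =
     \<lparr>Ob = Ob Q,
      Hom = (\<lambda>p q. \<lparr>carrier = arr Q p q // R p q, eq = (=),
                    le = (\<lambda>U V. \<exists>u \<in> U. \<exists>v \<in> V. u \<squnion>\<^bsub>Hom Q p q\<^esub> v \<in> V)\<rparr>),
      Comp = (\<lambda>p q r V U. \<Union>v \<in> V. \<Union>u \<in> U. R p r `` {Comp Q p q r v u}),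
      One = (\<lambda>p. R p p `` {One Q p})\<rparr>"

section \<open>Arrow quantaloids and diagonals\<close>

text \<open>An object \<open>(X, Y, \<phi>)\<close> of \<open>Arr Q\<close> is an arrow \<open>\<phi> : X \<rightarrow> Y\<close> of \<open>Q\<close>.\<close>

definition Arr :: "('o, 'a) qtld \<Rightarrow> ('o \<times> 'o \<times> 'a, 'a \<times> 'a) qtld" where
  "Arr Q =
     \<lparr>Ob = {(X, Y, \<phi>). X \<in> Ob Q \<and> Y \<in> Ob Q \<and> \<phi> \<in> arr Q X Y},
      Hom = (\<lambda>(X, Y, \<phi>) (X', Y', \<psi>).
        \<lparr>carrier = {(\<zeta>, \<eta>). \<zeta> \<in> arr Q X X' \<and> \<eta> \<in> arr Q Y Y' \<and>
                           Comp Q X X' Y' \<psi> \<zeta> = Comp Q X Y Y' \<eta> \<phi>},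
         eq = (=),
         le = (\<lambda>(\<zeta>, \<eta>) (\<zeta>', \<eta>'). \<zeta> \<sqsubseteq>\<^bsub>Hom Q X X'\<^esub> \<zeta>' \<and> \<eta> \<sqsubseteq>\<^bsub>Hom Q Y Y'\<^esub> \<eta>')\<rparr>),
      Comp = (\<lambda>(X, Y, _) (X', Y', _) (X'', Y'', _) (\<zeta>', \<eta>') (\<zeta>, \<eta>).
        (Comp Q X X' X'' \<zeta>' \<zeta>, Comp Q Y Y' Y'' \<eta>' \<eta>)),
      One = (\<lambda>(X, Y, _). (One Q X, One Q Y))\<rparr>"

definition diag_cong ::
  "('o, 'a) qtld \<Rightarrow> 'o \<times> 'o \<times> 'a \<Rightarrow> 'o \<times> 'o \<times> 'a \<Rightarrow> (('a \<times> 'a) \<times> ('a \<times> 'a)) set" where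
  "diag_cong Q = (\<lambda>(X, Y, \<phi>) (X', Y', \<psi>).
     {((\<zeta>, \<eta>), (\<zeta>', \<eta>')).
        (\<zeta>, \<eta>) \<in> arr (Arr Q) (X, Y, \<phi>) (X', Y', \<psi>) \<and>
        (\<zeta>', \<eta>') \<in> arr (Arr Q) (X, Y, \<phi>) (X', Y', \<psi>) \<and>
        Comp Q X X' Y' \<psi> \<zeta> = Comp Q X X' Y' \<psi> \<zeta>'})"

definition Diag :: "('o, 'a) qtld \<Rightarrow> ('o \<times> 'o \<times> 'a, ('a \<times> 'a) set) qtld" where
  "Diag Q = Quot (Arr Q) (diag_cong Q)"

section \<open>Small sets\<close>

unbundle cardinal_syntax

text \<open>
  The category of all sets is modelled relative to a universe given by a type \<open>'u\<close> whose
  cardinality is an infinite regular strong limit: a set is small if its cardinality is below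
  that of \<open>'u\<close>, and up to bijection the small sets are the small subsets of \<open>'u\<close>. Every nonempty
  Grothendieck universe is of this form; uncountability is not required, so the hereditarily
  finite universe (\<open>'u = nat\<close>) is admitted as well.
\<close>

definition universe :: "'u itself \<Rightarrow> bool" where
  "universe (_ :: 'u itself) \<longleftrightarrow>
     infinite (UNIV :: 'u set) \<and>
     regularCard |UNIV :: 'u set| \<and>
     (\<forall>A :: 'u set. |A| <o |UNIV :: 'u set| \<longrightarrow> |Pow A| <o |UNIV :: 'u set| )"

definition small :: "'u itself \<Rightarrow> 'b set \<Rightarrow> bool" where
  "small (_ :: 'u itself) A \<longleftrightarrow> |A| <o |UNIV :: 'u set|"

definition small_quantaloid :: "'u itself \<Rightarrow> ('o, 'a) qtld \<Rightarrow> bool" where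
  "small_quantaloid U Q \<longleftrightarrow>
     quantaloid Q \<and> small U (Ob Q) \<and> (\<forall>p \<in> Ob Q. \<forall>q \<in> Ob Q. small U (arr Q p q))"

section \<open>Relations valued in a quantaloid\<close>

text \<open>
  A set over \<open>ob Q\<close> is a pair \<open>(X, t)\<close> of a small set and its type map; all maps are
  extensional, i.e. \<open>undefined\<close> outside their domain.
\<close>

type_synonym ('u, 'o) oset = "'u set \<times> ('u \<Rightarrow> 'o)"
type_synonym ('u, 'a) qrel = "'u \<Rightarrow> 'u \<Rightarrow> 'a"

definition QRel :: "('o, 'a) qtld \<Rightarrow> (('u, 'o) oset, ('u, 'a) qrel) qtld" where
  "QRel Q =
     \<lparr>Ob = {(X, t). small TYPE('u) X \<and> t \<in> X \<rightarrow>\<^sub>E Ob Q},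
      Hom = (\<lambda>(X, t) (Y, s).
        \<lparr>carrier = (\<Pi>\<^sub>E x\<in>X. \<Pi>\<^sub>E y\<in>Y. arr Q (t x) (s y)),
         eq = (=),
         le = (\<lambda>\<phi> \<psi>. \<forall>x\<in>X. \<forall>y\<in>Y. \<phi> x y \<sqsubseteq>\<^bsub>Hom Q (t x) (s y)\<^esub> \<psi> x y)\<rparr>),
      Comp = (\<lambda>(X, t) (Y, s) (Z, r) \<psi> \<phi>. \<lambda>x\<in>X. \<lambda>z\<in>Z.
        \<Squnion>\<^bsub>Hom Q (t x) (r z)\<^esub> ((\<lambda>y. Comp Q (t x) (s y) (r z) (\<psi> y z) (\<phi> x y)) ` Y)),
      One = (\<lambda>(X, t). \<lambda>x\<in>X. \<lambda>y\<in>X.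
        if x = y then One Q (t x) else \<bottom>\<^bsub>Hom Q (t x) (t y)\<^esub>)\<rparr>"

text \<open>The singleton \<open>{q}\<close> of type \<open>q\<close>; its only element is an arbitrary point of the universe.\<close>

definition singleton_oset :: "'o \<Rightarrow> ('u, 'o) oset" where
  "singleton_oset q = ({undefined}, \<lambda>x\<in>{undefined}. q)"

section \<open>Interior spaces\<close>

text \<open>An element \<open>\<mu> : X \<rightarrow> {q}\<close> of \<open>PX\<close> is recorded together with its type, as \<open>(q, \<mu>)\<close>.\<close>

type_synonym ('u, 'o, 'a) psh = "'o \<times> ('u, 'a) qrel"

definition Psh :: "('o, 'a) qtld \<Rightarrow> ('u, 'o) oset \<Rightarrow> ('u, 'o, 'a) psh set" where
  "Psh Q X = {(q, \<mu>). q \<in> Ob Q \<and> \<mu> \<in> arr (QRel Q) X (singleton_oset q)}"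

text \<open>
  The hom-arrow \<open>\<mu>' \<swarrow> \<mu>\<close> is the residual in \<open>QRel Q\<close>, a relation between two singletons, that
  is, an arrow \<open>q \<rightarrow> q'\<close> of \<open>Q\<close>.
\<close>

definition psh_hom ::
  "('o, 'a) qtld \<Rightarrow> ('u, 'o) oset \<Rightarrow> ('u, 'o, 'a) psh \<Rightarrow> ('u, 'o, 'a) psh \<Rightarrow> ('u, 'a) qrel" where
  "psh_hom Q X = (\<lambda>(q, \<mu>) (q', \<mu>').
     lres (QRel Q) X (singleton_oset q) (singleton_oset q') \<mu>' \<mu>)"

definition psh_le ::
  "('o, 'a) qtld \<Rightarrow> ('u, 'o) oset \<Rightarrow> ('u, 'o, 'a) psh \<Rightarrow> ('u, 'o, 'a) psh \<Rightarrow> bool" where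
  "psh_le Q X = (\<lambda>(q, \<mu>) (q', \<mu>').
     q = q' \<and> \<mu> \<sqsubseteq>\<^bsub>Hom (QRel Q) X (singleton_oset q)\<^esub> \<mu>')"

definition interior_operator ::
  "('o, 'a) qtld \<Rightarrow> ('u, 'o) oset \<Rightarrow> (('u, 'o, 'a) psh \<Rightarrow> ('u, 'o, 'a) psh) \<Rightarrow> bool" where
  "interior_operator Q X a \<longleftrightarrow>
     a \<in> Psh Q X \<rightarrow>\<^sub>E Psh Q X \<and>
     (\<forall>\<mu> \<in> Psh Q X. fst (a \<mu>) = fst \<mu>) \<and>
     (\<forall>\<mu> \<in> Psh Q X. \<forall>\<mu>' \<in> Psh Q X.
        psh_hom Q X \<mu> \<mu>'
        \<sqsubseteq>\<^bsub>Hom (QRel Q) (singleton_oset (fst \<mu>)) (singleton_oset (fst \<mu>'))\<^esub>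
        psh_hom Q X (a \<mu>) (a \<mu>')) \<and>
     (\<forall>\<mu> \<in> Psh Q X. psh_le Q X (a \<mu>) \<mu>) \<and>
     (\<forall>\<mu> \<in> Psh Q X. a (a \<mu>) = a \<mu>)"

text \<open>\<open>pullback Q X Y \<zeta>\<close> is \<open>\<zeta>\<^sup>* : PY \<rightarrow> PX\<close> for \<open>\<zeta> : X \<rightarrow> Y\<close>.\<close>

definition pullback ::
  "('o, 'a) qtld \<Rightarrow> ('u, 'o) oset \<Rightarrow> ('u, 'o) oset \<Rightarrow> ('u, 'a) qrel \<Rightarrow>
   ('u, 'o, 'a) psh \<Rightarrow> ('u, 'o, 'a) psh" where
  "pullback Q X Y \<zeta> = (\<lambda>(q, l). (q, Comp (QRel Q) X Y (singleton_oset q) l \<zeta>))"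

type_synonym ('u, 'o, 'a) int_space =
  "('u, 'o) oset \<times> (('u, 'o, 'a) psh \<Rightarrow> ('u, 'o, 'a) psh)"

definition continuous_qrel ::
  "('o, 'a) qtld \<Rightarrow> ('u, 'o, 'a) int_space \<Rightarrow> ('u, 'o, 'a) int_space \<Rightarrow> ('u, 'a) qrel \<Rightarrow> bool" where
  "continuous_qrel Q = (\<lambda>(X, a) (Y, b) \<zeta>.
     \<zeta> \<in> arr (QRel Q) X Y \<and>
     (\<forall>l \<in> Psh Q Y. psh_le Q X (pullback Q X Y \<zeta> (b l)) (a (pullback Q X Y \<zeta> l))))"

definition IntRel :: "('o, 'a) qtld \<Rightarrow> (('u, 'o, 'a) int_space, ('u, 'a) qrel) qtld" where
  "IntRel Q =
     \<lparr>Ob = {(X, a). X \<in> Ob (QRel Q) \<and> interior_operator Q X a},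
      Hom = (\<lambda>S T. \<lparr>carrier = {\<zeta>. continuous_qrel Q S T \<zeta>}, eq = (=),
                    le = le (Hom (QRel Q) (fst S) (fst T))\<rparr>),
      Comp = (\<lambda>S T U. Comp (QRel Q) (fst S) (fst T) (fst U)),
      One = (\<lambda>S. One (QRel Q) (fst S))\<rparr>"

definition open_cong ::
  "('o, 'a) qtld \<Rightarrow> ('u, 'o, 'a) int_space \<Rightarrow> ('u, 'o, 'a) int_space \<Rightarrow>
   (('u, 'a) qrel \<times> ('u, 'a) qrel) set" where
  "open_cong Q = (\<lambda>(X, a) (Y, b).
     {(\<zeta>, \<zeta>'). continuous_qrel Q (X, a) (Y, b) \<zeta> \<and> continuous_qrel Q (X, a) (Y, b) \<zeta>' \<and>
              (\<forall>l \<in> Psh Q Y. pullback Q X Y \<zeta> (b l) = pullback Q X Y \<zeta>' (b l))})"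

definition IntRel_o :: "('o, 'a) qtld \<Rightarrow> (('u, 'o, 'a) int_space, ('u, 'a) qrel set) qtld" where
  "IntRel_o Q = Quot (IntRel Q) (open_cong Q)"

end

theory Submission
  imports Defs
begin

text \<open>
  A relation \<open>\<phi> : X \<rightarrow> Y\<close> induces the interior operator \<open>\<phi>\<^sup>* \<phi>\<^sub>*\<close>, \<open>\<mu> \<mapsto> (\<mu> \<swarrow> \<phi>) \<circ> \<phi>\<close>, on \<open>PX\<close>,
  whose open presheaves are those of the form \<open>l \<circ> \<phi>\<close>. A relation \<open>\<zeta>\<close> is continuous iff
  \<open>\<zeta>\<^sup>*\<close> preserves open presheaves, that is, iff each row of \<open>\<psi> \<circ> \<zeta>\<close> factors through \<open>\<phi>\<close>, that
  is, iff \<open>\<psi> \<circ> \<zeta> = \<eta> \<circ> \<phi>\<close> for some \<open>\<eta>\<close>. Hence \<open>(\<zeta>, \<eta>) \<mapsto> \<zeta>\<close> is a full homomorphism from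
  the arrow quantaloid to interior spaces. It identifies the two congruences, because \<open>\<zeta>\<^sup>*\<close> and
  \<open>\<zeta>'\<^sup>*\<close> agree on open presheaves iff \<open>\<psi> \<circ> \<zeta> = \<psi> \<circ> \<zeta>'\<close>. It is surjective on objects: given
  \<open>(X, a)\<close>, take for \<open>Y\<close> the small set of all open presheaves and for \<open>\<phi>\<close> evaluation. So it
  descends to an equivalence of the quotients.
\<close>

text \<open>The delicate point is that evaluation at the open presheaves recovers the given operator
  a. A presheaf w o phi is a join of scalar multiples v o mu of open presheaves mu, and each
  multiple that lies below a presheaf must be shown to lie below its interior. Pointwise
  monotonicity of a is too weak, because a scalar changes the type of a presheaf. What works is
  monotonicity for the hom-arrows: if mu is open and v o mu is below mu', then it is below a mu'.

  Fullness requires no compatibility between the rows of eta, because the sets are discrete: a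
  relation into Y is an arbitrary family of presheaves of the right types, indexed by Y.

  Size matters in one place: the points of Y must be elements of the universe type, so the
  presheaves on a small set, of all types together, must form a small set.

  In the quotients, the order is given by the existence of suitable representatives, and
  transitivity is not visible from that. It is replaced by comparison with the largest element of a
  class, which exists because a congruence respects arbitrary joins.\<close>

section \<open>Complete lattices and quantaloids\<close>

text \<open>Joins alone suffice: the meet of a set is the join of its lower bounds. All hom-sets
  below have explicitly known joins, so meets are never computed.\<close>

lemma complete_lattice_SupI:
  fixes L :: "('a, 'b) gorder_scheme"
  assumes eq: "eq L = (=)"
    and refl: "\<And>x. x \<in> carrier L \<Longrightarrow> x \<sqsubseteq>\<^bsub>L\<^esub> x"
    and antisym: "\<And>x y. \<lbrakk>x \<in> carrier L; y \<in> carrier L; x \<sqsubseteq>\<^bsub>L\<^esub> y; y \<sqsubseteq>\<^bsub>L\<^esub> x\<rbrakk> \<Longrightarrow> x = y"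
    and trans: "\<And>x y z. \<lbrakk>x \<in> carrier L; y \<in> carrier L; z \<in> carrier L; x \<sqsubseteq>\<^bsub>L\<^esub> y; y \<sqsubseteq>\<^bsub>L\<^esub> z\<rbrakk>
      \<Longrightarrow> x \<sqsubseteq>\<^bsub>L\<^esub> z"
    and Sup: "\<And>A. A \<subseteq> carrier L \<Longrightarrow> \<exists>s \<in> carrier L. (\<forall>x \<in> A. x \<sqsubseteq>\<^bsub>L\<^esub> s) \<and>
      (\<forall>z \<in> carrier L. (\<forall>x \<in> A. x \<sqsubseteq>\<^bsub>L\<^esub> z) \<longrightarrow> s \<sqsubseteq>\<^bsub>L\<^esub> z)"
  shows "complete_lattice L"
proof -
  interpret partial_order L
    by unfold_locales (auto simp: eq intro: refl antisym trans)
  have sup: "\<exists>s. least L s (Upper L A)" if A: "A \<subseteq> carrier L" for A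
  proof -
    obtain s where "s \<in> carrier L" "\<forall>x \<in> A. x \<sqsubseteq>\<^bsub>L\<^esub> s"
      "\<forall>z \<in> carrier L. (\<forall>x \<in> A. x \<sqsubseteq>\<^bsub>L\<^esub> z) \<longrightarrow> s \<sqsubseteq>\<^bsub>L\<^esub> z"
      using Sup[OF A] by auto
    with A have "least L s (Upper L A)"
      by (intro least_UpperI) (auto simp: Upper_def subset_iff)
    then show ?thesis ..
  qed
  have inf: "\<exists>s. greatest L s (Lower L A)" if A: "A \<subseteq> carrier L" for A
  proof -
    obtain s where s: "s \<in> carrier L" "\<forall>x \<in> Lower L A. x \<sqsubseteq>\<^bsub>L\<^esub> s"
      "\<forall>z \<in> carrier L. (\<forall>x \<in> Lower L A. x \<sqsubseteq>\<^bsub>L\<^esub> z) \<longrightarrow> s \<sqsubseteq>\<^bsub>L\<^esub> z"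
      using Sup[of "Lower L A"] by auto
    have "s \<sqsubseteq>\<^bsub>L\<^esub> x" if "x \<in> A" for x
      using s(3) A that by auto
    with s show ?thesis
      by (intro exI[of _ s] greatest_LowerI) (auto simp: A)
  qed
  show ?thesis
    by unfold_locales (use sup inf in auto)
qed

context complete_lattice
begin

lemma Sup_eqI:
  assumes "A \<subseteq> carrier L" "s \<in> carrier L" "\<And>x. x \<in> A \<Longrightarrow> x \<sqsubseteq> s"
    and "\<And>z. \<lbrakk>z \<in> carrier L; \<And>x. x \<in> A \<Longrightarrow> x \<sqsubseteq> z\<rbrakk> \<Longrightarrow> s \<sqsubseteq> z"
  shows "\<Squnion>A = s"
proof (rule le_antisym)
  show "\<Squnion>A \<sqsubseteq> s"
    by (rule sup_least) (use assms in auto)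
  show "s \<sqsubseteq> \<Squnion>A"
    using assms(1) by (intro assms(4) sup_upper) simp_all
qed (use assms in auto)

text \<open>Turns statements about joins into statements about order: a map that preserves binary
  joins is monotone, and the order of a quotient is itself given by a join.\<close>

lemma le_iff_join:
  assumes "x \<in> carrier L" "y \<in> carrier L"
  shows "x \<sqsubseteq> y \<longleftrightarrow> \<Squnion>{x, y} = y"
proof
  assume "x \<sqsubseteq> y"
  then show "\<Squnion>{x, y} = y"
    using assms by (intro Sup_eqI) auto
next
  assume "\<Squnion>{x, y} = y"
  then show "x \<sqsubseteq> y"
    using sup_upper[of "{x, y}" x] assms by simp
qed

text \<open>This is the pattern of a composite with an identity relation, where every term off the
  diagonal is bottom. Bottom is written as the empty join because preservation of joins produces it
  in that form.\<close>

lemma Sup_single_value: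
  assumes "y \<in> Y" "f y \<in> carrier L" "\<And>x. \<lbrakk>x \<in> Y; x \<noteq> y\<rbrakk> \<Longrightarrow> f x = \<Squnion>{}"
  shows "\<Squnion>(f ` Y) = f y"
proof (rule Sup_eqI)
  have b: "\<Squnion>{} \<in> carrier L" "\<And>z. z \<in> carrier L \<Longrightarrow> \<Squnion>{} \<sqsubseteq> z"
    by (auto intro: sup_least)
  show "f ` Y \<subseteq> carrier L"
    using assms b by (metis image_subsetI)
  show "x \<sqsubseteq> f y" if "x \<in> f ` Y" for x
    using that assms b by (metis imageE le_refl)
qed (use assms in auto)

lemma Sup_UN:
  assumes "\<And>i. i \<in> I \<Longrightarrow> A i \<subseteq> carrier L"
  shows "\<Squnion>(\<Union>i\<in>I. A i) = \<Squnion>((\<lambda>i. \<Squnion>(A i)) ` I)"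
proof (rule Sup_eqI)
  have c: "(\<lambda>i. \<Squnion>(A i)) ` I \<subseteq> carrier L"
    using assms by auto
  then show "\<Squnion>((\<lambda>i. \<Squnion>(A i)) ` I) \<in> carrier L"
    by simp
  show "x \<sqsubseteq> \<Squnion>((\<lambda>i. \<Squnion>(A i)) ` I)" if "x \<in> (\<Union>i\<in>I. A i)" for x
  proof -
    from that obtain i where i: "i \<in> I" "x \<in> A i" by auto
    then have "x \<sqsubseteq> \<Squnion>(A i)"
      using assms by (auto intro: sup_upper)
    also have "\<Squnion>(A i) \<sqsubseteq> \<Squnion>((\<lambda>i. \<Squnion>(A i)) ` I)"
      using i c by (auto intro: sup_upper)
    finally show ?thesis
      using assms i c by (auto simp: subset_iff)
  qed
  show "\<Squnion>((\<lambda>i. \<Squnion>(A i)) ` I) \<sqsubseteq> z"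
    if "z \<in> carrier L" "\<And>x. x \<in> (\<Union>i\<in>I. A i) \<Longrightarrow> x \<sqsubseteq> z" for z
    using that assms by (intro sup_least c) (auto intro!: sup_least)
qed (use assms in auto)

text \<open>Relations compose like matrices, so their associativity and distributivity amount to
  this exchange of joins.\<close>

lemma Sup_Sup_commute:
  assumes "\<And>i j. \<lbrakk>i \<in> I; j \<in> J\<rbrakk> \<Longrightarrow> f i j \<in> carrier L"
  shows "\<Squnion>((\<lambda>i. \<Squnion>(f i ` J)) ` I) = \<Squnion>((\<lambda>j. \<Squnion>((\<lambda>i. f i j) ` I)) ` J)"
proof -
  have "\<Squnion>((\<lambda>i. \<Squnion>(f i ` J)) ` I) = \<Squnion>(\<Union>i\<in>I. f i ` J)"
    by (rule Sup_UN[symmetric]) (use assms in auto)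
  also have "(\<Union>i\<in>I. f i ` J) = (\<Union>j\<in>J. (\<lambda>i. f i j) ` I)"
    by auto
  also have "\<Squnion>\<dots> = \<Squnion>((\<lambda>j. \<Squnion>((\<lambda>i. f i j) ` I)) ` J)"
    by (rule Sup_UN) (use assms in auto)
  finally show ?thesis .
qed

end

context quantaloid
begin

context
  fixes p q
  assumes pq: "p \<in> Ob Q" "q \<in> Ob Q"
begin

interpretation L: complete_lattice "Hom Q p q"
  by (rule hom_complete_lattice[OF pq])

lemma hom_refl: "u \<in> arr Q p q \<Longrightarrow> u \<sqsubseteq>\<^bsub>Hom Q p q\<^esub> u"
  by simp

lemma hom_trans:
  "\<lbrakk>u \<sqsubseteq>\<^bsub>Hom Q p q\<^esub> v; v \<sqsubseteq>\<^bsub>Hom Q p q\<^esub> w; u \<in> arr Q p q; v \<in> arr Q p q; w \<in> arr Q p q\<rbrakk>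
    \<Longrightarrow> u \<sqsubseteq>\<^bsub>Hom Q p q\<^esub> w"
  by (rule L.le_trans)

lemma hom_antisym:
  "\<lbrakk>u \<sqsubseteq>\<^bsub>Hom Q p q\<^esub> v; v \<sqsubseteq>\<^bsub>Hom Q p q\<^esub> u; u \<in> arr Q p q; v \<in> arr Q p q\<rbrakk> \<Longrightarrow> u = v"
  by (rule L.le_antisym)

lemma Sup_closed: "U \<subseteq> arr Q p q \<Longrightarrow> \<Squnion>\<^bsub>Hom Q p q\<^esub> U \<in> arr Q p q"
  by simp

lemma Sup_upper: "\<lbrakk>U \<subseteq> arr Q p q; u \<in> U\<rbrakk> \<Longrightarrow> u \<sqsubseteq>\<^bsub>Hom Q p q\<^esub> \<Squnion>\<^bsub>Hom Q p q\<^esub> U"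
  by (rule L.sup_upper)

lemma Sup_least:
  "\<lbrakk>U \<subseteq> arr Q p q; w \<in> arr Q p q; \<And>u. u \<in> U \<Longrightarrow> u \<sqsubseteq>\<^bsub>Hom Q p q\<^esub> w\<rbrakk>
    \<Longrightarrow> \<Squnion>\<^bsub>Hom Q p q\<^esub> U \<sqsubseteq>\<^bsub>Hom Q p q\<^esub> w"
  by (rule L.sup_least)

lemma bottom_eq_Sup: "\<bottom>\<^bsub>Hom Q p q\<^esub> = \<Squnion>\<^bsub>Hom Q p q\<^esub> {}"
  using L.weak_sup_empty by (simp add: L.eq_is_equal)

lemma bottom_arr: "\<bottom>\<^bsub>Hom Q p q\<^esub> \<in> arr Q p q"
  by simp

end

text \<open>Preservation of the join of the pair \<open>{u, u'}\<close>, which is \<open>u'\<close>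
  itself.\<close>

lemma comp_mono_right:
  assumes "p \<in> Ob Q" "q \<in> Ob Q" "r \<in> Ob Q" "u \<in> arr Q p q" "u' \<in> arr Q p q" "v \<in> arr Q q r"
    and "u \<sqsubseteq>\<^bsub>Hom Q p q\<^esub> u'"
  shows "Comp Q p q r v u \<sqsubseteq>\<^bsub>Hom Q p r\<^esub> Comp Q p q r v u'"
proof -
  have "\<Squnion>\<^bsub>Hom Q p q\<^esub> {u, u'} = u'"
    using complete_lattice.le_iff_join[OF hom_complete_lattice] assms by blast
  then have "Comp Q p q r v u' = \<Squnion>\<^bsub>Hom Q p r\<^esub> {Comp Q p q r v u, Comp Q p q r v u'}"
    using comp_Sup_right[of p q r "{u, u'}" v] assms by simp
  then show ?thesis
    using complete_lattice.le_iff_join[OF hom_complete_lattice] assms comp_closed by metis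
qed

lemma comp_mono_left:
  assumes "p \<in> Ob Q" "q \<in> Ob Q" "r \<in> Ob Q" "u \<in> arr Q p q" "v \<in> arr Q q r" "v' \<in> arr Q q r"
    and "v \<sqsubseteq>\<^bsub>Hom Q q r\<^esub> v'"
  shows "Comp Q p q r v u \<sqsubseteq>\<^bsub>Hom Q p r\<^esub> Comp Q p q r v' u"
proof -
  have "\<Squnion>\<^bsub>Hom Q q r\<^esub> {v, v'} = v'"
    using complete_lattice.le_iff_join[OF hom_complete_lattice] assms by blast
  then have "Comp Q p q r v' u = \<Squnion>\<^bsub>Hom Q p r\<^esub> {Comp Q p q r v u, Comp Q p q r v' u}"
    using comp_Sup_left[of p q r u "{v, v'}"] assms by simp
  then show ?thesis
    using complete_lattice.le_iff_join[OF hom_complete_lattice] assms comp_closed by metis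
qed

lemma comp_bottom_right:
  assumes "p \<in> Ob Q" "q \<in> Ob Q" "r \<in> Ob Q" "v \<in> arr Q q r"
  shows "Comp Q p q r v (\<Squnion>\<^bsub>Hom Q p q\<^esub> {}) = \<Squnion>\<^bsub>Hom Q p r\<^esub> {}"
  using comp_Sup_right[of p q r "{}" v] assms by simp

lemma comp_bottom_left:
  assumes "p \<in> Ob Q" "q \<in> Ob Q" "r \<in> Ob Q" "u \<in> arr Q p q"
  shows "Comp Q p q r (\<Squnion>\<^bsub>Hom Q q r\<^esub> {}) u = \<Squnion>\<^bsub>Hom Q p r\<^esub> {}"
  using comp_Sup_left[of p q r u "{}"] assms by simp

text \<open>The residual is the join of all \<open>v\<close> whose composite with \<open>u\<close>
  lies below \<open>w\<close>. Since composition preserves joins, this join again has that property.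
  Antisymmetry makes it the only candidate, so the definite description in \<open>lres\<close> is
  meaningful.\<close>

lemma lres:
  assumes ob: "p \<in> Ob Q" "q \<in> Ob Q" "r \<in> Ob Q" and u: "u \<in> arr Q p q" and w: "w \<in> arr Q p r"
  shows lres_closed: "lres Q p q r w u \<in> arr Q q r"
    and le_lres_iff: "v \<in> arr Q q r \<Longrightarrow>
      v \<sqsubseteq>\<^bsub>Hom Q q r\<^esub> lres Q p q r w u \<longleftrightarrow> Comp Q p q r v u \<sqsubseteq>\<^bsub>Hom Q p r\<^esub> w"
proof -
  define V where "V = {v \<in> arr Q q r. Comp Q p q r v u \<sqsubseteq>\<^bsub>Hom Q p r\<^esub> w}"
  define x where "x = \<Squnion>\<^bsub>Hom Q q r\<^esub> V"
  have V: "V \<subseteq> arr Q q r" by (auto simp: V_def)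
  then have x: "x \<in> arr Q q r" by (auto simp: x_def ob Sup_closed)
  have "Comp Q p q r x u \<sqsubseteq>\<^bsub>Hom Q p r\<^esub> w"
    unfolding x_def comp_Sup_left[OF ob u V] using V
    by (intro Sup_least) (auto simp: ob w V_def intro!: comp_closed u)
  then have iff: "Comp Q p q r v u \<sqsubseteq>\<^bsub>Hom Q p r\<^esub> w \<longleftrightarrow> v \<sqsubseteq>\<^bsub>Hom Q q r\<^esub> x"
    if "v \<in> arr Q q r" for v
    using that V x ob u w
    by (auto simp: x_def V_def intro: Sup_upper
        intro: hom_trans[OF _ _ comp_mono_left[of p q r u v]] comp_closed)
  have "lres Q p q r w u = x"
    unfolding lres_def
  proof (rule the_equality)
    fix y assume y: "y \<in> arr Q q r \<and> (\<forall>v \<in> arr Q q r.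
        Comp Q p q r v u \<sqsubseteq>\<^bsub>Hom Q p r\<^esub> w \<longleftrightarrow> v \<sqsubseteq>\<^bsub>Hom Q q r\<^esub> y)"
    then show "y = x"
      using iff x ob by (meson hom_antisym hom_refl)
  qed (use iff x in auto)
  then show "lres Q p q r w u \<in> arr Q q r" "v \<in> arr Q q r \<Longrightarrow>
      v \<sqsubseteq>\<^bsub>Hom Q q r\<^esub> lres Q p q r w u \<longleftrightarrow> Comp Q p q r v u \<sqsubseteq>\<^bsub>Hom Q p r\<^esub> w"
    using iff x by auto
qed

lemma comp_lres_le:
  assumes "p \<in> Ob Q" "q \<in> Ob Q" "r \<in> Ob Q" "u \<in> arr Q p q" "w \<in> arr Q p r"
  shows "Comp Q p q r (lres Q p q r w u) u \<sqsubseteq>\<^bsub>Hom Q p r\<^esub> w"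
  by (rule le_lres_iff[THEN iffD1]) (simp_all add: assms lres_closed hom_refl)

end

section \<open>Quotients by congruences\<close>

text \<open>In \<open>Sup_cong\<close>, a set \<open>T\<close> of related pairs plays the role of
  two related families indexed by \<open>T\<close> itself, so no index type is needed.\<close>

locale quantaloid_congruence = quantaloid Q for Q :: "('o, 'a) qtld" +
  fixes R :: "'o \<Rightarrow> 'o \<Rightarrow> ('a \<times> 'a) set"
  assumes equiv: "\<lbrakk>p \<in> Ob Q; q \<in> Ob Q\<rbrakk> \<Longrightarrow> equiv (arr Q p q) (R p q)"
    and comp_cong: "\<lbrakk>p \<in> Ob Q; q \<in> Ob Q; r \<in> Ob Q; (u, u') \<in> R p q; (v, v') \<in> R q r\<rbrakk>
      \<Longrightarrow> (Comp Q p q r v u, Comp Q p q r v' u') \<in> R p r"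
    and Sup_cong: "\<lbrakk>p \<in> Ob Q; q \<in> Ob Q; T \<subseteq> R p q\<rbrakk>
      \<Longrightarrow> (\<Squnion>\<^bsub>Hom Q p q\<^esub> (fst ` T), \<Squnion>\<^bsub>Hom Q p q\<^esub> (snd ` T)) \<in> R p q"
begin

abbreviation cls :: "'o \<Rightarrow> 'o \<Rightarrow> 'a \<Rightarrow> 'a set" where
  "cls p q u \<equiv> R p q `` {u}"

text \<open>The order of the quotient is that of the largest elements of the classes; this makes it a
  complete lattice without any choice of representatives.\<close>

definition cls_top :: "'o \<Rightarrow> 'o \<Rightarrow> 'a \<Rightarrow> 'a" where
  "cls_top p q u = \<Squnion>\<^bsub>Hom Q p q\<^esub> (cls p q u)"

lemma arr_Quot: "arr (Quot Q R) p q = cls p q ` arr Q p q"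
  by (auto simp: Quot_def quotient_def)

lemma Ob_Quot: "Ob (Quot Q R) = Ob Q"
  by (simp add: Quot_def)

lemma One_Quot: "One (Quot Q R) p = cls p p (One Q p)"
  by (simp add: Quot_def)

context
  fixes p q
  assumes pq: "p \<in> Ob Q" "q \<in> Ob Q"
begin

interpretation L: complete_lattice "Hom Q p q"
  by (rule hom_complete_lattice[OF pq])

lemma rel_arr: "(u, v) \<in> R p q \<Longrightarrow> u \<in> arr Q p q \<and> v \<in> arr Q p q"
  using equiv[OF pq] by (auto simp: equiv_def)

lemma rel_refl: "u \<in> arr Q p q \<Longrightarrow> (u, u) \<in> R p q"
  using equiv[OF pq] by (auto simp: equiv_def refl_on_def)

lemma rel_sym: "(u, v) \<in> R p q \<Longrightarrow> (v, u) \<in> R p q"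
  using equiv[OF pq] by (auto simp: equiv_def sym_def)

lemma rel_trans: "\<lbrakk>(u, v) \<in> R p q; (v, w) \<in> R p q\<rbrakk> \<Longrightarrow> (u, w) \<in> R p q"
  using equiv[OF pq] by (auto simp: equiv_def trans_def)

lemma cls_eq_iff: "\<lbrakk>u \<in> arr Q p q; v \<in> arr Q p q\<rbrakk> \<Longrightarrow> cls p q u = cls p q v \<longleftrightarrow> (u, v) \<in> R p q"
  using eq_equiv_class_iff[OF equiv[OF pq]] by blast

lemma rel_Sup_pair:
  assumes "(u, u') \<in> R p q" "(v, v') \<in> R p q"
  shows "(\<Squnion>\<^bsub>Hom Q p q\<^esub> {u, v}, \<Squnion>\<^bsub>Hom Q p q\<^esub> {u', v'}) \<in> R p q"
  using Sup_cong[OF pq, of "{(u, u'), (v, v')}"] assms by simp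

lemma cls_subset: "cls p q u \<subseteq> arr Q p q"
  using rel_arr by blast

lemma cls_top_arr: "cls_top p q u \<in> arr Q p q"
  unfolding cls_top_def using cls_subset by (intro L.sup_closed)

lemma le_cls_top: "(u, v) \<in> R p q \<Longrightarrow> v \<sqsubseteq>\<^bsub>Hom Q p q\<^esub> cls_top p q u"
  unfolding cls_top_def using cls_subset by (intro L.sup_upper) auto

text \<open>Pair the constant family \<open>u\<close> with all members of its class and take joins.
  The class must be nonempty, for otherwise the constant family would have bottom as its
  join.\<close>

lemma rel_cls_top:
  assumes "u \<in> arr Q p q"
  shows "(u, cls_top p q u) \<in> R p q"
proof -
  have "(\<Squnion>\<^bsub>Hom Q p q\<^esub> (fst ` ({u} \<times> cls p q u)), \<Squnion>\<^bsub>Hom Q p q\<^esub> (snd ` ({u} \<times> cls p q u))) \<in> R p q"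
    by (rule Sup_cong[OF pq]) auto
  moreover have "cls p q u \<noteq> {}"
    using rel_refl[OF assms] by blast
  ultimately show ?thesis
    using assms by (simp add: cls_top_def)
qed

lemma cls_top_cong: "(u, v) \<in> R p q \<Longrightarrow> cls_top p q u = cls_top p q v"
  using equiv_class_eq[OF equiv[OF pq]] by (auto simp: cls_top_def)

text \<open>Makes \<open>cls_top\<close> a closure operator. If \<open>u\<close> is absorbed by the
  largest element of the class of \<open>v\<close>, then replacing \<open>u\<close> by the congruent
  \<open>cls_top p q u\<close> leaves the join in that class, hence below its largest
  element.\<close>

lemma cls_top_le:
  assumes "u \<in> arr Q p q" "v \<in> arr Q p q" "u \<sqsubseteq>\<^bsub>Hom Q p q\<^esub> cls_top p q v"
  shows "cls_top p q u \<sqsubseteq>\<^bsub>Hom Q p q\<^esub> cls_top p q v"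
proof -
  have "\<Squnion>\<^bsub>Hom Q p q\<^esub> {u, cls_top p q v} = cls_top p q v"
    using assms L.le_iff_join cls_top_arr by blast
  then have "(v, \<Squnion>\<^bsub>Hom Q p q\<^esub> {cls_top p q u, cls_top p q v}) \<in> R p q"
    using rel_Sup_pair[OF rel_cls_top rel_refl, of u "cls_top p q v"] rel_cls_top[of v]
      rel_trans assms cls_top_arr by metis
  then have "\<Squnion>\<^bsub>Hom Q p q\<^esub> {cls_top p q u, cls_top p q v} \<sqsubseteq>\<^bsub>Hom Q p q\<^esub> cls_top p q v"
    by (rule le_cls_top)
  moreover have "cls_top p q u \<sqsubseteq>\<^bsub>Hom Q p q\<^esub> \<Squnion>\<^bsub>Hom Q p q\<^esub> {cls_top p q u, cls_top p q v}"
    using cls_top_arr by (intro L.sup_upper) auto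
  ultimately show ?thesis
    using cls_top_arr by (meson L.le_trans L.sup_closed empty_subsetI insert_subset)
qed

text \<open>If some \<open>u'\<close> in the class of \<open>u\<close> has its join with a member of
  the class of \<open>v\<close> in the latter class, then \<open>u'\<close> is below the largest
  element there, and \<open>cls_top_le\<close> passes from \<open>u'\<close> to \<open>u\<close>.
  Conversely \<open>u\<close> and \<open>cls_top p q v\<close> are suitable representatives.
  Reflexivity, transitivity and joins of the quotient are all read off from this form.\<close>

lemma le_Quot:
  assumes u: "u \<in> arr Q p q" and v: "v \<in> arr Q p q"
  shows "cls p q u \<sqsubseteq>\<^bsub>Hom (Quot Q R) p q\<^esub> cls p q v \<longleftrightarrow> u \<sqsubseteq>\<^bsub>Hom Q p q\<^esub> cls_top p q v"
proof -
  have "u \<sqsubseteq>\<^bsub>Hom Q p q\<^esub> cls_top p q v"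
    if "(u, u') \<in> R p q" "(v, v') \<in> R p q" "(v, \<Squnion>\<^bsub>Hom Q p q\<^esub> {u', v'}) \<in> R p q" for u' v'
  proof -
    have a: "u' \<in> arr Q p q" "v' \<in> arr Q p q"
      using that rel_arr by auto
    have "u' \<sqsubseteq>\<^bsub>Hom Q p q\<^esub> \<Squnion>\<^bsub>Hom Q p q\<^esub> {u', v'}"
      using a by (intro L.sup_upper) auto
    then have "u' \<sqsubseteq>\<^bsub>Hom Q p q\<^esub> cls_top p q v"
      using le_cls_top[OF that(3)] a cls_top_arr
      by (meson L.le_trans L.sup_closed empty_subsetI insert_subset)
    then have "cls_top p q u \<sqsubseteq>\<^bsub>Hom Q p q\<^esub> cls_top p q v"
      using cls_top_le a v cls_top_cong[OF that(1)] by simp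
    then show ?thesis
      using le_cls_top[OF rel_refl[OF u]] u cls_top_arr by (meson L.le_trans)
  qed
  moreover have "\<exists>u' \<in> cls p q u. \<exists>v' \<in> cls p q v. \<Squnion>\<^bsub>Hom Q p q\<^esub> {u', v'} \<in> cls p q v"
    if "u \<sqsubseteq>\<^bsub>Hom Q p q\<^esub> cls_top p q v"
  proof (intro bexI)
    show "\<Squnion>\<^bsub>Hom Q p q\<^esub> {u, cls_top p q v} \<in> cls p q v"
      using that L.le_iff_join u v cls_top_arr rel_cls_top by auto
  qed (use u v rel_refl rel_cls_top in auto)
  ultimately show ?thesis
    by (auto simp: Quot_def join_def)
qed

lemma Quot_Sup_aux:
  assumes B: "B \<subseteq> arr Q p q"
  shows "\<And>u. u \<in> B \<Longrightarrow> cls p q u \<sqsubseteq>\<^bsub>Hom (Quot Q R) p q\<^esub> cls p q (\<Squnion>\<^bsub>Hom Q p q\<^esub> B)"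
    and "\<And>v. \<lbrakk>v \<in> arr Q p q; \<And>u. u \<in> B \<Longrightarrow> cls p q u \<sqsubseteq>\<^bsub>Hom (Quot Q R) p q\<^esub> cls p q v\<rbrakk>
      \<Longrightarrow> cls p q (\<Squnion>\<^bsub>Hom Q p q\<^esub> B) \<sqsubseteq>\<^bsub>Hom (Quot Q R) p q\<^esub> cls p q v"
proof -
  have s: "\<Squnion>\<^bsub>Hom Q p q\<^esub> B \<in> arr Q p q"
    using B by simp
  show "cls p q u \<sqsubseteq>\<^bsub>Hom (Quot Q R) p q\<^esub> cls p q (\<Squnion>\<^bsub>Hom Q p q\<^esub> B)" if "u \<in> B" for u
  proof -
    have "u \<sqsubseteq>\<^bsub>Hom Q p q\<^esub> \<Squnion>\<^bsub>Hom Q p q\<^esub> B"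
      by (rule L.sup_upper[OF B that])
    then show ?thesis
      using le_cls_top[OF rel_refl[OF s]] s B that le_Quot cls_top_arr by (meson L.le_trans subsetD)
  qed
  show "cls p q (\<Squnion>\<^bsub>Hom Q p q\<^esub> B) \<sqsubseteq>\<^bsub>Hom (Quot Q R) p q\<^esub> cls p q v"
    if v: "v \<in> arr Q p q" and ub: "\<And>u. u \<in> B \<Longrightarrow> cls p q u \<sqsubseteq>\<^bsub>Hom (Quot Q R) p q\<^esub> cls p q v"
    for v
  proof -
    have "u \<sqsubseteq>\<^bsub>Hom Q p q\<^esub> cls_top p q v" if "u \<in> B" for u
      using ub[OF that] le_Quot that B v by auto
    then show ?thesis
      using v le_Quot s B cls_top_arr by (auto intro: L.sup_least)
  qed
qed

lemma Quot_complete_lattice: "complete_lattice (Hom (Quot Q R) p q)"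
proof (rule complete_lattice_SupI)
  show "eq (Hom (Quot Q R) p q) = (=)"
    by (simp add: Quot_def)
  show "x \<sqsubseteq>\<^bsub>Hom (Quot Q R) p q\<^esub> x" if "x \<in> arr (Quot Q R) p q" for x
    using that le_cls_top rel_refl by (auto simp: arr_Quot le_Quot)
  show "x = y" if "x \<in> arr (Quot Q R) p q" "y \<in> arr (Quot Q R) p q"
    "x \<sqsubseteq>\<^bsub>Hom (Quot Q R) p q\<^esub> y" "y \<sqsubseteq>\<^bsub>Hom (Quot Q R) p q\<^esub> x" for x y
  proof -
    from that obtain u v where uv: "u \<in> arr Q p q" "v \<in> arr Q p q" "x = cls p q u" "y = cls p q v"
      by (auto simp: arr_Quot)
    then have "cls_top p q u = cls_top p q v"
      using that by (auto simp: le_Quot intro!: L.le_antisym cls_top_le cls_top_arr)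
    then show ?thesis
      using uv rel_cls_top rel_sym rel_trans by (metis cls_eq_iff)
  qed
  show "x \<sqsubseteq>\<^bsub>Hom (Quot Q R) p q\<^esub> z" if "x \<in> arr (Quot Q R) p q" "y \<in> arr (Quot Q R) p q"
    "z \<in> arr (Quot Q R) p q"
    "x \<sqsubseteq>\<^bsub>Hom (Quot Q R) p q\<^esub> y" "y \<sqsubseteq>\<^bsub>Hom (Quot Q R) p q\<^esub> z" for x y z
    using that cls_top_le cls_top_arr by (auto simp: arr_Quot le_Quot) (meson L.le_trans)
  show "\<exists>s \<in> arr (Quot Q R) p q. (\<forall>x \<in> U. x \<sqsubseteq>\<^bsub>Hom (Quot Q R) p q\<^esub> s) \<and>
      (\<forall>z \<in> arr (Quot Q R) p q. (\<forall>x \<in> U. x \<sqsubseteq>\<^bsub>Hom (Quot Q R) p q\<^esub> z) \<longrightarrow>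
        s \<sqsubseteq>\<^bsub>Hom (Quot Q R) p q\<^esub> z)"
    if U: "U \<subseteq> arr (Quot Q R) p q" for U
  proof -
    from U obtain B where B: "B \<subseteq> arr Q p q" "U = cls p q ` B"
      by (metis arr_Quot subset_imageE)
    then have "\<Squnion>\<^bsub>Hom Q p q\<^esub> B \<in> arr Q p q"
      by simp
    then show ?thesis
      using Quot_Sup_aux[OF B(1)] B(2)
      by (intro bexI[of _ "cls p q (\<Squnion>\<^bsub>Hom Q p q\<^esub> B)"]) (auto simp: arr_Quot)
  qed
qed

lemma Sup_Quot:
  assumes B: "B \<subseteq> arr Q p q"
  shows "\<Squnion>\<^bsub>Hom (Quot Q R) p q\<^esub> (cls p q ` B) = cls p q (\<Squnion>\<^bsub>Hom Q p q\<^esub> B)"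
proof -
  interpret C: complete_lattice "Hom (Quot Q R) p q"
    by (rule Quot_complete_lattice)
  have "\<Squnion>\<^bsub>Hom Q p q\<^esub> B \<in> arr Q p q"
    using B by simp
  then show ?thesis
    using B Quot_Sup_aux[OF B] by (intro C.Sup_eqI) (auto simp: arr_Quot)
qed

end

lemma Comp_Quot:
  assumes ob: "p \<in> Ob Q" "q \<in> Ob Q" "r \<in> Ob Q" and u: "u \<in> arr Q p q" and v: "v \<in> arr Q q r"
  shows "Comp (Quot Q R) p q r (cls q r v) (cls p q u) = cls p r (Comp Q p q r v u)"
proof -
  have eq: "cls p r (Comp Q p q r v' u') = cls p r (Comp Q p q r v u)"
    if "u' \<in> cls p q u" "v' \<in> cls q r v" for u' v'
    using comp_cong[OF ob, of u u' v v'] rel_arr[OF ob(1,3)] cls_eq_iff[OF ob(1,3)] that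
    by (metis Image_singleton_iff)
  \<comment> \<open>The double union is that of a constant family, so it has the expected value only
    if both index sets are inhabited.\<close>
  have ne: "cls p q u \<noteq> {}" "cls q r v \<noteq> {}"
    using u v ob rel_refl by blast+
  have "Comp (Quot Q R) p q r (cls q r v) (cls p q u)
      = (\<Union>v' \<in> cls q r v. \<Union>u' \<in> cls p q u. cls p r (Comp Q p q r v' u'))"
    by (simp add: Quot_def)
  also have "\<dots> = (\<Union>v' \<in> cls q r v. \<Union>u' \<in> cls p q u. cls p r (Comp Q p q r v u))"
    by (intro SUP_cong refl eq)
  also have "\<dots> = cls p r (Comp Q p q r v u)"
    using ne by (simp only: UN_constant if_False)
  finally show ?thesis .
qed

lemma quantaloid_Quot: "quantaloid (Quot Q R)"
proof (rule quantaloid.intro)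
  fix p q r U v
  assume ob: "p \<in> Ob (Quot Q R)" "q \<in> Ob (Quot Q R)" "r \<in> Ob (Quot Q R)"
    and U: "U \<subseteq> arr (Quot Q R) p q" and v: "v \<in> arr (Quot Q R) q r"
  note ob = ob[unfolded Ob_Quot]
  from U obtain B where B: "B \<subseteq> arr Q p q" "U = cls p q ` B"
    by (metis arr_Quot subset_imageE)
  from v obtain w where w: "w \<in> arr Q q r" "v = cls q r w"
    by (auto simp: arr_Quot)
  have "Comp (Quot Q R) p q r v (\<Squnion>\<^bsub>Hom (Quot Q R) p q\<^esub> U)
      = cls p r (Comp Q p q r w (\<Squnion>\<^bsub>Hom Q p q\<^esub> B))"
    by (simp add: B w ob Sup_Quot Comp_Quot Sup_closed)
  also have "\<dots> = \<Squnion>\<^bsub>Hom (Quot Q R) p r\<^esub> (cls p r ` Comp Q p q r w ` B)"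
    using B w ob by (subst Sup_Quot) (auto simp: comp_Sup_right intro!: comp_closed)
  also have "cls p r ` Comp Q p q r w ` B = Comp (Quot Q R) p q r v ` U"
    using B w ob by (auto simp: image_image Comp_Quot subset_iff intro!: image_cong)
  finally show "Comp (Quot Q R) p q r v (\<Squnion>\<^bsub>Hom (Quot Q R) p q\<^esub> U)
      = \<Squnion>\<^bsub>Hom (Quot Q R) p r\<^esub> (Comp (Quot Q R) p q r v ` U)" .
next
  fix p q r u V
  assume ob: "p \<in> Ob (Quot Q R)" "q \<in> Ob (Quot Q R)" "r \<in> Ob (Quot Q R)"
    and u: "u \<in> arr (Quot Q R) p q" and V: "V \<subseteq> arr (Quot Q R) q r"
  note ob = ob[unfolded Ob_Quot]
  from V obtain B where B: "B \<subseteq> arr Q q r" "V = cls q r ` B"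
    by (metis arr_Quot subset_imageE)
  from u obtain w where w: "w \<in> arr Q p q" "u = cls p q w"
    by (auto simp: arr_Quot)
  have "Comp (Quot Q R) p q r (\<Squnion>\<^bsub>Hom (Quot Q R) q r\<^esub> V) u
      = cls p r (Comp Q p q r (\<Squnion>\<^bsub>Hom Q q r\<^esub> B) w)"
    by (simp add: B w ob Sup_Quot Comp_Quot Sup_closed)
  also have "\<dots> = \<Squnion>\<^bsub>Hom (Quot Q R) p r\<^esub> (cls p r ` (\<lambda>v. Comp Q p q r v w) ` B)"
    using B w ob by (subst Sup_Quot) (auto simp: comp_Sup_left intro!: comp_closed)
  also have "cls p r ` (\<lambda>v. Comp Q p q r v w) ` B = (\<lambda>v. Comp (Quot Q R) p q r v u) ` V"
    using B w ob by (auto simp: image_image Comp_Quot subset_iff intro!: image_cong)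
  finally show "Comp (Quot Q R) p q r (\<Squnion>\<^bsub>Hom (Quot Q R) q r\<^esub> V) u
      = \<Squnion>\<^bsub>Hom (Quot Q R) p r\<^esub> ((\<lambda>v. Comp (Quot Q R) p q r v u) ` V)" .
qed (auto simp: Ob_Quot arr_Quot One_Quot Comp_Quot comp_closed one_closed comp_assoc
    comp_one_left comp_one_right Quot_complete_lattice)

end

section \<open>Functors that are full, faithful and surjective on objects\<close>

text \<open>The inverse functor picks a preimage \<open>g b\<close> of each object and transports
  arrows through the bijections of hom-sets. Every equation in the domain is verified after applying
  \<open>F\<close>, which is faithful. Strict surjectivity on objects makes the composite on the
  codomain side the identity functor exactly.\<close>

lemma category_equivalence_if_bij:
  fixes A :: "('o1, 'a1) qtld" and B :: "('o2, 'a2) qtld"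
  assumes A: "quantaloid A" and B: "quantaloid B" and F: "is_functor A B F"
    and surj: "\<And>b. b \<in> Ob B \<Longrightarrow> \<exists>p \<in> Ob A. omap F p = b"
    and bij: "\<And>p q. \<lbrakk>p \<in> Ob A; q \<in> Ob A\<rbrakk>
      \<Longrightarrow> bij_betw (amap F p q) (arr A p q) (arr B (omap F p) (omap F q))"
  shows "is_category_equivalence A B F"
proof -
  interpret A: quantaloid A by (rule A)
  interpret B: quantaloid B by (rule B)
  define g where "g b = (SOME p. p \<in> Ob A \<and> omap F p = b)" for b
  define h where "h p q = the_inv_into (arr A p q) (amap F p q)" for p q
  define G :: "('o2, 'a2, 'o1, 'a1) qfun"
    where "G = \<lparr>omap = g, amap = (\<lambda>b c. h (g b) (g c))\<rparr>"
  have g: "g b \<in> Ob A" "omap F (g b) = b" if "b \<in> Ob B" for b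
    using someI_ex[of "\<lambda>p. p \<in> Ob A \<and> omap F p = b"] surj[OF that] by (auto simp: g_def)
  have Fob: "omap F p \<in> Ob B" if "p \<in> Ob A" for p
    using F that by (auto simp: is_functor_def)
  have Farr: "amap F p q u \<in> arr B (omap F p) (omap F q)"
    if "p \<in> Ob A" "q \<in> Ob A" "u \<in> arr A p q" for p q u
    using F that by (auto simp: is_functor_def)
  have Fcomp: "amap F p r (Comp A p q r v u)
      = Comp B (omap F p) (omap F q) (omap F r) (amap F q r v) (amap F p q u)"
    if "p \<in> Ob A" "q \<in> Ob A" "r \<in> Ob A" "u \<in> arr A p q" "v \<in> arr A q r" for p q r u v
    using F that by (auto simp: is_functor_def)
  have Fone: "amap F p p (One A p) = One B (omap F p)" if "p \<in> Ob A" for p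
    using F that by (auto simp: is_functor_def)
  have h: "h p q v \<in> arr A p q" "amap F p q (h p q v) = v"
    if "p \<in> Ob A" "q \<in> Ob A" "v \<in> arr B (omap F p) (omap F q)" for p q v
    using bij[OF that(1,2)] that(3) unfolding h_def bij_betw_def
    by (auto intro: the_inv_into_into f_the_inv_into_f)
  have F_inj: "u = v" if "p \<in> Ob A" "q \<in> Ob A" "u \<in> arr A p q" "v \<in> arr A p q"
    "amap F p q u = amap F p q v" for p q u v
    using bij[OF that(1,2)] that(3-5) by (auto simp: bij_betw_def inj_on_def)
  have G_one: "h (g b) (g b) (One B b) = One A (g b)" if "b \<in> Ob B" for b
    using that by (intro F_inj[of "g b" "g b"]) (simp_all add: g h B.one_closed A.one_closed Fone)
  have G_comp: "h (g b) (g d) (Comp B b c d v u)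
      = Comp A (g b) (g c) (g d) (h (g c) (g d) v) (h (g b) (g c) u)"
    if "b \<in> Ob B" "c \<in> Ob B" "d \<in> Ob B" "u \<in> arr B b c" "v \<in> arr B c d" for b c d u v
    using that
    by (intro F_inj[of "g b" "g d"]) (simp_all add: g h B.comp_closed A.comp_closed Fcomp)
  have G: "is_functor B A G"
    unfolding is_functor_def G_def by (simp add: g h G_one G_comp)
  have unit: "naturally_isomorphic A A id_functor (comp_functor G F)"
    unfolding naturally_isomorphic_def
  proof (intro exI conjI ballI)
    let ?k = "\<lambda>p. g (omap F p)"
    \<comment> \<open>The objects \<open>p\<close> and \<open>?k p\<close> have the same image under
      \<open>F\<close>, so the identity of that image lifts in both directions; the two lifts are
      mutually inverse.\<close>
    let ?s = "\<lambda>p. h p (?k p) (One B (omap F p))" and ?t = "\<lambda>p. h (?k p) p (One B (omap F p))"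
    have k: "?k p \<in> Ob A" "omap F (?k p) = omap F p" if "p \<in> Ob A" for p
      using that g Fob by auto
    have s: "?s p \<in> arr A p (?k p)" "amap F p (?k p) (?s p) = One B (omap F p)"
      "?t p \<in> arr A (?k p) p" "amap F (?k p) p (?t p) = One B (omap F p)" if "p \<in> Ob A" for p
      using that k h Fob B.one_closed by auto
    show "is_iso A (omap id_functor p) (omap (comp_functor G F) p) (?s p)" if p: "p \<in> Ob A" for p
    proof -
      have "Comp A p (?k p) p (?t p) (?s p) = One A p"
        using p by (intro F_inj[of p p])
          (simp_all add: k s Fob B.one_closed B.comp_one_left Fcomp Fone A.one_closed A.comp_closed)
      moreover have "Comp A (?k p) p (?k p) (?s p) (?t p) = One A (?k p)"
        using p by (intro F_inj[of "?k p" "?k p"])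
          (simp_all add: k s Fob B.one_closed B.comp_one_left Fcomp Fone A.one_closed A.comp_closed)
      ultimately show ?thesis
        using s[OF p] by (auto simp: is_iso_def id_functor_def comp_functor_def G_def)
    qed
    show "Comp A (omap id_functor p) (omap id_functor q) (omap (comp_functor G F) q)
          (?s q) (amap id_functor p q u)
        = Comp A (omap id_functor p) (omap (comp_functor G F) p) (omap (comp_functor G F) q)
          (amap (comp_functor G F) p q u) (?s p)"
      if "p \<in> Ob A" "q \<in> Ob A" "u \<in> arr A p q" for p q u
      unfolding id_functor_def comp_functor_def G_def qfun.simps using that
      by (intro F_inj[of p "?k q"]) (simp_all add: k s h Fob B.comp_one_left B.comp_one_right
          Fcomp Farr A.comp_closed)
  qed
  \<comment> \<open>Since \<open>g\<close> is a section of the object map and \<open>h\<close> of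
    the arrow maps, identities serve as components.\<close>
  have counit: "naturally_isomorphic B B (comp_functor F G) id_functor"
    unfolding naturally_isomorphic_def
    by (rule exI[of _ "One B"])
      (auto simp: is_iso_def id_functor_def comp_functor_def G_def g h B.one_closed
        B.comp_one_left B.comp_one_right intro!: bexI[of _ "One B _"])
  from F G unit counit show ?thesis
    unfolding is_category_equivalence_def by blast
qed

text \<open>Of the equivalence in \<open>cong\<close>, one direction makes the induced functor well
  defined on classes and the other makes it faithful. Fullness on representatives gives fullness on
  classes.\<close>

lemma equivalent_Quot:
  fixes A :: "('o1, 'a1) qtld" and B :: "('o2, 'a2) qtld"
  assumes A: "quantaloid_congruence A R" and B: "quantaloid_congruence B S"
    and F: "is_quantaloid_hom A B F"
    and surj: "\<And>b. b \<in> Ob B \<Longrightarrow> \<exists>p \<in> Ob A. omap F p = b"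
    and full: "\<And>p q v. \<lbrakk>p \<in> Ob A; q \<in> Ob A; v \<in> arr B (omap F p) (omap F q)\<rbrakk>
      \<Longrightarrow> \<exists>u \<in> arr A p q. amap F p q u = v"
    and cong: "\<And>p q u v. \<lbrakk>p \<in> Ob A; q \<in> Ob A; u \<in> arr A p q; v \<in> arr A p q\<rbrakk>
      \<Longrightarrow> (amap F p q u, amap F p q v) \<in> S (omap F p) (omap F q) \<longleftrightarrow> (u, v) \<in> R p q"
  shows "equivalent_quantaloids (Quot A R) (Quot B S)"
proof -
  interpret A: quantaloid_congruence A R by (rule A)
  interpret B: quantaloid_congruence B S by (rule B)
  \<comment> \<open>The image of a class is saturated under \<open>S\<close>, which avoids choosing
    representatives; \<open>aH\<close> shows that the result is a single class.\<close>
  define H :: "('o1, 'a1 set, 'o2, 'a2 set) qfun"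
    where "H = \<lparr>omap = omap F, amap = (\<lambda>p q U. S (omap F p) (omap F q) `` (amap F p q ` U))\<rparr>"
  have oH: "omap H = omap F"
    by (simp add: H_def)
  have Fun: "is_functor A B F"
    using F by (simp add: is_quantaloid_hom_def)
  have Fob: "omap F p \<in> Ob B" if "p \<in> Ob A" for p
    using Fun that by (auto simp: is_functor_def)
  have Farr: "amap F p q u \<in> arr B (omap F p) (omap F q)"
    if "p \<in> Ob A" "q \<in> Ob A" "u \<in> arr A p q" for p q u
    using Fun that by (auto simp: is_functor_def)
  have Fcomp: "amap F p r (Comp A p q r v u)
      = Comp B (omap F p) (omap F q) (omap F r) (amap F q r v) (amap F p q u)"
    if "p \<in> Ob A" "q \<in> Ob A" "r \<in> Ob A" "u \<in> arr A p q" "v \<in> arr A q r" for p q r u v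
    using Fun that by (auto simp: is_functor_def)
  have Fone: "amap F p p (One A p) = One B (omap F p)" if "p \<in> Ob A" for p
    using Fun that by (auto simp: is_functor_def)
  have Fsup: "amap F p q (\<Squnion>\<^bsub>Hom A p q\<^esub> U) = \<Squnion>\<^bsub>Hom B (omap F p) (omap F q)\<^esub> (amap F p q ` U)"
    if "p \<in> Ob A" "q \<in> Ob A" "U \<subseteq> arr A p q" for p q U
    using F that by (auto simp: is_quantaloid_hom_def)
  have aH: "amap H p q (A.cls p q u) = B.cls (omap F p) (omap F q) (amap F p q u)"
    if pq: "p \<in> Ob A" "q \<in> Ob A" and u: "u \<in> arr A p q" for p q u
  proof -
    have "(amap F p q u, w) \<in> S (omap F p) (omap F q)"
      if "(u, v) \<in> R p q" "(amap F p q v, w) \<in> S (omap F p) (omap F q)" for v w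
      using that cong[OF pq u] A.rel_arr[OF pq] B.rel_trans[OF Fob Fob, OF pq] by blast
    then show ?thesis
      using A.rel_refl[OF pq u] by (auto simp: H_def)
  qed
  have "is_functor (Quot A R) (Quot B S) H"
    unfolding is_functor_def
    by (auto simp: oH aH A.Ob_Quot B.Ob_Quot A.arr_Quot B.arr_Quot Fob Farr A.One_Quot B.One_Quot
        A.one_closed Fone A.Comp_Quot B.Comp_Quot Fcomp A.comp_closed)
  moreover have "amap H p q (\<Squnion>\<^bsub>Hom (Quot A R) p q\<^esub> U)
      = \<Squnion>\<^bsub>Hom (Quot B S) (omap H p) (omap H q)\<^esub> (amap H p q ` U)"
    if pq: "p \<in> Ob A" "q \<in> Ob A" and U: "U \<subseteq> arr (Quot A R) p q" for p q U
  proof -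
    from U obtain C where C: "C \<subseteq> arr A p q" "U = A.cls p q ` C"
      by (metis A.arr_Quot subset_imageE)
    have "amap H p q ` U = B.cls (omap F p) (omap F q) ` amap F p q ` C"
      using C pq by (auto simp: image_image aH subset_iff intro!: image_cong)
    moreover have "amap F p q ` C \<subseteq> arr B (omap F p) (omap F q)"
      using C pq Farr by auto
    ultimately show ?thesis
      using C pq by (simp add: A.Sup_Quot B.Sup_Quot Fob oH aH A.Sup_closed Fsup)
  qed
  ultimately have hom: "is_quantaloid_hom (Quot A R) (Quot B S) H"
    by (auto simp: is_quantaloid_hom_def A.Ob_Quot)
  have "is_category_equivalence (Quot A R) (Quot B S) H"
  proof (rule category_equivalence_if_bij)
    show "is_functor (Quot A R) (Quot B S) H"
      using hom by (simp add: is_quantaloid_hom_def)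
    show "\<exists>p \<in> Ob (Quot A R). omap H p = b" if "b \<in> Ob (Quot B S)" for b
      using that surj by (auto simp: oH A.Ob_Quot B.Ob_Quot)
    show "bij_betw (amap H p q) (arr (Quot A R) p q) (arr (Quot B S) (omap H p) (omap H q))"
      if "p \<in> Ob (Quot A R)" "q \<in> Ob (Quot A R)" for p q
    proof -
      note pq = that[unfolded A.Ob_Quot]
      have "inj_on (amap H p q) (arr (Quot A R) p q)"
        using pq by (auto simp: inj_on_def A.arr_Quot aH B.cls_eq_iff Fob Farr A.cls_eq_iff cong)
      moreover have "amap H p q ` arr (Quot A R) p q
          = B.cls (omap F p) (omap F q) ` amap F p q ` arr A p q"
        using pq by (auto simp: image_image aH A.arr_Quot intro!: image_cong)
      moreover have "amap F p q ` arr A p q = arr B (omap F p) (omap F q)"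
        using full[OF pq] Farr[OF pq] by blast
      ultimately show ?thesis
        by (simp add: bij_betw_def oH B.arr_Quot)
    qed
  qed (use A.quantaloid_Quot B.quantaloid_Quot in auto)
  then show ?thesis
    using hom A.quantaloid_Quot B.quantaloid_Quot by (auto simp: equivalent_quantaloids_def)
qed

section \<open>Arrow quantaloids\<close>

lemma Ob_Arr: "(X, Y, \<phi>) \<in> Ob (Arr Q) \<longleftrightarrow> X \<in> Ob Q \<and> Y \<in> Ob Q \<and> \<phi> \<in> arr Q X Y"
  by (simp add: Arr_def)

lemma arr_Arr:
  "(\<zeta>, \<eta>) \<in> arr (Arr Q) (X, Y, \<phi>) (X', Y', \<psi>) \<longleftrightarrow>
    \<zeta> \<in> arr Q X X' \<and> \<eta> \<in> arr Q Y Y' \<and> Comp Q X X' Y' \<psi> \<zeta> = Comp Q X Y Y' \<eta> \<phi>"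
  by (simp add: Arr_def)

lemma le_Arr:
  "(\<zeta>, \<eta>) \<sqsubseteq>\<^bsub>Hom (Arr Q) (X, Y, \<phi>) (X', Y', \<psi>)\<^esub> (\<zeta>', \<eta>') \<longleftrightarrow>
    \<zeta> \<sqsubseteq>\<^bsub>Hom Q X X'\<^esub> \<zeta>' \<and> \<eta> \<sqsubseteq>\<^bsub>Hom Q Y Y'\<^esub> \<eta>'"
  by (simp add: Arr_def)

lemma Comp_Arr:
  "Comp (Arr Q) (X, Y, \<phi>) (X', Y', \<phi>') (X'', Y'', \<phi>'') (\<zeta>', \<eta>') (\<zeta>, \<eta>)
    = (Comp Q X X' X'' \<zeta>' \<zeta>, Comp Q Y Y' Y'' \<eta>' \<eta>)"
  by (simp add: Arr_def)

lemma One_Arr: "One (Arr Q) (X, Y, \<phi>) = (One Q X, One Q Y)"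
  by (simp add: Arr_def)

context quantaloid
begin

context
  fixes X Y \<phi> X' Y' \<psi>
  assumes ob: "(X, Y, \<phi>) \<in> Ob (Arr Q)" "(X', Y', \<psi>) \<in> Ob (Arr Q)"
begin

text \<open>Composition preserves joins in each variable, so a componentwise join of commuting
  squares commutes. Therefore joins of squares are componentwise.\<close>

lemma Arr_Sup_aux:
  assumes T: "T \<subseteq> arr (Arr Q) (X, Y, \<phi>) (X', Y', \<psi>)"
  defines "s \<equiv> (\<Squnion>\<^bsub>Hom Q X X'\<^esub> (fst ` T), \<Squnion>\<^bsub>Hom Q Y Y'\<^esub> (snd ` T))"
  shows "s \<in> arr (Arr Q) (X, Y, \<phi>) (X', Y', \<psi>)"
    and "\<And>x. x \<in> T \<Longrightarrow> x \<sqsubseteq>\<^bsub>Hom (Arr Q) (X, Y, \<phi>) (X', Y', \<psi>)\<^esub> s"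
    and "\<And>z. \<lbrakk>z \<in> arr (Arr Q) (X, Y, \<phi>) (X', Y', \<psi>);
        \<And>x. x \<in> T \<Longrightarrow> x \<sqsubseteq>\<^bsub>Hom (Arr Q) (X, Y, \<phi>) (X', Y', \<psi>)\<^esub> z\<rbrakk>
      \<Longrightarrow> s \<sqsubseteq>\<^bsub>Hom (Arr Q) (X, Y, \<phi>) (X', Y', \<psi>)\<^esub> z"
proof -
  note o = ob[unfolded Ob_Arr]
  have T': "\<zeta> \<in> arr Q X X'" "\<eta> \<in> arr Q Y Y'" "Comp Q X X' Y' \<psi> \<zeta> = Comp Q X Y Y' \<eta> \<phi>"
    if "(\<zeta>, \<eta>) \<in> T" for \<zeta> \<eta>
    using subsetD[OF T that] by (simp_all add: arr_Arr)
  have c: "fst ` T \<subseteq> arr Q X X'" "snd ` T \<subseteq> arr Q Y Y'"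
    using T' by auto
  have "Comp Q X X' Y' \<psi> (\<Squnion>\<^bsub>Hom Q X X'\<^esub> (fst ` T))
      = \<Squnion>\<^bsub>Hom Q X Y'\<^esub> (Comp Q X X' Y' \<psi> ` fst ` T)"
    using o c by (simp add: comp_Sup_right)
  also have "Comp Q X X' Y' \<psi> ` fst ` T = (\<lambda>\<eta>. Comp Q X Y Y' \<eta> \<phi>) ` snd ` T"
    unfolding image_image using T' by (intro image_cong) auto
  also have "\<Squnion>\<^bsub>Hom Q X Y'\<^esub> \<dots> = Comp Q X Y Y' (\<Squnion>\<^bsub>Hom Q Y Y'\<^esub> (snd ` T)) \<phi>"
    using o c by (simp add: comp_Sup_left)
  finally show "s \<in> arr (Arr Q) (X, Y, \<phi>) (X', Y', \<psi>)"
    using o c by (simp add: s_def arr_Arr Sup_closed)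
  show "x \<sqsubseteq>\<^bsub>Hom (Arr Q) (X, Y, \<phi>) (X', Y', \<psi>)\<^esub> s" if "x \<in> T" for x
  proof -
    have "fst x \<sqsubseteq>\<^bsub>Hom Q X X'\<^esub> \<Squnion>\<^bsub>Hom Q X X'\<^esub> (fst ` T)"
      "snd x \<sqsubseteq>\<^bsub>Hom Q Y Y'\<^esub> \<Squnion>\<^bsub>Hom Q Y Y'\<^esub> (snd ` T)"
      using that o c by (auto intro!: Sup_upper)
    then show ?thesis
      by (cases x) (simp add: s_def le_Arr)
  qed
  show "s \<sqsubseteq>\<^bsub>Hom (Arr Q) (X, Y, \<phi>) (X', Y', \<psi>)\<^esub> z"
    if z: "z \<in> arr (Arr Q) (X, Y, \<phi>) (X', Y', \<psi>)"
      and ub: "\<And>x. x \<in> T \<Longrightarrow> x \<sqsubseteq>\<^bsub>Hom (Arr Q) (X, Y, \<phi>) (X', Y', \<psi>)\<^esub> z" for z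
  proof -
    obtain a b where ab: "z = (a, b)" "a \<in> arr Q X X'" "b \<in> arr Q Y Y'"
      using z by (cases z) (simp add: arr_Arr)
    have "\<Squnion>\<^bsub>Hom Q X X'\<^esub> (fst ` T) \<sqsubseteq>\<^bsub>Hom Q X X'\<^esub> a" "\<Squnion>\<^bsub>Hom Q Y Y'\<^esub> (snd ` T) \<sqsubseteq>\<^bsub>Hom Q Y Y'\<^esub> b"
      using o c ub ab by (auto simp: le_Arr intro!: Sup_least)
    then show ?thesis
      by (simp add: s_def ab le_Arr)
  qed
qed

lemma Arr_complete_lattice: "complete_lattice (Hom (Arr Q) (X, Y, \<phi>) (X', Y', \<psi>))"
proof (rule complete_lattice_SupI)
  note o = ob[unfolded Ob_Arr]
  show "eq (Hom (Arr Q) (X, Y, \<phi>) (X', Y', \<psi>)) = (=)"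
    by (simp add: Arr_def)
  fix x assume x: "x \<in> arr (Arr Q) (X, Y, \<phi>) (X', Y', \<psi>)"
  then show "x \<sqsubseteq>\<^bsub>Hom (Arr Q) (X, Y, \<phi>) (X', Y', \<psi>)\<^esub> x"
    using o by (cases x) (simp add: le_Arr arr_Arr hom_refl)
  fix y assume y: "y \<in> arr (Arr Q) (X, Y, \<phi>) (X', Y', \<psi>)"
  show "x = y" if "x \<sqsubseteq>\<^bsub>Hom (Arr Q) (X, Y, \<phi>) (X', Y', \<psi>)\<^esub> y"
    "y \<sqsubseteq>\<^bsub>Hom (Arr Q) (X, Y, \<phi>) (X', Y', \<psi>)\<^esub> x"
    using x y that o hom_antisym by (cases x; cases y) (auto simp: le_Arr arr_Arr)
  fix z assume z: "z \<in> arr (Arr Q) (X, Y, \<phi>) (X', Y', \<psi>)"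
  show "x \<sqsubseteq>\<^bsub>Hom (Arr Q) (X, Y, \<phi>) (X', Y', \<psi>)\<^esub> z"
    if "x \<sqsubseteq>\<^bsub>Hom (Arr Q) (X, Y, \<phi>) (X', Y', \<psi>)\<^esub> y" "y \<sqsubseteq>\<^bsub>Hom (Arr Q) (X, Y, \<phi>) (X', Y', \<psi>)\<^esub> z"
    using x y z that o by (cases x; cases y; cases z) (auto simp: le_Arr arr_Arr elim: hom_trans)
next
  fix T assume "T \<subseteq> arr (Arr Q) (X, Y, \<phi>) (X', Y', \<psi>)"
  from Arr_Sup_aux[OF this]
  show "\<exists>s \<in> arr (Arr Q) (X, Y, \<phi>) (X', Y', \<psi>).
      (\<forall>x \<in> T. x \<sqsubseteq>\<^bsub>Hom (Arr Q) (X, Y, \<phi>) (X', Y', \<psi>)\<^esub> s) \<and>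
      (\<forall>z \<in> arr (Arr Q) (X, Y, \<phi>) (X', Y', \<psi>).
        (\<forall>x \<in> T. x \<sqsubseteq>\<^bsub>Hom (Arr Q) (X, Y, \<phi>) (X', Y', \<psi>)\<^esub> z) \<longrightarrow>
        s \<sqsubseteq>\<^bsub>Hom (Arr Q) (X, Y, \<phi>) (X', Y', \<psi>)\<^esub> z)"
    by blast
qed

lemma Sup_Arr:
  assumes "T \<subseteq> arr (Arr Q) (X, Y, \<phi>) (X', Y', \<psi>)"
  shows "\<Squnion>\<^bsub>Hom (Arr Q) (X, Y, \<phi>) (X', Y', \<psi>)\<^esub> T
    = (\<Squnion>\<^bsub>Hom Q X X'\<^esub> (fst ` T), \<Squnion>\<^bsub>Hom Q Y Y'\<^esub> (snd ` T))"
  using Arr_Sup_aux[OF assms] assms by (intro complete_lattice.Sup_eqI[OF Arr_complete_lattice]) auto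

end

text \<open>Pasting of two commuting squares.\<close>

lemma Arr_comp_closed:
  assumes ob: "(X, Y, \<phi>) \<in> Ob (Arr Q)" "(X', Y', \<phi>') \<in> Ob (Arr Q)" "(X'', Y'', \<phi>'') \<in> Ob (Arr Q)"
    and u: "(\<zeta>, \<eta>) \<in> arr (Arr Q) (X, Y, \<phi>) (X', Y', \<phi>')"
    and v: "(\<zeta>', \<eta>') \<in> arr (Arr Q) (X', Y', \<phi>') (X'', Y'', \<phi>'')"
  shows "(Comp Q X X' X'' \<zeta>' \<zeta>, Comp Q Y Y' Y'' \<eta>' \<eta>) \<in> arr (Arr Q) (X, Y, \<phi>) (X'', Y'', \<phi>'')"
proof -
  note o = ob[unfolded Ob_Arr] and a = u[unfolded arr_Arr] v[unfolded arr_Arr]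
  have "Comp Q X X'' Y'' \<phi>'' (Comp Q X X' X'' \<zeta>' \<zeta>) = Comp Q X X' Y'' (Comp Q X' Y' Y'' \<eta>' \<phi>') \<zeta>"
    using o a comp_assoc[of X X' X'' Y'' \<zeta> \<zeta>' \<phi>''] by simp
  also have "\<dots> = Comp Q X Y' Y'' \<eta>' (Comp Q X X' Y' \<phi>' \<zeta>)"
    using o a comp_assoc[of X X' Y' Y'' \<zeta> \<phi>' \<eta>'] by simp
  also have "\<dots> = Comp Q X Y Y'' (Comp Q Y Y' Y'' \<eta>' \<eta>) \<phi>"
    using o a comp_assoc[of X Y Y' Y'' \<phi> \<eta> \<eta>'] by simp
  finally show ?thesis
    using o a by (simp add: arr_Arr comp_closed)
qed

lemma quantaloid_Arr: "quantaloid (Arr Q)"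
proof (rule quantaloid.intro; (simp only: split_paired_all)?)
  fix X Y \<phi> X' Y' \<phi>' X'' Y'' \<phi>'' U and \<zeta>' \<eta>'
  assume ob: "(X, Y, \<phi>) \<in> Ob (Arr Q)" "(X', Y', \<phi>') \<in> Ob (Arr Q)" "(X'', Y'', \<phi>'') \<in> Ob (Arr Q)"
    and U: "U \<subseteq> arr (Arr Q) (X, Y, \<phi>) (X', Y', \<phi>')"
    and v: "(\<zeta>', \<eta>') \<in> arr (Arr Q) (X', Y', \<phi>') (X'', Y'', \<phi>'')"
  note o = ob[unfolded Ob_Arr] and v' = v[unfolded arr_Arr]
  have c: "fst ` U \<subseteq> arr Q X X'" "snd ` U \<subseteq> arr Q Y Y'"
    using U by (auto simp: arr_Arr)
  have s: "Comp (Arr Q) (X, Y, \<phi>) (X', Y', \<phi>') (X'', Y'', \<phi>'') (\<zeta>', \<eta>') ` U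
      \<subseteq> arr (Arr Q) (X, Y, \<phi>) (X'', Y'', \<phi>'')"
    using U ob v by (auto simp: Comp_Arr intro!: Arr_comp_closed)
  have "fst ` Comp (Arr Q) (X, Y, \<phi>) (X', Y', \<phi>') (X'', Y'', \<phi>'') (\<zeta>', \<eta>') ` U
      = Comp Q X X' X'' \<zeta>' ` fst ` U"
    "snd ` Comp (Arr Q) (X, Y, \<phi>) (X', Y', \<phi>') (X'', Y'', \<phi>'') (\<zeta>', \<eta>') ` U
      = Comp Q Y Y' Y'' \<eta>' ` snd ` U"
    unfolding image_image by (auto simp: Comp_Arr intro!: image_cong)
  then show "Comp (Arr Q) (X, Y, \<phi>) (X', Y', \<phi>') (X'', Y'', \<phi>'') (\<zeta>', \<eta>')
        (\<Squnion>\<^bsub>Hom (Arr Q) (X, Y, \<phi>) (X', Y', \<phi>')\<^esub> U)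
      = \<Squnion>\<^bsub>Hom (Arr Q) (X, Y, \<phi>) (X'', Y'', \<phi>'')\<^esub>
        (Comp (Arr Q) (X, Y, \<phi>) (X', Y', \<phi>') (X'', Y'', \<phi>'') (\<zeta>', \<eta>') ` U)"
    using ob o U v' c s by (simp add: Sup_Arr Comp_Arr comp_Sup_right)
next
  fix X Y \<phi> X' Y' \<phi>' X'' Y'' \<phi>'' \<zeta> \<eta> V
  assume ob: "(X, Y, \<phi>) \<in> Ob (Arr Q)" "(X', Y', \<phi>') \<in> Ob (Arr Q)" "(X'', Y'', \<phi>'') \<in> Ob (Arr Q)"
    and u: "(\<zeta>, \<eta>) \<in> arr (Arr Q) (X, Y, \<phi>) (X', Y', \<phi>')"
    and V: "V \<subseteq> arr (Arr Q) (X', Y', \<phi>') (X'', Y'', \<phi>'')"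
  note o = ob[unfolded Ob_Arr] and u' = u[unfolded arr_Arr]
  let ?C = "\<lambda>v. Comp (Arr Q) (X, Y, \<phi>) (X', Y', \<phi>') (X'', Y'', \<phi>'') v (\<zeta>, \<eta>)"
  have c: "fst ` V \<subseteq> arr Q X' X''" "snd ` V \<subseteq> arr Q Y' Y''"
    using V by (auto simp: arr_Arr)
  have s: "?C ` V \<subseteq> arr (Arr Q) (X, Y, \<phi>) (X'', Y'', \<phi>'')"
    using V ob u by (auto simp: Comp_Arr intro!: Arr_comp_closed)
  have "fst ` ?C ` V = (\<lambda>v. Comp Q X X' X'' v \<zeta>) ` fst ` V"
    "snd ` ?C ` V = (\<lambda>v. Comp Q Y Y' Y'' v \<eta>) ` snd ` V"
    unfolding image_image by (auto simp: Comp_Arr intro!: image_cong)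
  then show "?C (\<Squnion>\<^bsub>Hom (Arr Q) (X', Y', \<phi>') (X'', Y'', \<phi>'')\<^esub> V)
      = \<Squnion>\<^bsub>Hom (Arr Q) (X, Y, \<phi>) (X'', Y'', \<phi>'')\<^esub> (?C ` V)"
    using ob o V u' c s by (simp add: Sup_Arr Comp_Arr comp_Sup_left)
qed (simp_all add: Comp_Arr One_Arr Arr_comp_closed Arr_complete_lattice,
    simp_all add: Ob_Arr arr_Arr comp_assoc comp_one_left comp_one_right one_closed)

lemma diag_cong_iff:
  "((\<zeta>, \<eta>), (\<zeta>', \<eta>')) \<in> diag_cong Q (X, Y, \<phi>) (X', Y', \<psi>) \<longleftrightarrow>
    (\<zeta>, \<eta>) \<in> arr (Arr Q) (X, Y, \<phi>) (X', Y', \<psi>) \<and>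
    (\<zeta>', \<eta>') \<in> arr (Arr Q) (X, Y, \<phi>) (X', Y', \<psi>) \<and>
    Comp Q X X' Y' \<psi> \<zeta> = Comp Q X X' Y' \<psi> \<zeta>'"
  by (simp add: diag_cong_def)

text \<open>For composites, the diagonal of the second square may be written with the lower arrow of
  its related square, as \<open>\<eta>1'\<close> after \<open>\<phi>'\<close>. So the composite
  depends on \<open>\<zeta>\<close> only through the diagonal of the first square, which
  \<open>\<zeta>\<close> and \<open>\<zeta>1\<close> share.\<close>

lemma quantaloid_congruence_diag: "quantaloid_congruence (Arr Q) (diag_cong Q)"
proof (intro quantaloid_congruence.intro quantaloid_Arr quantaloid_congruence_axioms.intro;
    (simp only: split_paired_all)?)
  fix X Y \<phi> X' Y' \<phi>'
  show "equiv (arr (Arr Q) (X, Y, \<phi>) (X', Y', \<phi>')) (diag_cong Q (X, Y, \<phi>) (X', Y', \<phi>'))"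
    by (rule equivI) (auto simp: refl_on_def sym_def trans_def diag_cong_iff)
next
  fix X Y \<phi> X' Y' \<phi>' X'' Y'' \<phi>'' \<zeta> \<eta> \<zeta>1 \<eta>1 \<zeta>' \<eta>' \<zeta>1' \<eta>1'
  assume ob: "(X, Y, \<phi>) \<in> Ob (Arr Q)" "(X', Y', \<phi>') \<in> Ob (Arr Q)" "(X'', Y'', \<phi>'') \<in> Ob (Arr Q)"
    and u: "((\<zeta>, \<eta>), (\<zeta>1, \<eta>1)) \<in> diag_cong Q (X, Y, \<phi>) (X', Y', \<phi>')"
    and v: "((\<zeta>', \<eta>'), (\<zeta>1', \<eta>1')) \<in> diag_cong Q (X', Y', \<phi>') (X'', Y'', \<phi>'')"
  note o = ob[unfolded Ob_Arr] and uv = u[unfolded diag_cong_iff] v[unfolded diag_cong_iff]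
  note a = uv[unfolded arr_Arr]
  have ar: "\<zeta> \<in> arr Q X X'" "\<zeta>1 \<in> arr Q X X'" "\<zeta>' \<in> arr Q X' X''" "\<zeta>1' \<in> arr Q X' X''"
      "\<eta>1' \<in> arr Q Y' Y''"
    and eqs: "Comp Q X' X'' Y'' \<phi>'' \<zeta>' = Comp Q X' Y' Y'' \<eta>1' \<phi>'"
      "Comp Q X X' Y' \<phi>' \<zeta> = Comp Q X X' Y' \<phi>' \<zeta>1"
      "Comp Q X' Y' Y'' \<eta>1' \<phi>' = Comp Q X' X'' Y'' \<phi>'' \<zeta>1'"
    using a by metis+
  have "Comp Q X X'' Y'' \<phi>'' (Comp Q X X' X'' \<zeta>' \<zeta>)
      = Comp Q X X' Y'' (Comp Q X' X'' Y'' \<phi>'' \<zeta>') \<zeta>"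
    using o ar by (simp add: comp_assoc)
  also have "\<dots> = Comp Q X Y' Y'' \<eta>1' (Comp Q X X' Y' \<phi>' \<zeta>)"
    unfolding eqs(1) using o ar by (simp add: comp_assoc)
  also have "\<dots> = Comp Q X X' Y'' (Comp Q X' Y' Y'' \<eta>1' \<phi>') \<zeta>1"
    unfolding eqs(2) using o ar by (simp add: comp_assoc)
  also have "\<dots> = Comp Q X X'' Y'' \<phi>'' (Comp Q X X' X'' \<zeta>1' \<zeta>1)"
    unfolding eqs(3) using o ar by (simp add: comp_assoc)
  finally show "(Comp (Arr Q) (X, Y, \<phi>) (X', Y', \<phi>') (X'', Y'', \<phi>'') (\<zeta>', \<eta>') (\<zeta>, \<eta>),
      Comp (Arr Q) (X, Y, \<phi>) (X', Y', \<phi>') (X'', Y'', \<phi>'') (\<zeta>1', \<eta>1') (\<zeta>1, \<eta>1))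
      \<in> diag_cong Q (X, Y, \<phi>) (X'', Y'', \<phi>'')"
    using ob uv by (auto simp: Comp_Arr diag_cong_iff intro!: Arr_comp_closed)
next
  fix X Y \<phi> X' Y' \<phi>' T
  assume ob: "(X, Y, \<phi>) \<in> Ob (Arr Q)" "(X', Y', \<phi>') \<in> Ob (Arr Q)"
    and T: "T \<subseteq> diag_cong Q (X, Y, \<phi>) (X', Y', \<phi>')"
  note o = ob[unfolded Ob_Arr]
  have A: "fst ` T \<subseteq> arr (Arr Q) (X, Y, \<phi>) (X', Y', \<phi>')" "snd ` T \<subseteq> arr (Arr Q) (X, Y, \<phi>) (X', Y', \<phi>')"
    using T by (auto simp: diag_cong_iff subset_iff)
  have c: "fst ` fst ` T \<subseteq> arr Q X X'" "fst ` snd ` T \<subseteq> arr Q X X'"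
    using T by (auto simp: diag_cong_iff arr_Arr subset_iff)
  have "Comp Q X X' Y' \<phi>' ` fst ` fst ` T = Comp Q X X' Y' \<phi>' ` fst ` snd ` T"
    unfolding image_image using T by (intro image_cong) (auto simp: diag_cong_iff)
  then show "(\<Squnion>\<^bsub>Hom (Arr Q) (X, Y, \<phi>) (X', Y', \<phi>')\<^esub> (fst ` T),
      \<Squnion>\<^bsub>Hom (Arr Q) (X, Y, \<phi>) (X', Y', \<phi>')\<^esub> (snd ` T)) \<in> diag_cong Q (X, Y, \<phi>) (X', Y', \<phi>')"
    using Arr_Sup_aux(1)[OF ob A(1)] Arr_Sup_aux(1)[OF ob A(2)] A o c
    by (simp add: Sup_Arr[OF ob] diag_cong_iff comp_Sup_right)
qed

end

section \<open>The quantaloid of relations\<close>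

lemma Ob_QRel:
  "(X, t) \<in> Ob (QRel Q :: (('u, 'o) oset, ('u, 'a) qrel) qtld) \<longleftrightarrow>
    small TYPE('u) X \<and> t \<in> X \<rightarrow>\<^sub>E Ob Q"
  by (simp add: QRel_def)

lemma Ob_QRelD: "\<lbrakk>(X, t) \<in> Ob (QRel Q); x \<in> X\<rbrakk> \<Longrightarrow> t x \<in> Ob Q"
  by (auto simp: Ob_QRel)

lemma arr_QRel: "arr (QRel Q) (X, t) (Y, s) = (\<Pi>\<^sub>E x\<in>X. \<Pi>\<^sub>E y\<in>Y. arr Q (t x) (s y))"
  by (simp add: QRel_def)

lemma arr_QRelD: "\<lbrakk>\<phi> \<in> arr (QRel Q) (X, t) (Y, s); x \<in> X; y \<in> Y\<rbrakk> \<Longrightarrow> \<phi> x y \<in> arr Q (t x) (s y)"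
  by (auto simp: arr_QRel)

lemma arr_QRelI:
  "(\<And>x y. \<lbrakk>x \<in> X; y \<in> Y\<rbrakk> \<Longrightarrow> f x y \<in> arr Q (t x) (s y)) \<Longrightarrow>
    (\<lambda>x\<in>X. \<lambda>y\<in>Y. f x y) \<in> arr (QRel Q) (X, t) (Y, s)"
  by (auto simp: arr_QRel)

lemma QRel_eqI:
  assumes "\<phi> \<in> arr (QRel Q) (X, t) (Y, s)" "\<psi> \<in> arr (QRel Q) (X, t) (Y, s)"
    and "\<And>x y. \<lbrakk>x \<in> X; y \<in> Y\<rbrakk> \<Longrightarrow> \<phi> x y = \<psi> x y"
  shows "\<phi> = \<psi>"
proof (rule PiE_ext[where k = X])
  show "\<phi> x = \<psi> x" if "x \<in> X" for x
    by (rule PiE_ext[where k = Y]) (use assms that in \<open>auto simp: arr_QRel\<close>)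
qed (use assms in \<open>auto simp: arr_QRel\<close>)

lemma le_QRel:
  "\<phi> \<sqsubseteq>\<^bsub>Hom (QRel Q) (X, t) (Y, s)\<^esub> \<psi> \<longleftrightarrow>
    (\<forall>x\<in>X. \<forall>y\<in>Y. \<phi> x y \<sqsubseteq>\<^bsub>Hom Q (t x) (s y)\<^esub> \<psi> x y)"
  by (simp add: QRel_def)

lemma Comp_QRel:
  "Comp (QRel Q) (X, t) (Y, s) (Z, r) \<psi> \<phi> = (\<lambda>x\<in>X. \<lambda>z\<in>Z.
    \<Squnion>\<^bsub>Hom Q (t x) (r z)\<^esub> ((\<lambda>y. Comp Q (t x) (s y) (r z) (\<psi> y z) (\<phi> x y)) ` Y))"
  by (simp add: QRel_def)

lemma One_QRel:
  "One (QRel Q) (X, t) = (\<lambda>x\<in>X. \<lambda>y\<in>X. if x = y then One Q (t x) else \<bottom>\<^bsub>Hom Q (t x) (t y)\<^esub>)"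
  by (simp add: QRel_def)

context quantaloid
begin

context
  fixes X Y :: "'u set" and t s
  assumes ob: "(X, t) \<in> Ob (QRel Q)" "(Y, s) \<in> Ob (QRel Q)"
begin

definition QRel_Sup :: "('u, 'a) qrel set \<Rightarrow> ('u, 'a) qrel" where
  "QRel_Sup T = (\<lambda>x\<in>X. \<lambda>y\<in>Y. \<Squnion>\<^bsub>Hom Q (t x) (s y)\<^esub> ((\<lambda>\<phi>. \<phi> x y) ` T))"

lemma QRel_Sup_aux:
  assumes T: "T \<subseteq> arr (QRel Q) (X, t) (Y, s)"
  shows "QRel_Sup T \<in> arr (QRel Q) (X, t) (Y, s)"
    and "\<And>\<phi>. \<phi> \<in> T \<Longrightarrow> \<phi> \<sqsubseteq>\<^bsub>Hom (QRel Q) (X, t) (Y, s)\<^esub> QRel_Sup T"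
    and "\<And>\<psi>. \<lbrakk>\<psi> \<in> arr (QRel Q) (X, t) (Y, s);
        \<And>\<phi>. \<phi> \<in> T \<Longrightarrow> \<phi> \<sqsubseteq>\<^bsub>Hom (QRel Q) (X, t) (Y, s)\<^esub> \<psi>\<rbrakk>
      \<Longrightarrow> QRel_Sup T \<sqsubseteq>\<^bsub>Hom (QRel Q) (X, t) (Y, s)\<^esub> \<psi>"
proof -
  note o = ob[THEN Ob_QRelD]
  have c: "(\<lambda>\<phi>. \<phi> x y) ` T \<subseteq> arr Q (t x) (s y)" if "x \<in> X" "y \<in> Y" for x y
    using T that by (auto dest: arr_QRelD subsetD)
  show "QRel_Sup T \<in> arr (QRel Q) (X, t) (Y, s)"
    unfolding QRel_Sup_def using c o by (intro arr_QRelI Sup_closed)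
  show "\<phi> \<sqsubseteq>\<^bsub>Hom (QRel Q) (X, t) (Y, s)\<^esub> QRel_Sup T" if "\<phi> \<in> T" for \<phi>
    unfolding le_QRel
  proof (intro ballI)
    show "\<phi> x y \<sqsubseteq>\<^bsub>Hom Q (t x) (s y)\<^esub> QRel_Sup T x y" if xy: "x \<in> X" "y \<in> Y" for x y
      using Sup_upper[OF o(1)[OF xy(1)] o(2)[OF xy(2)] c[OF xy], of "\<phi> x y"] xy \<open>\<phi> \<in> T\<close>
      by (simp add: QRel_Sup_def)
  qed
  show "QRel_Sup T \<sqsubseteq>\<^bsub>Hom (QRel Q) (X, t) (Y, s)\<^esub> \<psi>" if psi: "\<psi> \<in> arr (QRel Q) (X, t) (Y, s)"
    and ub: "\<And>\<phi>. \<phi> \<in> T \<Longrightarrow> \<phi> \<sqsubseteq>\<^bsub>Hom (QRel Q) (X, t) (Y, s)\<^esub> \<psi>" for \<psi>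
    unfolding le_QRel
  proof (intro ballI)
    show "QRel_Sup T x y \<sqsubseteq>\<^bsub>Hom Q (t x) (s y)\<^esub> \<psi> x y" if xy: "x \<in> X" "y \<in> Y" for x y
      using Sup_least[OF o(1)[OF xy(1)] o(2)[OF xy(2)] c[OF xy], of "\<psi> x y"] xy ub
        arr_QRelD[OF psi xy] by (auto simp: QRel_Sup_def le_QRel)
  qed
qed

lemma QRel_complete_lattice: "complete_lattice (Hom (QRel Q) (X, t) (Y, s))"
proof (rule complete_lattice_SupI)
  note o = ob[THEN Ob_QRelD]
  show "eq (Hom (QRel Q) (X, t) (Y, s)) = (=)"
    by (simp add: QRel_def)
  fix x assume x: "x \<in> arr (QRel Q) (X, t) (Y, s)"
  then show "x \<sqsubseteq>\<^bsub>Hom (QRel Q) (X, t) (Y, s)\<^esub> x"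
    using o by (auto simp: le_QRel hom_refl dest: arr_QRelD)
  fix y assume y: "y \<in> arr (QRel Q) (X, t) (Y, s)"
  show "x = y" if "x \<sqsubseteq>\<^bsub>Hom (QRel Q) (X, t) (Y, s)\<^esub> y" "y \<sqsubseteq>\<^bsub>Hom (QRel Q) (X, t) (Y, s)\<^esub> x"
  proof (rule QRel_eqI[OF x y])
    show "x a b = y a b" if "a \<in> X" "b \<in> Y" for a b
      using x y \<open>x \<sqsubseteq>\<^bsub>_\<^esub> y\<close> \<open>y \<sqsubseteq>\<^bsub>_\<^esub> x\<close> that o
      by (intro hom_antisym[of "t a" "s b"]) (auto simp: le_QRel dest: arr_QRelD)
  qed
  fix z assume z: "z \<in> arr (QRel Q) (X, t) (Y, s)"
  show "x \<sqsubseteq>\<^bsub>Hom (QRel Q) (X, t) (Y, s)\<^esub> z"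
    if "x \<sqsubseteq>\<^bsub>Hom (QRel Q) (X, t) (Y, s)\<^esub> y" "y \<sqsubseteq>\<^bsub>Hom (QRel Q) (X, t) (Y, s)\<^esub> z"
    unfolding le_QRel
  proof (intro ballI)
    show "x a b \<sqsubseteq>\<^bsub>Hom Q (t a) (s b)\<^esub> z a b" if "a \<in> X" "b \<in> Y" for a b
      using x y z \<open>x \<sqsubseteq>\<^bsub>_\<^esub> y\<close> \<open>y \<sqsubseteq>\<^bsub>_\<^esub> z\<close> that o
      by (intro hom_trans[of "t a" "s b" "x a b" "y a b" "z a b"]) (auto simp: le_QRel dest: arr_QRelD)
  qed
next
  fix T assume "T \<subseteq> arr (QRel Q) (X, t) (Y, s)"
  from QRel_Sup_aux[OF this]
  show "\<exists>\<sigma> \<in> arr (QRel Q) (X, t) (Y, s). (\<forall>x \<in> T. x \<sqsubseteq>\<^bsub>Hom (QRel Q) (X, t) (Y, s)\<^esub> \<sigma>) \<and>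
      (\<forall>z \<in> arr (QRel Q) (X, t) (Y, s). (\<forall>x \<in> T. x \<sqsubseteq>\<^bsub>Hom (QRel Q) (X, t) (Y, s)\<^esub> z) \<longrightarrow>
        \<sigma> \<sqsubseteq>\<^bsub>Hom (QRel Q) (X, t) (Y, s)\<^esub> z)"
    by blast
qed

lemma Sup_QRel_eq:
  assumes "T \<subseteq> arr (QRel Q) (X, t) (Y, s)"
  shows "\<Squnion>\<^bsub>Hom (QRel Q) (X, t) (Y, s)\<^esub> T = QRel_Sup T"
  using QRel_Sup_aux[OF assms] assms by (intro complete_lattice.Sup_eqI[OF QRel_complete_lattice]) auto

lemma Sup_QRel:
  assumes "T \<subseteq> arr (QRel Q) (X, t) (Y, s)" "x \<in> X" "y \<in> Y"
  shows "(\<Squnion>\<^bsub>Hom (QRel Q) (X, t) (Y, s)\<^esub> T) x y = \<Squnion>\<^bsub>Hom Q (t x) (s y)\<^esub> ((\<lambda>\<phi>. \<phi> x y) ` T)"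
  using assms by (simp add: Sup_QRel_eq QRel_Sup_def)

lemma QRel_Sup_closed:
  "T \<subseteq> arr (QRel Q) (X, t) (Y, s) \<Longrightarrow> \<Squnion>\<^bsub>Hom (QRel Q) (X, t) (Y, s)\<^esub> T \<in> arr (QRel Q) (X, t) (Y, s)"
  by (simp add: Sup_QRel_eq QRel_Sup_aux(1))

end

lemma QRel_comp_closed:
  assumes "(X, t) \<in> Ob (QRel Q)" "(Y, s) \<in> Ob (QRel Q)" "(Z, r) \<in> Ob (QRel Q)"
    and "\<phi> \<in> arr (QRel Q) (X, t) (Y, s)" "\<psi> \<in> arr (QRel Q) (Y, s) (Z, r)"
  shows "Comp (QRel Q) (X, t) (Y, s) (Z, r) \<psi> \<phi> \<in> arr (QRel Q) (X, t) (Z, r)"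
  unfolding Comp_QRel using assms Ob_QRelD
  by (intro arr_QRelI Sup_closed) (auto intro!: comp_closed dest: arr_QRelD)

lemma QRel_one_closed:
  assumes "(X, t) \<in> Ob (QRel Q)"
  shows "One (QRel Q) (X, t) \<in> arr (QRel Q) (X, t) (X, t)"
  unfolding One_QRel using Ob_QRelD[OF assms] by (intro arr_QRelI) (auto simp: one_closed bottom_arr)

text \<open>Matrix calculus: each law is checked entry by entry. Composition in \<open>Q\<close> is
  first distributed over the inner join, and then two joins are exchanged.\<close>

lemma quantaloid_QRel: "quantaloid (QRel Q :: (('u, 'o) oset, ('u, 'a) qrel) qtld)"
proof (rule quantaloid.intro; (simp only: split_paired_all)?)
  fix X Y Z W :: "'u set" and t s r q \<phi> \<psi> \<xi>
  assume ob: "(X, t) \<in> Ob (QRel Q)" "(Y, s) \<in> Ob (QRel Q)" "(Z, r) \<in> Ob (QRel Q)" "(W, q) \<in> Ob (QRel Q)"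
    and a: "\<phi> \<in> arr (QRel Q) (X, t) (Y, s)" "\<psi> \<in> arr (QRel Q) (Y, s) (Z, r)" "\<xi> \<in> arr (QRel Q) (Z, r) (W, q)"
  note o = ob[THEN Ob_QRelD] and a' = a[THEN arr_QRelD]
  show "Comp (QRel Q) (X, t) (Z, r) (W, q) \<xi> (Comp (QRel Q) (X, t) (Y, s) (Z, r) \<psi> \<phi>)
      = Comp (QRel Q) (X, t) (Y, s) (W, q) (Comp (QRel Q) (Y, s) (Z, r) (W, q) \<xi> \<psi>) \<phi>"
  proof (rule QRel_eqI)
    fix x w assume xw: "x \<in> X" "w \<in> W"
    let ?c = "\<lambda>z y. Comp Q (t x) (r z) (q w) (\<xi> z w) (Comp Q (t x) (s y) (r z) (\<psi> y z) (\<phi> x y))"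
    have "Comp Q (t x) (r z) (q w) (\<xi> z w)
        (\<Squnion>\<^bsub>Hom Q (t x) (r z)\<^esub> ((\<lambda>y. Comp Q (t x) (s y) (r z) (\<psi> y z) (\<phi> x y)) ` Y))
        = \<Squnion>\<^bsub>Hom Q (t x) (q w)\<^esub> (?c z ` Y)" if "z \<in> Z" for z
      using o a' xw that by (subst comp_Sup_right) (auto simp: image_image intro!: comp_closed)
    moreover have "Comp Q (t x) (s y) (q w)
        (\<Squnion>\<^bsub>Hom Q (s y) (q w)\<^esub> ((\<lambda>z. Comp Q (s y) (r z) (q w) (\<xi> z w) (\<psi> y z)) ` Z)) (\<phi> x y)
        = \<Squnion>\<^bsub>Hom Q (t x) (q w)\<^esub> ((\<lambda>z. ?c z y) ` Z)" if "y \<in> Y" for y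
      using o a' xw that
      by (subst comp_Sup_left) (auto simp: image_image comp_assoc intro!: comp_closed
          intro: arg_cong[where f = "\<lambda>S. \<Squnion>\<^bsub>Hom Q (t x) (q w)\<^esub> S"] image_cong)
    moreover have "\<Squnion>\<^bsub>Hom Q (t x) (q w)\<^esub> ((\<lambda>z. \<Squnion>\<^bsub>Hom Q (t x) (q w)\<^esub> (?c z ` Y)) ` Z)
        = \<Squnion>\<^bsub>Hom Q (t x) (q w)\<^esub> ((\<lambda>y. \<Squnion>\<^bsub>Hom Q (t x) (q w)\<^esub> ((\<lambda>z. ?c z y) ` Z)) ` Y)"
      using o a' xw
      by (intro complete_lattice.Sup_Sup_commute hom_complete_lattice) (auto intro!: comp_closed)
    ultimately show "Comp (QRel Q) (X, t) (Z, r) (W, q) \<xi> (Comp (QRel Q) (X, t) (Y, s) (Z, r) \<psi> \<phi>) x w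
      = Comp (QRel Q) (X, t) (Y, s) (W, q) (Comp (QRel Q) (Y, s) (Z, r) (W, q) \<xi> \<psi>) \<phi> x w"
      using xw by (simp add: Comp_QRel cong: image_cong_simp)
  qed (use ob a in \<open>auto intro!: QRel_comp_closed\<close>)
next
  fix X Y :: "'u set" and t s \<phi>
  assume ob: "(X, t) \<in> Ob (QRel Q)" "(Y, s) \<in> Ob (QRel Q)" and a: "\<phi> \<in> arr (QRel Q) (X, t) (Y, s)"
  note o = ob[THEN Ob_QRelD] and a' = a[THEN arr_QRelD]
  show "Comp (QRel Q) (X, t) (X, t) (Y, s) \<phi> (One (QRel Q) (X, t)) = \<phi>"
  proof (rule QRel_eqI[OF _ a])
    fix x y assume xy: "x \<in> X" "y \<in> Y"
    let ?f = "\<lambda>z. Comp Q (t x) (t z) (s y) (\<phi> z y) (One (QRel Q) (X, t) x z)"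
    have "\<Squnion>\<^bsub>Hom Q (t x) (s y)\<^esub> (?f ` X) = ?f x"
      using xy o a' by (intro complete_lattice.Sup_single_value hom_complete_lattice)
        (auto simp: One_QRel bottom_eq_Sup comp_bottom_right one_closed intro!: comp_closed)
    then show "Comp (QRel Q) (X, t) (X, t) (Y, s) \<phi> (One (QRel Q) (X, t)) x y = \<phi> x y"
      using xy o a' by (simp add: Comp_QRel) (simp add: One_QRel comp_one_right)
  qed (use ob a in \<open>auto intro!: QRel_comp_closed QRel_one_closed\<close>)
  show "Comp (QRel Q) (X, t) (Y, s) (Y, s) (One (QRel Q) (Y, s)) \<phi> = \<phi>"
  proof (rule QRel_eqI[OF _ a])
    fix x y assume xy: "x \<in> X" "y \<in> Y"
    let ?f = "\<lambda>z. Comp Q (t x) (s z) (s y) (One (QRel Q) (Y, s) z y) (\<phi> x z)"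
    have "\<Squnion>\<^bsub>Hom Q (t x) (s y)\<^esub> (?f ` Y) = ?f y"
      using xy o a' by (intro complete_lattice.Sup_single_value hom_complete_lattice)
        (auto simp: One_QRel bottom_eq_Sup comp_bottom_left one_closed intro!: comp_closed)
    then show "Comp (QRel Q) (X, t) (Y, s) (Y, s) (One (QRel Q) (Y, s)) \<phi> x y = \<phi> x y"
      using xy o a' by (simp add: Comp_QRel) (simp add: One_QRel comp_one_left)
  qed (use ob a in \<open>auto intro!: QRel_comp_closed QRel_one_closed\<close>)
next
  fix X Y Z :: "'u set" and t s r U \<psi>
  assume ob: "(X, t) \<in> Ob (QRel Q)" "(Y, s) \<in> Ob (QRel Q)" "(Z, r) \<in> Ob (QRel Q)"
    and U: "U \<subseteq> arr (QRel Q) (X, t) (Y, s)" and a: "\<psi> \<in> arr (QRel Q) (Y, s) (Z, r)"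
  note o = ob[THEN Ob_QRelD] and a' = a[THEN arr_QRelD]
  have U': "u x y \<in> arr Q (t x) (s y)" if "u \<in> U" "x \<in> X" "y \<in> Y" for u x y
    using U that by (auto dest: arr_QRelD)
  have c: "Comp (QRel Q) (X, t) (Y, s) (Z, r) \<psi> ` U \<subseteq> arr (QRel Q) (X, t) (Z, r)"
    using U ob a by (auto intro!: QRel_comp_closed)
  show "Comp (QRel Q) (X, t) (Y, s) (Z, r) \<psi> (\<Squnion>\<^bsub>Hom (QRel Q) (X, t) (Y, s)\<^esub> U)
      = \<Squnion>\<^bsub>Hom (QRel Q) (X, t) (Z, r)\<^esub> (Comp (QRel Q) (X, t) (Y, s) (Z, r) \<psi> ` U)"
  proof (rule QRel_eqI)
    fix x z assume xz: "x \<in> X" "z \<in> Z"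
    let ?c = "\<lambda>y u. Comp Q (t x) (s y) (r z) (\<psi> y z) (u x y)"
    have "Comp Q (t x) (s y) (r z) (\<psi> y z) ((\<Squnion>\<^bsub>Hom (QRel Q) (X, t) (Y, s)\<^esub> U) x y)
        = \<Squnion>\<^bsub>Hom Q (t x) (r z)\<^esub> (?c y ` U)" if "y \<in> Y" for y
      using o a' xz that ob U U' by (subst Sup_QRel, simp_all, subst comp_Sup_right)
        (auto simp: image_image)
    moreover have "\<Squnion>\<^bsub>Hom Q (t x) (r z)\<^esub> ((\<lambda>y. \<Squnion>\<^bsub>Hom Q (t x) (r z)\<^esub> (?c y ` U)) ` Y)
        = \<Squnion>\<^bsub>Hom Q (t x) (r z)\<^esub> ((\<lambda>u. \<Squnion>\<^bsub>Hom Q (t x) (r z)\<^esub> ((\<lambda>y. ?c y u) ` Y)) ` U)"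
      using o a' xz U'
      by (intro complete_lattice.Sup_Sup_commute hom_complete_lattice) (auto intro!: comp_closed)
    ultimately show "Comp (QRel Q) (X, t) (Y, s) (Z, r) \<psi> (\<Squnion>\<^bsub>Hom (QRel Q) (X, t) (Y, s)\<^esub> U) x z
        = (\<Squnion>\<^bsub>Hom (QRel Q) (X, t) (Z, r)\<^esub> (Comp (QRel Q) (X, t) (Y, s) (Z, r) \<psi> ` U)) x z"
      using xz ob c by (simp add: Sup_QRel image_image) (simp add: Comp_QRel cong: image_cong_simp)
  qed (use ob a U c in \<open>auto intro!: QRel_comp_closed QRel_Sup_closed\<close>)
next
  fix X Y Z :: "'u set" and t s r V \<phi>
  assume ob: "(X, t) \<in> Ob (QRel Q)" "(Y, s) \<in> Ob (QRel Q)" "(Z, r) \<in> Ob (QRel Q)"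
    and a: "\<phi> \<in> arr (QRel Q) (X, t) (Y, s)" and V: "V \<subseteq> arr (QRel Q) (Y, s) (Z, r)"
  note o = ob[THEN Ob_QRelD] and a' = a[THEN arr_QRelD]
  have V': "v y z \<in> arr Q (s y) (r z)" if "v \<in> V" "y \<in> Y" "z \<in> Z" for v y z
    using V that by (auto dest: arr_QRelD)
  have c: "(\<lambda>v. Comp (QRel Q) (X, t) (Y, s) (Z, r) v \<phi>) ` V \<subseteq> arr (QRel Q) (X, t) (Z, r)"
    using V ob a by (auto intro!: QRel_comp_closed)
  show "Comp (QRel Q) (X, t) (Y, s) (Z, r) (\<Squnion>\<^bsub>Hom (QRel Q) (Y, s) (Z, r)\<^esub> V) \<phi>
      = \<Squnion>\<^bsub>Hom (QRel Q) (X, t) (Z, r)\<^esub> ((\<lambda>v. Comp (QRel Q) (X, t) (Y, s) (Z, r) v \<phi>) ` V)"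
  proof (rule QRel_eqI)
    fix x z assume xz: "x \<in> X" "z \<in> Z"
    let ?c = "\<lambda>y v. Comp Q (t x) (s y) (r z) (v y z) (\<phi> x y)"
    have "Comp Q (t x) (s y) (r z) ((\<Squnion>\<^bsub>Hom (QRel Q) (Y, s) (Z, r)\<^esub> V) y z) (\<phi> x y)
        = \<Squnion>\<^bsub>Hom Q (t x) (r z)\<^esub> (?c y ` V)" if "y \<in> Y" for y
      using o a' xz that ob V V' by (subst Sup_QRel, simp_all, subst comp_Sup_left)
        (auto simp: image_image)
    moreover have "\<Squnion>\<^bsub>Hom Q (t x) (r z)\<^esub> ((\<lambda>y. \<Squnion>\<^bsub>Hom Q (t x) (r z)\<^esub> (?c y ` V)) ` Y)
        = \<Squnion>\<^bsub>Hom Q (t x) (r z)\<^esub> ((\<lambda>v. \<Squnion>\<^bsub>Hom Q (t x) (r z)\<^esub> ((\<lambda>y. ?c y v) ` Y)) ` V)"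
      using o a' xz V'
      by (intro complete_lattice.Sup_Sup_commute hom_complete_lattice) (auto intro!: comp_closed)
    ultimately show "Comp (QRel Q) (X, t) (Y, s) (Z, r) (\<Squnion>\<^bsub>Hom (QRel Q) (Y, s) (Z, r)\<^esub> V) \<phi> x z
        = (\<Squnion>\<^bsub>Hom (QRel Q) (X, t) (Z, r)\<^esub> ((\<lambda>v. Comp (QRel Q) (X, t) (Y, s) (Z, r) v \<phi>) ` V)) x z"
      using xz ob c by (simp add: Sup_QRel image_image) (simp add: Comp_QRel cong: image_cong_simp)
  qed (use ob a V c in \<open>auto intro!: QRel_comp_closed QRel_Sup_closed\<close>)
qed (simp_all add: QRel_complete_lattice QRel_comp_closed QRel_one_closed)

end

section \<open>Small sets\<close>

lemma small_inj:
  assumes "inj_on f A" "f ` A \<subseteq> B" "small U B"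
  shows "small U A"
  using assms card_of_ordLeqI ordLeq_ordLess_trans unfolding small_def
  by (metis image_subset_iff)

lemma small_image: "small U A \<Longrightarrow> small U (f ` A)"
  unfolding small_def using card_of_image ordLeq_ordLess_trans by blast

lemma small_subset: "\<lbrakk>small U B; A \<subseteq> B\<rbrakk> \<Longrightarrow> small U A"
  by (rule small_inj[of id]) auto

text \<open>Uses that the universe is infinite; it makes singletons small.\<close>

lemma small_finite: "\<lbrakk>universe U; finite A\<rbrakk> \<Longrightarrow> small U A"
  unfolding universe_def small_def using finite_ordLess_infinite[OF card_of_Well_order card_of_Well_order]
  by (auto simp: Field_card_of)

text \<open>Uses regularity: a regular cardinal is stable, that is, fewer than that many sets of
  smaller size have a disjoint union of smaller size.\<close>

lemma small_Sigma:
  assumes "universe U" "small U A" "\<And>a. a \<in> A \<Longrightarrow> small U (F a)"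
  shows "small U (Sigma A F)"
  using assms unfolding universe_def small_def
  by (intro stable_elim regularCard_stable card_of_Card_order) (auto simp: Field_card_of)

lemma small_embedding:
  fixes U :: "'u itself"
  assumes "small U A"
  obtains f :: "_ \<Rightarrow> 'u" where "inj_on f A"
  using assms ordLess_imp_ordLeq card_of_ordLeq unfolding small_def by metis

text \<open>The strong limit axiom speaks only of subsets of \<open>'u\<close>, so the set is first
  embedded there and the bound is pulled back along the induced injection of power sets.\<close>

lemma small_Pow:
  fixes U :: "'u itself"
  assumes U: "universe U" and A: "small U A"
  shows "small U (Pow A)"
proof -
  obtain f :: "_ \<Rightarrow> 'u" where f: "inj_on f A"
    using A by (rule small_embedding)
  have "small U (Pow (f ` A))"
    using U small_image[OF A, of f] unfolding universe_def small_def by blast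
  moreover have "inj_on ((`) f) (Pow A)"
    using f by (rule inj_on_image_Pow)
  ultimately show ?thesis
    by (rule small_inj[rotated 2]) auto
qed

text \<open>A function is encoded by its graph. Extensionality of the functions is what makes the
  encoding injective.\<close>

lemma small_PiE:
  assumes U: "universe U" and I: "small U I" and F: "\<And>i. i \<in> I \<Longrightarrow> small U (F i)"
  shows "small U (Pi\<^sub>E I F)"
proof (rule small_inj)
  show "small U (Pow (Sigma I F))"
    by (intro small_Pow small_Sigma U I F)
  show "inj_on (\<lambda>f. (\<lambda>i. (i, f i)) ` I) (Pi\<^sub>E I F)"
    by (rule inj_onI, rule PiE_ext) auto
qed auto

section \<open>Presheaves on discrete categories\<close>

locale rel_universe =
  fixes Q :: "('o, 'a) qtld" and U :: "'u itself"
  assumes universe: "universe U" and small_Q: "small_quantaloid U Q"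
begin

sublocale quantaloid Q
  using small_Q by (simp add: small_quantaloid_def)

abbreviation K :: "(('u, 'o) oset, ('u, 'a) qrel) qtld" where
  "K \<equiv> QRel Q"

abbreviation pt :: "'o \<Rightarrow> ('u, 'o) oset" where
  "pt \<equiv> singleton_oset"

sublocale K: quantaloid K
  by (rule quantaloid_QRel)

lemma Ob_K: "(X, t) \<in> Ob K \<longleftrightarrow> small U X \<and> t \<in> X \<rightarrow>\<^sub>E Ob Q"
  by (simp add: Ob_QRel small_def)

lemma pt_Ob: "q \<in> Ob Q \<Longrightarrow> pt q \<in> Ob K"
  by (simp add: singleton_oset_def Ob_K small_finite[OF universe])

lemma typ_Ob: "\<lbrakk>Y \<in> Ob K; y \<in> fst Y\<rbrakk> \<Longrightarrow> snd Y y \<in> Ob Q"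
  by (cases Y) (auto dest: Ob_QRelD)

text \<open>The presheaf on \<open>Y\<close> represented by \<open>y\<close>, namely the column of
  the identity relation at \<open>y\<close>. Composing it with a relation into \<open>Y\<close>
  extracts the presheaf of entries at \<open>y\<close>, called a row in what follows. Through these
  projections, statements about entries become statements about composites.\<close>

definition coord :: "('u, 'o) oset \<Rightarrow> 'u \<Rightarrow> ('u, 'a) qrel" where
  "coord Y y = (\<lambda>z\<in>fst Y. \<lambda>w\<in>{undefined}. One K Y z y)"

lemma coord_arr:
  assumes "Y \<in> Ob K" "y \<in> fst Y"
  shows "coord Y y \<in> arr K Y (pt (snd Y y))"
  using assms QRel_one_closed[of "fst Y" "snd Y"]
  by (cases Y) (auto simp: coord_def singleton_oset_def intro!: arr_QRelI dest: arr_QRelD)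

lemma coord_comp:
  assumes X: "X \<in> Ob K" and Y: "Y \<in> Ob K" and y: "y \<in> fst Y" and \<phi>: "\<phi> \<in> arr K X Y" and x: "x \<in> fst X"
  shows "Comp K X Y (pt (snd Y y)) (coord Y y) \<phi> x undefined = \<phi> x y"
proof -
  have "Comp K X Y (pt (snd Y y)) (coord Y y) \<phi> x undefined = Comp K X Y Y (One K Y) \<phi> x y"
    using x y by (cases X; cases Y)
      (auto simp: Comp_QRel singleton_oset_def coord_def
        intro!: arg_cong[where f = "\<lambda>S. \<Squnion>\<^bsub>Hom Q _ _\<^esub> S"] image_cong)
  then show ?thesis
    using K.comp_one_left[OF X Y \<phi>] by simp
qed

text \<open>The coordinates are jointly monic.\<close>

lemma coord_eqI:
  assumes X: "X \<in> Ob K" and Y: "Y \<in> Ob K" and \<phi>: "\<phi> \<in> arr K X Y" and \<psi>: "\<psi> \<in> arr K X Y"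
    and eq: "\<And>y. y \<in> fst Y \<Longrightarrow>
      Comp K X Y (pt (snd Y y)) (coord Y y) \<phi> = Comp K X Y (pt (snd Y y)) (coord Y y) \<psi>"
  shows "\<phi> = \<psi>"
proof (rule QRel_eqI[of _ Q "fst X" "snd X" "fst Y" "snd Y"])
  show "\<phi> x y = \<psi> x y" if "x \<in> fst X" "y \<in> fst Y" for x y
    using coord_comp[OF X Y that(2) _ that(1)] \<phi> \<psi> eq[OF that(2)] by metis
qed (use \<phi> \<psi> in auto)

lemma pt_eqI:
  assumes "\<phi> \<in> arr K X (pt q)" "\<psi> \<in> arr K X (pt q)"
    and "\<And>x. x \<in> fst X \<Longrightarrow> \<phi> x undefined = \<psi> x undefined"
  shows "\<phi> = \<psi>"
  using assms by (cases X) (auto simp: singleton_oset_def intro: QRel_eqI)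

text \<open>Together with \<open>coord_eqI\<close> this is the universal property of
  \<open>Y\<close> as the product of its points. The family is arbitrary because \<open>Y\<close> is
  discrete.\<close>

lemma ex_tuple:
  assumes X: "X \<in> Ob K" and Y: "Y \<in> Ob K"
    and f: "\<And>y. y \<in> fst Y \<Longrightarrow> f y \<in> arr K X (pt (snd Y y))"
  obtains \<phi> where "\<phi> \<in> arr K X Y"
    "\<And>y. y \<in> fst Y \<Longrightarrow> Comp K X Y (pt (snd Y y)) (coord Y y) \<phi> = f y"
proof
  let ?p = "\<lambda>x\<in>fst X. \<lambda>y\<in>fst Y. f y x undefined"
  have "?p \<in> arr K (fst X, snd X) (fst Y, snd Y)"
  proof (rule arr_QRelI)
    show "f y x undefined \<in> arr Q (snd X x) (snd Y y)" if "x \<in> fst X" "y \<in> fst Y" for x y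
      using arr_QRelD[of "f y" Q "fst X" "snd X" "{undefined}" "\<lambda>x\<in>{undefined}. snd Y y"] f that
      by (simp add: singleton_oset_def)
  qed
  then show p: "?p \<in> arr K X Y"
    by simp
  show "Comp K X Y (pt (snd Y y)) (coord Y y) ?p = f y" if y: "y \<in> fst Y" for y
  proof (rule pt_eqI)
    show "Comp K X Y (pt (snd Y y)) (coord Y y) ?p \<in> arr K X (pt (snd Y y))"
      using X Y y p by (intro K.comp_closed coord_arr pt_Ob typ_Ob)
    show "Comp K X Y (pt (snd Y y)) (coord Y y) ?p x undefined = f y x undefined"
      if "x \<in> fst X" for x
      using coord_comp[OF X Y y p that] that y by simp
  qed (use f y in auto)
qed

text \<open>The composite is the join over \<open>y\<close> of the scalar multiples of the rows of
  \<open>\<phi>\<close> by the entries of \<open>w\<close>. Each such multiple is below the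
  composite, so it is enough to bound those multiples of rows that are.\<close>

lemma comp_le_if_coord:
  assumes X: "X \<in> Ob K" and Y: "Y \<in> Ob K" and q: "q \<in> Ob Q"
    and \<phi>: "\<phi> \<in> arr K X Y" and w: "w \<in> arr K Y (pt q)" and \<beta>: "\<beta> \<in> arr K X (pt q)"
    and le: "\<And>y v. \<lbrakk>y \<in> fst Y; v \<in> arr K (pt (snd Y y)) (pt q);
        Comp K X (pt (snd Y y)) (pt q) v (Comp K X Y (pt (snd Y y)) (coord Y y) \<phi>)
          \<sqsubseteq>\<^bsub>Hom K X (pt q)\<^esub> Comp K X Y (pt q) w \<phi>\<rbrakk>
      \<Longrightarrow> Comp K X (pt (snd Y y)) (pt q) v (Comp K X Y (pt (snd Y y)) (coord Y y) \<phi>)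
          \<sqsubseteq>\<^bsub>Hom K X (pt q)\<^esub> \<beta>"
  shows "Comp K X Y (pt q) w \<phi> \<sqsubseteq>\<^bsub>Hom K X (pt q)\<^esub> \<beta>"
proof -
  obtain X0 t Y0 s where XY: "X = (X0, t)" "Y = (Y0, s)"
    by (cases X, cases Y)
  note o = X[unfolded XY, THEN Ob_QRelD] Y[unfolded XY, THEN Ob_QRelD]
  have \<phi>': "\<phi> x y \<in> arr Q (t x) (s y)" if "x \<in> X0" "y \<in> Y0" for x y
    using \<phi> that by (auto simp: XY dest: arr_QRelD)
  have w': "w y undefined \<in> arr Q (s y) q" if "y \<in> Y0" for y
    using w that by (auto simp: XY singleton_oset_def dest: arr_QRelD)
  have \<beta>': "\<beta> x undefined \<in> arr Q (t x) q" if "x \<in> X0" for x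
    using \<beta> that by (auto simp: XY singleton_oset_def dest: arr_QRelD)
  let ?c = "\<lambda>x y. Comp Q (t x) (s y) q (w y undefined) (\<phi> x y)"
  have c: "?c x ` Y0 \<subseteq> arr Q (t x) q" if "x \<in> X0" for x
    using that o q \<phi>' w' by (auto intro!: comp_closed)
  have wx: "Comp K X Y (pt q) w \<phi> x undefined = \<Squnion>\<^bsub>Hom Q (t x) q\<^esub> (?c x ` Y0)" if "x \<in> X0" for x
    using that by (simp add: XY Comp_QRel singleton_oset_def)
  have "?c x y \<sqsubseteq>\<^bsub>Hom Q (t x) q\<^esub> \<beta> x undefined" if x: "x \<in> X0" and y: "y \<in> Y0" for x y
  proof -
    \<comment> \<open>The entry of \<open>w\<close> at \<open>y\<close>, regarded as a relation
      between two singletons.\<close>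
    let ?v = "\<lambda>a\<in>{undefined::'u}. \<lambda>b\<in>{undefined::'u}. w y undefined"
    have vx: "Comp K X (pt (snd Y y)) (pt q) ?v (Comp K X Y (pt (snd Y y)) (coord Y y) \<phi>) x' undefined
        = ?c x' y" if x': "x' \<in> X0" for x'
    proof -
      have "Comp K X (pt (snd Y y)) (pt q) ?v (Comp K X Y (pt (snd Y y)) (coord Y y) \<phi>) x' undefined
        = \<Squnion>\<^bsub>Hom Q (t x') q\<^esub>
            {Comp Q (t x') (s y) q (w y undefined) (Comp K X Y (pt (snd Y y)) (coord Y y) \<phi> x' undefined)}"
        using x' by (simp add: XY Comp_QRel[of _ "X0"] singleton_oset_def)
      also have "\<dots> = \<Squnion>\<^bsub>Hom Q (t x') q\<^esub> {?c x' y}"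
        using coord_comp[OF X Y _ \<phi>, of y x'] x' y by (simp add: XY)
      also have "\<dots> = ?c x' y"
        using complete_lattice.Sup_single_value[OF hom_complete_lattice, of "t x'" q y "{y}" "?c x'"]
          c x' y o q by auto
      finally show ?thesis .
    qed
    have "?v \<in> arr K (pt (snd Y y)) (pt q)"
      using w' y by (auto simp: XY singleton_oset_def intro!: arr_QRelI)
    moreover have "Comp K X (pt (snd Y y)) (pt q) ?v (Comp K X Y (pt (snd Y y)) (coord Y y) \<phi>)
        \<sqsubseteq>\<^bsub>Hom K X (pt q)\<^esub> Comp K X Y (pt q) w \<phi>"
    proof -
      have "?c x' y \<sqsubseteq>\<^bsub>Hom Q (t x') q\<^esub> \<Squnion>\<^bsub>Hom Q (t x') q\<^esub> (?c x' ` Y0)" if "x' \<in> X0" for x'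
        using Sup_upper[OF _ q c] that o y by auto
      then show ?thesis
        using vx wx by (auto simp: XY singleton_oset_def le_QRel)
    qed
    ultimately have "Comp K X (pt (snd Y y)) (pt q) ?v (Comp K X Y (pt (snd Y y)) (coord Y y) \<phi>)
        \<sqsubseteq>\<^bsub>Hom K X (pt q)\<^esub> \<beta>"
      using le y XY by simp
    then show ?thesis
      using vx[OF x] x by (auto simp: XY singleton_oset_def le_QRel)
  qed
  then have "Comp K X Y (pt q) w \<phi> x undefined \<sqsubseteq>\<^bsub>Hom Q (t x) q\<^esub> \<beta> x undefined" if "x \<in> X0" for x
    unfolding wx[OF that] using that by (intro Sup_least[OF o(1) q c \<beta>']) auto
  then show ?thesis
    by (auto simp: XY singleton_oset_def le_QRel)
qed

lemma Psh_iff: "(q, \<mu>) \<in> Psh Q X \<longleftrightarrow> q \<in> Ob Q \<and> \<mu> \<in> arr K X (pt q)"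
  by (simp add: Psh_def)

text \<open>Presheaves of all types form a sum over the objects of \<open>Q\<close> of products of
  hom-sets. Both the object set and the hom-sets of \<open>Q\<close> have to be small here.\<close>

lemma small_Psh:
  assumes "X \<in> Ob K"
  shows "small U (Psh Q X)"
proof -
  obtain X0 t where X: "X = (X0, t)"
    by (cases X)
  have "small U (Ob Q)" "small U X0"
    using small_Q assms by (auto simp: small_quantaloid_def X Ob_K)
  moreover have "small U (arr Q (t x) q)" if "x \<in> X0" "q \<in> Ob Q" for x q
    using that assms small_Q by (auto simp: small_quantaloid_def X Ob_K)
  ultimately have "small U (SIGMA q : Ob Q. \<Pi>\<^sub>E x\<in>X0. \<Pi>\<^sub>E y\<in>{undefined::'u}. arr Q (t x) q)"
    by (intro small_Sigma small_PiE small_finite[OF _ finite.intros(2)] universe) auto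
  moreover have "(\<Pi>\<^sub>E y\<in>{undefined}. arr Q (t x) ((\<lambda>y\<in>{undefined}. q) y))
      = (\<Pi>\<^sub>E y\<in>{undefined::'u}. arr Q (t x) q)" for x q
    by (rule PiE_cong) simp
  then have "Psh Q X \<subseteq> (SIGMA q : Ob Q. \<Pi>\<^sub>E x\<in>X0. \<Pi>\<^sub>E y\<in>{undefined}. arr Q (t x) q)"
    by (auto simp only: Psh_def X singleton_oset_def arr_QRel)
  ultimately show ?thesis
    by (rule small_subset)
qed

section \<open>Interior spaces\<close>

text \<open>Fixed points of the operator, kept typed. Continuity and the congruence of interior
  spaces are reformulated below entirely in terms of them.\<close>

definition is_open ::
  "('u, 'o, 'a) int_space \<Rightarrow> 'o \<Rightarrow> ('u, 'a) qrel \<Rightarrow> bool" where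
  "is_open S q \<mu> \<longleftrightarrow> q \<in> Ob Q \<and> \<mu> \<in> arr K (fst S) (pt q) \<and> snd S (q, \<mu>) = (q, \<mu>)"

text \<open>A residual is determined by the scalars \<open>w\<close> below it, and the adjunction
  says which ones these are. This removes residuals from the functoriality condition on interior
  operators.\<close>

lemma psh_hom_le_iff:
  assumes X: "X \<in> Ob K" and q: "q \<in> Ob Q" "q' \<in> Ob Q"
    and \<mu>: "\<mu> \<in> arr K X (pt q)" "\<mu>' \<in> arr K X (pt q')" and v: "v \<in> arr K X (pt q)" "v' \<in> arr K X (pt q')"
  shows "psh_hom Q X (q, \<mu>) (q', \<mu>') \<sqsubseteq>\<^bsub>Hom K (pt q) (pt q')\<^esub> psh_hom Q X (q, v) (q', v') \<longleftrightarrow>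
    (\<forall>w \<in> arr K (pt q) (pt q'). Comp K X (pt q) (pt q') w \<mu> \<sqsubseteq>\<^bsub>Hom K X (pt q')\<^esub> \<mu>' \<longrightarrow>
      Comp K X (pt q) (pt q') w v \<sqsubseteq>\<^bsub>Hom K X (pt q')\<^esub> v')"
proof -
  note o = X pt_Ob[OF q(1)] pt_Ob[OF q(2)]
  note m = K.lres_closed[OF o \<mu>] K.le_lres_iff[OF o \<mu>] and n = K.lres_closed[OF o v] K.le_lres_iff[OF o v]
  show ?thesis
    unfolding psh_hom_def prod.case
    using m n K.hom_refl[OF o(2,3)] K.hom_trans[OF o(2,3)] by meson
qed

context
  fixes X :: "('u, 'o) oset" and a
  assumes X: "X \<in> Ob K" and int: "interior_operator Q X a"
begin

lemma int_cases:
  assumes "q \<in> Ob Q" "\<mu> \<in> arr K X (pt q)"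
  obtains \<nu> where "a (q, \<mu>) = (q, \<nu>)" "is_open (X, a) q \<nu>" "\<nu> \<sqsubseteq>\<^bsub>Hom K X (pt q)\<^esub> \<mu>"
proof
  have m: "(q, \<mu>) \<in> Psh Q X"
    using assms by (simp add: Psh_iff)
  then have "a (q, \<mu>) \<in> Psh Q X" "fst (a (q, \<mu>)) = q" "psh_le Q X (a (q, \<mu>)) (q, \<mu>)"
    "a (a (q, \<mu>)) = a (q, \<mu>)"
    using int unfolding interior_operator_def by auto
  then show "a (q, \<mu>) = (q, snd (a (q, \<mu>)))" "is_open (X, a) q (snd (a (q, \<mu>)))"
    "snd (a (q, \<mu>)) \<sqsubseteq>\<^bsub>Hom K X (pt q)\<^esub> \<mu>"
    by (cases "a (q, \<mu>)"; auto simp: Psh_iff is_open_def psh_le_def)+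
qed

text \<open>The full strength of functoriality: an open \<open>\<mu>\<close> is fixed, so a scalar
  \<open>v\<close> that carries it below \<open>\<mu>'\<close> carries it below the interior of
  \<open>\<mu>'\<close>, even when the types differ. Taking \<open>v\<close> to be an identity gives
  only \<open>open_le_int\<close>.\<close>

lemma int_comp_le:
  assumes "is_open (X, a) q \<mu>" "q' \<in> Ob Q" "\<mu>' \<in> arr K X (pt q')" "v \<in> arr K (pt q) (pt q')"
    and "Comp K X (pt q) (pt q') v \<mu> \<sqsubseteq>\<^bsub>Hom K X (pt q')\<^esub> \<mu>'"
  shows "Comp K X (pt q) (pt q') v \<mu> \<sqsubseteq>\<^bsub>Hom K X (pt q')\<^esub> snd (a (q', \<mu>'))"
proof -
  have o: "q \<in> Ob Q" "\<mu> \<in> arr K X (pt q)" "a (q, \<mu>) = (q, \<mu>)"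
    using assms(1) by (auto simp: is_open_def)
  obtain \<nu> where \<nu>: "a (q', \<mu>') = (q', \<nu>)" "is_open (X, a) q' \<nu>"
    using int_cases assms by metis
  have "psh_hom Q X (q, \<mu>) (q', \<mu>') \<sqsubseteq>\<^bsub>Hom K (pt q) (pt q')\<^esub> psh_hom Q X (q, \<mu>) (q', \<nu>)"
    using int o assms \<nu>(1) unfolding interior_operator_def by (metis Psh_iff fst_conv)
  then show ?thesis
    using psh_hom_le_iff[OF X o(1) assms(2) o(2) assms(3) o(2), of \<nu>] \<nu> assms by (auto simp: is_open_def)
qed

lemma open_le_int:
  assumes "is_open (X, a) q \<mu>" "\<mu>' \<in> arr K X (pt q)" "\<mu> \<sqsubseteq>\<^bsub>Hom K X (pt q)\<^esub> \<mu>'"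
  shows "\<mu> \<sqsubseteq>\<^bsub>Hom K X (pt q)\<^esub> snd (a (q, \<mu>'))"
proof -
  have o: "q \<in> Ob Q" "\<mu> \<in> arr K X (pt q)"
    using assms(1) by (auto simp: is_open_def)
  show ?thesis
    using int_comp_le[OF assms(1) o(1) assms(2) K.one_closed[OF pt_Ob[OF o(1)]]] assms(3)
    by (simp add: K.comp_one_left[OF X pt_Ob] o)
qed

lemma openI:
  assumes "q \<in> Ob Q" "\<mu> \<in> arr K X (pt q)" "\<mu> \<sqsubseteq>\<^bsub>Hom K X (pt q)\<^esub> snd (a (q, \<mu>))"
  shows "is_open (X, a) q \<mu>"
proof -
  obtain \<nu> where "a (q, \<mu>) = (q, \<nu>)" "is_open (X, a) q \<nu>" "\<nu> \<sqsubseteq>\<^bsub>Hom K X (pt q)\<^esub> \<mu>"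
    using int_cases assms by metis
  moreover from this have "\<nu> = \<mu>"
    using K.hom_antisym[OF X pt_Ob[OF assms(1)]] assms by (auto simp: is_open_def)
  ultimately show ?thesis
    by simp
qed

text \<open>Each member is open and below the join, hence below the interior of the join.\<close>

lemma open_Sup:
  assumes q: "q \<in> Ob Q" and M: "\<And>\<mu>. \<mu> \<in> M \<Longrightarrow> is_open (X, a) q \<mu>"
  shows "is_open (X, a) q (\<Squnion>\<^bsub>Hom K X (pt q)\<^esub> M)"
proof -
  note o = X pt_Ob[OF q]
  have M': "M \<subseteq> arr K X (pt q)"
    using M by (auto simp: is_open_def)
  then have s: "\<Squnion>\<^bsub>Hom K X (pt q)\<^esub> M \<in> arr K X (pt q)"
    by (rule K.Sup_closed[OF o])
  have "snd (a (q, \<Squnion>\<^bsub>Hom K X (pt q)\<^esub> M)) \<in> arr K X (pt q)"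
    by (rule int_cases[OF q s]) (simp add: is_open_def)
  then have "\<Squnion>\<^bsub>Hom K X (pt q)\<^esub> M \<sqsubseteq>\<^bsub>Hom K X (pt q)\<^esub> snd (a (q, \<Squnion>\<^bsub>Hom K X (pt q)\<^esub> M))"
    by (rule K.Sup_least[OF o M']) (intro open_le_int M s K.Sup_upper[OF o M'])
  then show ?thesis
    by (rule openI[OF q s])
qed

end

text \<open>For open \<open>l\<close>, the continuity inequality says that the pullback of
  \<open>l\<close> is below its own interior. Conversely, the interior of any \<open>l\<close> is
  open, so its pullback is an open presheaf below the pullback of \<open>l\<close> and therefore
  below the interior of the latter.\<close>

lemma continuous_iff:
  assumes X: "X \<in> Ob K" and a: "interior_operator Q X a" and Y: "Y \<in> Ob K" and b: "interior_operator Q Y b"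
  shows "continuous_qrel Q (X, a) (Y, b) \<zeta> \<longleftrightarrow> \<zeta> \<in> arr K X Y \<and>
    (\<forall>q l. is_open (Y, b) q l \<longrightarrow> is_open (X, a) q (Comp K X Y (pt q) l \<zeta>))" (is "?L \<longleftrightarrow> ?R")
proof
  assume L: ?L
  then have z: "\<zeta> \<in> arr K X Y"
    by (simp add: continuous_qrel_def)
  have "is_open (X, a) q (Comp K X Y (pt q) l \<zeta>)" if l: "is_open (Y, b) q l" for q l
  proof -
    have l': "q \<in> Ob Q" "l \<in> arr K Y (pt q)" "b (q, l) = (q, l)"
      using l by (auto simp: is_open_def)
    then have "psh_le Q X (q, Comp K X Y (pt q) l \<zeta>) (a (q, Comp K X Y (pt q) l \<zeta>))"
      using L by (force simp: continuous_qrel_def pullback_def Psh_def)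
    then show ?thesis
      using l' z X Y by (intro openI[OF X a] K.comp_closed pt_Ob) (auto simp: psh_le_def split: prod.splits)
  qed
  with z show ?R
    by blast
next
  assume R: ?R
  have "psh_le Q X (pullback Q X Y \<zeta> (b (q, l))) (a (pullback Q X Y \<zeta> (q, l)))"
    if q: "q \<in> Ob Q" and l: "l \<in> arr K Y (pt q)" for q l
  proof -
    obtain m where m: "b (q, l) = (q, m)" "is_open (Y, b) q m" "m \<sqsubseteq>\<^bsub>Hom K Y (pt q)\<^esub> l"
      using int_cases[OF Y b q l] .
    have lz: "Comp K X Y (pt q) l \<zeta> \<in> arr K X (pt q)"
      using R X Y q l by (intro K.comp_closed pt_Ob) auto
    have "Comp K X Y (pt q) m \<zeta> \<sqsubseteq>\<^bsub>Hom K X (pt q)\<^esub> Comp K X Y (pt q) l \<zeta>"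
      using R X Y q l m by (intro K.comp_mono_left pt_Ob) (auto simp: is_open_def)
    then have "Comp K X Y (pt q) m \<zeta> \<sqsubseteq>\<^bsub>Hom K X (pt q)\<^esub> snd (a (q, Comp K X Y (pt q) l \<zeta>))"
      using R m lz by (intro open_le_int[OF X a]) auto
    moreover have "fst (a (q, Comp K X Y (pt q) l \<zeta>)) = q"
      using int_cases[OF X a q lz] by (metis fst_conv)
    ultimately show ?thesis
      by (auto simp: m pullback_def psh_le_def split: prod.splits)
  qed
  with R show ?L
    by (auto simp: continuous_qrel_def Psh_def)
qed

text \<open>The values of an interior operator are exactly its fixed points.\<close>

lemma open_cong_iff:
  assumes Y: "Y \<in> Ob K" and b: "interior_operator Q Y b"
  shows "(\<zeta>, \<zeta>') \<in> open_cong Q (X, a) (Y, b) \<longleftrightarrow>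
    continuous_qrel Q (X, a) (Y, b) \<zeta> \<and> continuous_qrel Q (X, a) (Y, b) \<zeta>' \<and>
    (\<forall>q l. is_open (Y, b) q l \<longrightarrow> Comp K X Y (pt q) l \<zeta> = Comp K X Y (pt q) l \<zeta>')"
proof -
  have "(\<forall>l \<in> Psh Q Y. pullback Q X Y \<zeta> (b l) = pullback Q X Y \<zeta>' (b l)) \<longleftrightarrow>
    (\<forall>q l. is_open (Y, b) q l \<longrightarrow> Comp K X Y (pt q) l \<zeta> = Comp K X Y (pt q) l \<zeta>')" (is "?L \<longleftrightarrow> ?R")
  proof
    assume L: ?L
    show ?R
    proof (intro allI impI)
      fix q l assume l: "is_open (Y, b) q l"
      then have "pullback Q X Y \<zeta> (b (q, l)) = pullback Q X Y \<zeta>' (b (q, l))" "b (q, l) = (q, l)"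
        using bspec[OF L, of "(q, l)"] by (auto simp: is_open_def Psh_def)
      then show "Comp K X Y (pt q) l \<zeta> = Comp K X Y (pt q) l \<zeta>'"
        by (simp add: pullback_def)
    qed
  next
    assume R: ?R
    show ?L
    proof (clarify)
      fix q l assume "(q, l) \<in> Psh Q Y"
      then obtain m where "b (q, l) = (q, m)" "is_open (Y, b) q m"
        using int_cases[OF Y b] by (metis Psh_iff)
      then show "pullback Q X Y \<zeta> (b (q, l)) = pullback Q X Y \<zeta>' (b (q, l))"
        using R by (simp add: pullback_def)
    qed
  qed
  then show ?thesis
    by (simp add: open_cong_def)
qed

end

section \<open>The quantaloid of interior spaces and its congruence\<close>

context rel_universe
begin

abbreviation I :: "(('u, 'o, 'a) int_space, ('u, 'a) qrel) qtld" where
  "I \<equiv> IntRel Q"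

lemma Ob_IntRel: "(X, a) \<in> Ob I \<longleftrightarrow> X \<in> Ob K \<and> interior_operator Q X a"
  by (simp add: IntRel_def)

lemma arr_IntRel: "\<zeta> \<in> arr I S T \<longleftrightarrow> continuous_qrel Q S T \<zeta>"
  by (simp add: IntRel_def)

lemma le_IntRel: "(\<sqsubseteq>\<^bsub>Hom I S T\<^esub>) = (\<sqsubseteq>\<^bsub>Hom K (fst S) (fst T)\<^esub>)"
  by (simp add: IntRel_def)

lemma Comp_IntRel: "Comp I S T R = Comp K (fst S) (fst T) (fst R)"
  by (simp add: IntRel_def)

lemma One_IntRel: "One I S = One K (fst S)"
  by (simp add: IntRel_def)

context
  fixes X Y :: "('u, 'o) oset" and a b
  assumes ob: "(X, a) \<in> Ob I" "(Y, b) \<in> Ob I"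
begin

lemma cont_iff:
  "\<zeta> \<in> arr I (X, a) (Y, b) \<longleftrightarrow> \<zeta> \<in> arr K X Y \<and>
    (\<forall>q l. is_open (Y, b) q l \<longrightarrow> is_open (X, a) q (Comp K X Y (pt q) l \<zeta>))"
  using ob by (simp add: arr_IntRel Ob_IntRel continuous_iff)

text \<open>Pulling back along a join gives the join of the pullbacks, and open presheaves are
  closed under joins. Hence joins of continuous relations are those of relations, and the quantaloid
  laws are inherited.\<close>

lemma cont_Sup_closed:
  assumes T: "T \<subseteq> arr I (X, a) (Y, b)"
  shows "\<Squnion>\<^bsub>Hom K X Y\<^esub> T \<in> arr I (X, a) (Y, b)"
proof -
  note o = ob[unfolded Ob_IntRel]
  have T': "T \<subseteq> arr K X Y"
    using T cont_iff by auto
  have "is_open (X, a) q (Comp K X Y (pt q) l (\<Squnion>\<^bsub>Hom K X Y\<^esub> T))" if l: "is_open (Y, b) q l" for q l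
  proof -
    have q: "q \<in> Ob Q" "l \<in> arr K Y (pt q)"
      using l by (auto simp: is_open_def)
    have "Comp K X Y (pt q) l (\<Squnion>\<^bsub>Hom K X Y\<^esub> T) = \<Squnion>\<^bsub>Hom K X (pt q)\<^esub> (Comp K X Y (pt q) l ` T)"
      using o q T' by (intro K.comp_Sup_right pt_Ob) auto
    then show ?thesis
      using o q l T cont_iff by (auto intro!: open_Sup)
  qed
  then show ?thesis
    using o T' cont_iff K.Sup_closed by blast
qed

lemma IntRel_complete_lattice: "complete_lattice (Hom I (X, a) (Y, b))"
proof (rule complete_lattice_SupI)
  note o = ob[unfolded Ob_IntRel, THEN conjunct1]
  have c: "x \<in> arr K X Y" if "x \<in> arr I (X, a) (Y, b)" for x
    using that cont_iff by blast
  show "eq (Hom I (X, a) (Y, b)) = (=)"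
    by (simp add: IntRel_def)
  show "x \<sqsubseteq>\<^bsub>Hom I (X, a) (Y, b)\<^esub> x" if "x \<in> arr I (X, a) (Y, b)" for x
    using K.hom_refl[OF o c[OF that]] by (simp add: le_IntRel)
  show "x = y" if "x \<in> arr I (X, a) (Y, b)" "y \<in> arr I (X, a) (Y, b)"
    "x \<sqsubseteq>\<^bsub>Hom I (X, a) (Y, b)\<^esub> y" "y \<sqsubseteq>\<^bsub>Hom I (X, a) (Y, b)\<^esub> x" for x y
    using that K.hom_antisym[OF o] c by (simp add: le_IntRel)
  show "x \<sqsubseteq>\<^bsub>Hom I (X, a) (Y, b)\<^esub> z" if "x \<in> arr I (X, a) (Y, b)" "y \<in> arr I (X, a) (Y, b)"
    "z \<in> arr I (X, a) (Y, b)" "x \<sqsubseteq>\<^bsub>Hom I (X, a) (Y, b)\<^esub> y" "y \<sqsubseteq>\<^bsub>Hom I (X, a) (Y, b)\<^esub> z" for x y z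
    using that K.hom_trans[OF o, of x y z] c by (simp add: le_IntRel)
  show "\<exists>s \<in> arr I (X, a) (Y, b). (\<forall>x \<in> T. x \<sqsubseteq>\<^bsub>Hom I (X, a) (Y, b)\<^esub> s) \<and>
      (\<forall>z \<in> arr I (X, a) (Y, b). (\<forall>x \<in> T. x \<sqsubseteq>\<^bsub>Hom I (X, a) (Y, b)\<^esub> z) \<longrightarrow>
        s \<sqsubseteq>\<^bsub>Hom I (X, a) (Y, b)\<^esub> z)" if T: "T \<subseteq> arr I (X, a) (Y, b)" for T
  proof -
    have "T \<subseteq> arr K X Y"
      using T c by blast
    then show ?thesis
      using cont_Sup_closed[OF T] K.Sup_upper[OF o] K.Sup_least[OF o] c
      by (intro bexI[of _ "\<Squnion>\<^bsub>Hom K X Y\<^esub> T"]) (auto simp: le_IntRel)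
  qed
qed

lemma Sup_IntRel:
  assumes T: "T \<subseteq> arr I (X, a) (Y, b)"
  shows "\<Squnion>\<^bsub>Hom I (X, a) (Y, b)\<^esub> T = \<Squnion>\<^bsub>Hom K X Y\<^esub> T"
proof -
  note o = ob[unfolded Ob_IntRel, THEN conjunct1]
  have T': "T \<subseteq> arr K X Y"
    using T cont_iff by blast
  show ?thesis
    using T cont_Sup_closed[OF T] K.Sup_upper[OF o T'] K.Sup_least[OF o T'] cont_iff
    by (intro complete_lattice.Sup_eqI[OF IntRel_complete_lattice]) (auto simp: le_IntRel)
qed

end

lemma cont_comp_closed:
  assumes ob: "(X, a) \<in> Ob I" "(Y, b) \<in> Ob I" "(Z, c) \<in> Ob I"
    and u: "u \<in> arr I (X, a) (Y, b)" and v: "v \<in> arr I (Y, b) (Z, c)"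
  shows "Comp K X Y Z v u \<in> arr I (X, a) (Z, c)"
proof -
  note o = ob[unfolded Ob_IntRel, THEN conjunct1]
  note u' = u[unfolded cont_iff[OF ob(1,2)]] and v' = v[unfolded cont_iff[OF ob(2,3)]]
  have "is_open (X, a) q (Comp K X Z (pt q) l (Comp K X Y Z v u))" if l: "is_open (Z, c) q l" for q l
  proof -
    have "q \<in> Ob Q" "l \<in> arr K Z (pt q)"
      using l by (auto simp: is_open_def)
    then have "Comp K X Z (pt q) l (Comp K X Y Z v u) = Comp K X Y (pt q) (Comp K Y Z (pt q) l v) u"
      using o u' v' by (intro K.comp_assoc pt_Ob) auto
    then show ?thesis
      using u' v' l by simp
  qed
  then show ?thesis
    using o u' v' K.comp_closed cont_iff[OF ob(1,3)] by blast
qed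

lemma cont_one_closed:
  assumes ob: "(X, a) \<in> Ob I"
  shows "One K X \<in> arr I (X, a) (X, a)"
proof -
  note o = ob[unfolded Ob_IntRel, THEN conjunct1]
  have "Comp K X X (pt q) l (One K X) = l" if "is_open (X, a) q l" for q l
    using that o by (intro K.comp_one_right pt_Ob) (auto simp: is_open_def)
  then show ?thesis
    using o K.one_closed cont_iff[OF ob ob] by auto
qed

lemma quantaloid_IntRel: "quantaloid I"
proof (rule quantaloid.intro; (simp only: split_paired_all Comp_IntRel One_IntRel fst_conv)?)
  fix X Y Z W :: "('u, 'o) oset" and a b c d
  show "complete_lattice (Hom I (X, a) (Y, b))" if "(X, a) \<in> Ob I" "(Y, b) \<in> Ob I"
    using that by (rule IntRel_complete_lattice)
  show "Comp K X Y Z v u \<in> arr I (X, a) (Z, c)"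
    if "(X, a) \<in> Ob I" "(Y, b) \<in> Ob I" "(Z, c) \<in> Ob I"
      "u \<in> arr I (X, a) (Y, b)" "v \<in> arr I (Y, b) (Z, c)" for u v
    using that by (rule cont_comp_closed)
  show "One K X \<in> arr I (X, a) (X, a)" if "(X, a) \<in> Ob I"
    using that by (rule cont_one_closed)
  show "Comp K X Z W w (Comp K X Y Z v u) = Comp K X Y W (Comp K Y Z W w v) u"
    if "(X, a) \<in> Ob I" "(Y, b) \<in> Ob I" "(Z, c) \<in> Ob I" "(W, d) \<in> Ob I"
      "u \<in> arr I (X, a) (Y, b)" "v \<in> arr I (Y, b) (Z, c)" "w \<in> arr I (Z, c) (W, d)" for u v w
    using that by (intro K.comp_assoc) (auto simp: cont_iff Ob_IntRel)
  show "Comp K X X Y u (One K X) = u" "Comp K X Y Y (One K Y) u = u"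
    if "(X, a) \<in> Ob I" "(Y, b) \<in> Ob I" "u \<in> arr I (X, a) (Y, b)" for u
    using that K.comp_one_right[of X Y u] K.comp_one_left[of X Y u] by (auto simp: cont_iff Ob_IntRel)
next
  fix X Y Z :: "('u, 'o) oset" and a b c U v
  assume ob: "(X, a) \<in> Ob I" "(Y, b) \<in> Ob I" "(Z, c) \<in> Ob I"
    and U: "U \<subseteq> arr I (X, a) (Y, b)" and v: "v \<in> arr I (Y, b) (Z, c)"
  have "Comp K X Y Z v ` U \<subseteq> arr I (X, a) (Z, c)"
    using cont_comp_closed[OF ob] U v by blast
  moreover have "Comp K X Y Z v (\<Squnion>\<^bsub>Hom K X Y\<^esub> U) = \<Squnion>\<^bsub>Hom K X Z\<^esub> (Comp K X Y Z v ` U)"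
    using ob U v by (intro K.comp_Sup_right) (auto simp: cont_iff Ob_IntRel)
  ultimately show "Comp K X Y Z v (\<Squnion>\<^bsub>Hom I (X, a) (Y, b)\<^esub> U)
      = \<Squnion>\<^bsub>Hom I (X, a) (Z, c)\<^esub> (Comp K X Y Z v ` U)"
    using ob U by (simp add: Sup_IntRel)
next
  fix X Y Z :: "('u, 'o) oset" and a b c u V
  assume ob: "(X, a) \<in> Ob I" "(Y, b) \<in> Ob I" "(Z, c) \<in> Ob I"
    and u: "u \<in> arr I (X, a) (Y, b)" and V: "V \<subseteq> arr I (Y, b) (Z, c)"
  have "(\<lambda>v. Comp K X Y Z v u) ` V \<subseteq> arr I (X, a) (Z, c)"
    using cont_comp_closed[OF ob] u V by blast
  moreover have "Comp K X Y Z (\<Squnion>\<^bsub>Hom K Y Z\<^esub> V) u = \<Squnion>\<^bsub>Hom K X Z\<^esub> ((\<lambda>v. Comp K X Y Z v u) ` V)"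
    using ob u V by (intro K.comp_Sup_left) (auto simp: cont_iff Ob_IntRel)
  ultimately show "Comp K X Y Z (\<Squnion>\<^bsub>Hom I (Y, b) (Z, c)\<^esub> V) u
      = \<Squnion>\<^bsub>Hom I (X, a) (Z, c)\<^esub> ((\<lambda>v. Comp K X Y Z v u) ` V)"
    using ob V by (simp add: Sup_IntRel)
qed

lemma open_cong_cont_iff:
  assumes "(X, a) \<in> Ob I" "(Y, b) \<in> Ob I"
  shows "(\<zeta>, \<zeta>') \<in> open_cong Q (X, a) (Y, b) \<longleftrightarrow>
    \<zeta> \<in> arr I (X, a) (Y, b) \<and> \<zeta>' \<in> arr I (X, a) (Y, b) \<and>
    (\<forall>q l. is_open (Y, b) q l \<longrightarrow> Comp K X Y (pt q) l \<zeta> = Comp K X Y (pt q) l \<zeta>')"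
  using assms by (simp add: arr_IntRel Ob_IntRel open_cong_iff)

text \<open>For composites, the pullback of an open presheaf along \<open>v\<close> is open and
  equals the one along \<open>v'\<close>, so it is a presheaf on which \<open>u\<close> and
  \<open>u'\<close> agree.\<close>

lemma quantaloid_congruence_open: "quantaloid_congruence I (open_cong Q)"
proof (intro quantaloid_congruence.intro quantaloid_IntRel quantaloid_congruence_axioms.intro;
    simp only: split_paired_all Comp_IntRel fst_conv)
  fix X Y :: "('u, 'o) oset" and a b
  assume ob: "(X, a) \<in> Ob I" "(Y, b) \<in> Ob I"
  show "equiv (arr I (X, a) (Y, b)) (open_cong Q (X, a) (Y, b))"
    by (rule equivI) (auto simp: refl_on_def sym_def trans_def open_cong_cont_iff[OF ob])
  fix T assume T: "T \<subseteq> open_cong Q (X, a) (Y, b)"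
  have A: "fst ` T \<subseteq> arr I (X, a) (Y, b)" "snd ` T \<subseteq> arr I (X, a) (Y, b)"
    using T open_cong_cont_iff[OF ob] by auto
  have "Comp K X Y (pt q) l (\<Squnion>\<^bsub>Hom K X Y\<^esub> (fst ` T)) = Comp K X Y (pt q) l (\<Squnion>\<^bsub>Hom K X Y\<^esub> (snd ` T))"
    if l: "is_open (Y, b) q l" for q l
  proof -
    have "q \<in> Ob Q" "l \<in> arr K Y (pt q)"
      using l by (auto simp: is_open_def)
    moreover have "Comp K X Y (pt q) l ` fst ` T = Comp K X Y (pt q) l ` snd ` T"
      unfolding image_image using T l open_cong_cont_iff[OF ob] by (intro image_cong) auto
    moreover have "fst ` T \<subseteq> arr K X Y" "snd ` T \<subseteq> arr K X Y"
      using A cont_iff[OF ob] by blast+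
    ultimately show ?thesis
      using ob K.comp_Sup_right[of X Y "pt q"] by (simp add: pt_Ob Ob_IntRel)
  qed
  then show "(\<Squnion>\<^bsub>Hom I (X, a) (Y, b)\<^esub> (fst ` T), \<Squnion>\<^bsub>Hom I (X, a) (Y, b)\<^esub> (snd ` T))
      \<in> open_cong Q (X, a) (Y, b)"
    using A ob by (simp add: Sup_IntRel open_cong_cont_iff cont_Sup_closed)
next
  fix X Y Z :: "('u, 'o) oset" and a b c u u' v v'
  assume ob: "(X, a) \<in> Ob I" "(Y, b) \<in> Ob I" "(Z, c) \<in> Ob I"
    and u: "(u, u') \<in> open_cong Q (X, a) (Y, b)" and v: "(v, v') \<in> open_cong Q (Y, b) (Z, c)"
  note o = ob[unfolded Ob_IntRel, THEN conjunct1]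
  note u = u[unfolded open_cong_cont_iff[OF ob(1,2)]] and v = v[unfolded open_cong_cont_iff[OF ob(2,3)]]
  have a: "u \<in> arr K X Y" "u' \<in> arr K X Y" "v \<in> arr K Y Z" "v' \<in> arr K Y Z"
    using u v cont_iff ob by blast+
  have "Comp K X Z (pt q) l (Comp K X Y Z v u) = Comp K X Z (pt q) l (Comp K X Y Z v' u')"
    if l: "is_open (Z, c) q l" for q l
  proof -
    have q: "q \<in> Ob Q" "l \<in> arr K Z (pt q)"
      using l by (auto simp: is_open_def)
    have "is_open (Y, b) q (Comp K Y Z (pt q) l v)"
      using l v cont_iff[OF ob(2,3)] by blast
    moreover have "Comp K Y Z (pt q) l v = Comp K Y Z (pt q) l v'"
      using l v by blast
    ultimately have "Comp K X Y (pt q) (Comp K Y Z (pt q) l v) u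
        = Comp K X Y (pt q) (Comp K Y Z (pt q) l v') u'"
      using u by metis
    then show ?thesis
      using q a o by (simp add: K.comp_assoc pt_Ob)
  qed
  then show "(Comp K X Y Z v u, Comp K X Y Z v' u') \<in> open_cong Q (X, a) (Z, c)"
    using u v ob by (auto simp: open_cong_cont_iff intro: cont_comp_closed)
qed

section \<open>The equivalence\<close>

text \<open>This is \<open>\<phi>\<^sup>* \<phi>\<^sub>*\<close>, where \<open>\<phi>\<^sub>* \<mu> = \<mu> \<swarrow> \<phi>\<close> is right adjoint to \<open>\<phi>\<^sup>*\<close>.\<close>

definition rel_int ::
  "('u, 'o) oset \<Rightarrow> ('u, 'o) oset \<Rightarrow> ('u, 'a) qrel \<Rightarrow> ('u, 'o, 'a) psh \<Rightarrow> ('u, 'o, 'a) psh" where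
  "rel_int X Y \<phi> = (\<lambda>m\<in>Psh Q X. (fst m,
    Comp K X Y (pt (fst m)) (lres K X Y (pt (fst m)) (snd m) \<phi>) \<phi>))"

context
  fixes X Y :: "('u, 'o) oset" and \<phi>
  assumes X: "X \<in> Ob K" and Y: "Y \<in> Ob K" and \<phi>: "\<phi> \<in> arr K X Y"
begin

abbreviation rint :: "'o \<Rightarrow> ('u, 'a) qrel \<Rightarrow> ('u, 'a) qrel" where
  "rint q \<mu> \<equiv> Comp K X Y (pt q) (lres K X Y (pt q) \<mu> \<phi>) \<phi>"

lemma rel_int_apply:
  "\<lbrakk>q \<in> Ob Q; \<mu> \<in> arr K X (pt q)\<rbrakk> \<Longrightarrow> rel_int X Y \<phi> (q, \<mu>) = (q, rint q \<mu>)"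
  by (simp add: rel_int_def Psh_iff)

lemma rint_arr: "\<lbrakk>q \<in> Ob Q; \<mu> \<in> arr K X (pt q)\<rbrakk> \<Longrightarrow> rint q \<mu> \<in> arr K X (pt q)"
  using X Y \<phi> by (intro K.comp_closed K.lres_closed pt_Ob)

lemma rint_le: "\<lbrakk>q \<in> Ob Q; \<mu> \<in> arr K X (pt q)\<rbrakk> \<Longrightarrow> rint q \<mu> \<sqsubseteq>\<^bsub>Hom K X (pt q)\<^esub> \<mu>"
  using X Y \<phi> by (intro K.comp_lres_le pt_Ob)

text \<open>By the adjunction \<open>w\<close> is below the residual; composing with
  \<open>\<phi>\<close> is monotone. Thus \<open>rint q \<mu>\<close> is the largest presheaf below
  \<open>\<mu>\<close> that factors through \<open>\<phi>\<close>.\<close>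

lemma comp_le_rint:
  assumes "q \<in> Ob Q" "\<mu> \<in> arr K X (pt q)" "w \<in> arr K Y (pt q)"
    and "Comp K X Y (pt q) w \<phi> \<sqsubseteq>\<^bsub>Hom K X (pt q)\<^esub> \<mu>"
  shows "Comp K X Y (pt q) w \<phi> \<sqsubseteq>\<^bsub>Hom K X (pt q)\<^esub> rint q \<mu>"
  using assms X Y \<phi> by (intro K.comp_mono_left K.le_lres_iff[THEN iffD2] K.lres_closed pt_Ob)

lemma rint_comp:
  assumes "q \<in> Ob Q" "w \<in> arr K Y (pt q)"
  shows "rint q (Comp K X Y (pt q) w \<phi>) = Comp K X Y (pt q) w \<phi>"
proof (rule K.hom_antisym[OF X pt_Ob[OF assms(1)]])
  show c: "Comp K X Y (pt q) w \<phi> \<in> arr K X (pt q)"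
    using assms X Y \<phi> by (intro K.comp_closed pt_Ob)
  show "rint q (Comp K X Y (pt q) w \<phi>) \<in> arr K X (pt q)"
    by (rule rint_arr[OF assms(1) c])
  show "rint q (Comp K X Y (pt q) w \<phi>) \<sqsubseteq>\<^bsub>Hom K X (pt q)\<^esub> Comp K X Y (pt q) w \<phi>"
    by (rule rint_le[OF assms(1) c])
  show "Comp K X Y (pt q) w \<phi> \<sqsubseteq>\<^bsub>Hom K X (pt q)\<^esub> rint q (Comp K X Y (pt q) w \<phi>)"
    by (rule comp_le_rint[OF assms(1) c assms(2) K.hom_refl[OF X pt_Ob[OF assms(1)] c]])
qed

lemma open_rel_int_iff:
  "is_open (X, rel_int X Y \<phi>) q \<mu> \<longleftrightarrow>
    q \<in> Ob Q \<and> (\<exists>w \<in> arr K Y (pt q). \<mu> = Comp K X Y (pt q) w \<phi>)"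
proof
  assume "is_open (X, rel_int X Y \<phi>) q \<mu>"
  then have "q \<in> Ob Q" "\<mu> \<in> arr K X (pt q)" "rint q \<mu> = \<mu>"
    by (auto simp: is_open_def rel_int_apply)
  then show "q \<in> Ob Q \<and> (\<exists>w \<in> arr K Y (pt q). \<mu> = Comp K X Y (pt q) w \<phi>)"
    using K.lres_closed[OF X Y pt_Ob \<phi>] by metis
next
  assume "q \<in> Ob Q \<and> (\<exists>w \<in> arr K Y (pt q). \<mu> = Comp K X Y (pt q) w \<phi>)"
  then show "is_open (X, rel_int X Y \<phi>) q \<mu>"
    using X Y \<phi> K.comp_closed[OF X Y pt_Ob \<phi>]
    by (auto simp: is_open_def rel_int_apply rint_comp)
qed

text \<open>Presheaves factoring through \<open>\<phi>\<close> are fixed, which gives idempotence.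
  For functoriality, a scalar multiple of \<open>rint q \<mu>\<close> still factors through
  \<open>\<phi>\<close>, so as soon as it is below \<open>\<mu>'\<close> it is below
  \<open>rint q' \<mu>'\<close>.\<close>

lemma interior_rel_int: "interior_operator Q X (rel_int X Y \<phi>)"
  unfolding interior_operator_def
proof (intro conjI ballI)
  show "rel_int X Y \<phi> \<in> Psh Q X \<rightarrow>\<^sub>E Psh Q X"
    by (auto simp: rel_int_def Psh_iff rint_arr)
  fix m assume "m \<in> Psh Q X"
  then obtain q \<mu> where m: "m = (q, \<mu>)" "q \<in> Ob Q" "\<mu> \<in> arr K X (pt q)"
    by (cases m) (auto simp: Psh_iff)
  show "fst (rel_int X Y \<phi> m) = fst m" "psh_le Q X (rel_int X Y \<phi> m) m"
    using m by (simp_all add: rel_int_apply psh_le_def rint_le)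
  show "rel_int X Y \<phi> (rel_int X Y \<phi> m) = rel_int X Y \<phi> m"
    using m X Y \<phi> by (simp add: rel_int_apply rint_arr rint_comp K.lres_closed pt_Ob)
  fix m' assume "m' \<in> Psh Q X"
  then obtain q' \<mu>' where m': "m' = (q', \<mu>')" "q' \<in> Ob Q" "\<mu>' \<in> arr K X (pt q')"
    by (cases m') (auto simp: Psh_iff)
  have "Comp K X (pt q) (pt q') w (rint q \<mu>) \<sqsubseteq>\<^bsub>Hom K X (pt q')\<^esub> rint q' \<mu>'"
    if w: "w \<in> arr K (pt q) (pt q')" and le: "Comp K X (pt q) (pt q') w \<mu> \<sqsubseteq>\<^bsub>Hom K X (pt q')\<^esub> \<mu>'" for w
  proof -
    let ?r = "lres K X Y (pt q) \<mu> \<phi>"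
    note o = X Y pt_Ob[OF m(2)] pt_Ob[OF m'(2)]
    have r: "?r \<in> arr K Y (pt q)"
      using o \<phi> m by (intro K.lres_closed)
    have "Comp K X (pt q) (pt q') w (rint q \<mu>) \<sqsubseteq>\<^bsub>Hom K X (pt q')\<^esub> Comp K X (pt q) (pt q') w \<mu>"
      using o w m by (intro K.comp_mono_right rint_le rint_arr)
    then have "Comp K X (pt q) (pt q') w (rint q \<mu>) \<sqsubseteq>\<^bsub>Hom K X (pt q')\<^esub> \<mu>'"
      using le by (rule K.hom_trans[OF o(1,4)]) (use o w m m' rint_arr in \<open>auto intro: K.comp_closed\<close>)
    moreover have "Comp K X (pt q) (pt q') w (rint q \<mu>)
        = Comp K X Y (pt q') (Comp K Y (pt q) (pt q') w ?r) \<phi>"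
      using o \<phi> r w by (simp add: K.comp_assoc)
    moreover have "Comp K Y (pt q) (pt q') w ?r \<in> arr K Y (pt q')"
      using o r w by (intro K.comp_closed)
    ultimately show ?thesis
      using comp_le_rint[OF m'(2,3)] by simp
  qed
  then show "psh_hom Q X m m' \<sqsubseteq>\<^bsub>Hom K (pt (fst m)) (pt (fst m'))\<^esub>
      psh_hom Q X (rel_int X Y \<phi> m) (rel_int X Y \<phi> m')"
    using m m' X by (simp add: rel_int_apply psh_hom_le_iff rint_arr)
qed

end

text \<open>The relation indexed by the open presheaves themselves recovers the interior operator;
  there are few enough of them because the universe is a strong limit.\<close>

lemma ex_rel_int:
  assumes X: "X \<in> Ob K" and a: "interior_operator Q X a"
  obtains Y \<phi> where "Y \<in> Ob K" "\<phi> \<in> arr K X Y" "rel_int X Y \<phi> = a"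
proof -
  define Op where "Op = {(q, \<mu>). is_open (X, a) q \<mu>}"
  have "Op \<subseteq> Psh Q X"
    by (auto simp: Op_def is_open_def Psh_iff)
  then have small: "small U Op"
    using small_Psh[OF X] by (rule small_subset[rotated])
  \<comment> \<open>Points of a set over the objects are elements of \<open>'u\<close>, so the open
    presheaves are renamed by an injection; \<open>g\<close> undoes the renaming.\<close>
  then obtain f :: "_ \<Rightarrow> 'u" where f: "inj_on f Op"
    by (rule small_embedding)
  define g where "g = the_inv_into Op f"
  have g: "g y \<in> Op" if "y \<in> f ` Op" for y
    using that f by (auto simp: g_def the_inv_into_f_f)
  have gf: "g (f m) = m" if "m \<in> Op" for m
    using that f by (simp add: g_def the_inv_into_f_f)
  define Y where "Y = (f ` Op, \<lambda>y\<in>f ` Op. fst (g y))"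
  have g_open: "is_open (X, a) (snd Y y) (snd (g y))" if "y \<in> fst Y" for y
    using g[of y] that by (simp add: Y_def) (simp add: Op_def case_prod_beta)
  have Y: "Y \<in> Ob K"
    using small_image[OF small] g_open by (auto simp: Y_def Ob_K is_open_def)
  \<comment> \<open>The evaluation relation: its row at the name of an open presheaf is that
    presheaf.\<close>
  obtain \<phi> where \<phi>: "\<phi> \<in> arr K X Y"
    and c: "\<And>y. y \<in> fst Y \<Longrightarrow> Comp K X Y (pt (snd Y y)) (coord Y y) \<phi> = snd (g y)"
    using g_open ex_tuple[OF X Y, of "\<lambda>y. snd (g y)"] by (auto simp: is_open_def)
  have "rel_int X Y \<phi> m = a m" if m_Psh: "m \<in> Psh Q X" for m
  proof -
    obtain q \<mu> where m: "m = (q, \<mu>)" "q \<in> Ob Q" "\<mu> \<in> arr K X (pt q)"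
      using m_Psh by (cases m) (auto simp: Psh_iff)
    note o = X pt_Ob[OF m(2)]
    obtain \<nu> where \<nu>: "a (q, \<mu>) = (q, \<nu>)" "is_open (X, a) q \<nu>" "\<nu> \<sqsubseteq>\<^bsub>Hom K X (pt q)\<^esub> \<mu>"
      using int_cases[OF X a m(2,3)] .
    have \<nu>_arr: "\<nu> \<in> arr K X (pt q)"
      using \<nu>(2) by (simp add: is_open_def)
    let ?w = "lres K X Y (pt q) \<mu> \<phi>"
    have w: "?w \<in> arr K Y (pt q)"
      using X Y \<phi> m by (intro K.lres_closed pt_Ob)
    have r: "rint X Y \<phi> q \<mu> \<in> arr K X (pt q)"
      by (rule rint_arr[OF X Y \<phi> m(2,3)])
    \<comment> \<open>The rows are open, so a scalar multiple of a row that lies below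
      \<open>\<mu>\<close> lies below the interior of \<open>\<mu>\<close> by
      \<open>int_comp_le\<close>.\<close>
    have "rint X Y \<phi> q \<mu> \<sqsubseteq>\<^bsub>Hom K X (pt q)\<^esub> \<nu>"
    proof (rule comp_le_if_coord[OF X Y m(2) \<phi> w \<nu>_arr])
      fix y v assume y: "y \<in> fst Y" and v: "v \<in> arr K (pt (snd Y y)) (pt q)"
        and le: "Comp K X (pt (snd Y y)) (pt q) v (Comp K X Y (pt (snd Y y)) (coord Y y) \<phi>)
          \<sqsubseteq>\<^bsub>Hom K X (pt q)\<^esub> rint X Y \<phi> q \<mu>"
      have "snd (g y) \<in> arr K X (pt (snd Y y))"
        using g_open[OF y] by (simp add: is_open_def)
      then have "Comp K X (pt (snd Y y)) (pt q) v (snd (g y)) \<in> arr K X (pt q)"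
        using X v m typ_Ob[OF Y y] by (intro K.comp_closed pt_Ob)
      then have "Comp K X (pt (snd Y y)) (pt q) v (snd (g y)) \<sqsubseteq>\<^bsub>Hom K X (pt q)\<^esub> \<mu>"
        using le rint_le[OF X Y \<phi> m(2,3)] K.hom_trans[OF o] m r unfolding c[OF y] by blast
      then show "Comp K X (pt (snd Y y)) (pt q) v (Comp K X Y (pt (snd Y y)) (coord Y y) \<phi>)
          \<sqsubseteq>\<^bsub>Hom K X (pt q)\<^esub> \<nu>"
        using int_comp_le[OF X a g_open[OF y] m(2,3) v] \<nu>(1) c[OF y] by simp
    qed
    \<comment> \<open>The interior of \<open>\<mu>\<close> is open, hence itself a row; a row
      factors through \<open>\<phi>\<close> by its coordinate.\<close>
    moreover have "\<nu> \<sqsubseteq>\<^bsub>Hom K X (pt q)\<^esub> rint X Y \<phi> q \<mu>"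
    proof -
      let ?y = "f (q, \<nu>)"
      have "(q, \<nu>) \<in> Op"
        using \<nu>(2) by (simp add: Op_def)
      then have y: "?y \<in> fst Y" "snd Y ?y = q" "snd (g ?y) = \<nu>"
        by (auto simp: Y_def gf)
      then show ?thesis
        using comp_le_rint[OF X Y \<phi> m(2,3), of "coord Y ?y"] coord_arr[OF Y y(1)] c[OF y(1)] \<nu>(3) by simp
    qed
    ultimately have "rint X Y \<phi> q \<mu> = \<nu>"
      using r \<nu>_arr by (intro K.hom_antisym[OF o])
    then show ?thesis
      using m \<nu> by (simp add: rel_int_apply[OF X Y \<phi>])
  qed
  \<comment> \<open>Both operators are extensional, so agreement on presheaves is equality.\<close>
  moreover have "rel_int X Y \<phi> \<in> Psh Q X \<rightarrow>\<^sub>E Psh Q X" "a \<in> Psh Q X \<rightarrow>\<^sub>E Psh Q X"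
    using a interior_rel_int[OF X Y \<phi>] by (simp_all add: interior_operator_def)
  ultimately have "rel_int X Y \<phi> = a"
    by (intro PiE_ext[of _ "Psh Q X" "\<lambda>_. Psh Q X"]) auto
  then show thesis
    using that Y \<phi> by blast
qed

section \<open>The full homomorphism from relations to interior spaces\<close>

definition rel_functor ::
  "(('u, 'o) oset \<times> ('u, 'o) oset \<times> ('u, 'a) qrel, ('u, 'a) qrel \<times> ('u, 'a) qrel,
    ('u, 'o, 'a) int_space, ('u, 'a) qrel) qfun" where
  "rel_functor = \<lparr>omap = (\<lambda>(X, Y, \<phi>). (X, rel_int X Y \<phi>)), amap = (\<lambda>_ _. fst)\<rparr>"

lemma rel_functor_simps [simp]:
  "omap rel_functor (X, Y, \<phi>) = (X, rel_int X Y \<phi>)" "amap rel_functor p q = fst"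
  by (simp_all add: rel_functor_def)

lemma Ob_rel_functor: "(X, Y, \<phi>) \<in> Ob (Arr K) \<Longrightarrow> (X, rel_int X Y \<phi>) \<in> Ob I"
  by (simp add: Ob_Arr Ob_IntRel interior_rel_int)

context
  fixes X Y X' Y' :: "('u, 'o) oset" and \<phi> \<psi>
  assumes ob: "(X, Y, \<phi>) \<in> Ob (Arr K)" "(X', Y', \<psi>) \<in> Ob (Arr K)"
begin

text \<open>An open presheaf of the target has the form \<open>w\<close> after
  \<open>\<psi>\<close>; the commuting square rewrites its pullback as \<open>w\<close> after
  \<open>\<eta>\<close>, after \<open>\<phi>\<close>.\<close>

lemma rel_functor_arr:
  assumes "(\<zeta>, \<eta>) \<in> arr (Arr K) (X, Y, \<phi>) (X', Y', \<psi>)"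
  shows "\<zeta> \<in> arr I (X, rel_int X Y \<phi>) (X', rel_int X' Y' \<psi>)"
proof -
  note o = ob[unfolded Ob_Arr] and a = assms[unfolded arr_Arr]
  have "is_open (X, rel_int X Y \<phi>) q (Comp K X X' (pt q) l \<zeta>)"
    if l: "is_open (X', rel_int X' Y' \<psi>) q l" for q l
  proof -
    obtain w where w: "q \<in> Ob Q" "w \<in> arr K Y' (pt q)" "l = Comp K X' Y' (pt q) w \<psi>"
      using l o by (auto simp: open_rel_int_iff)
    have "Comp K X X' (pt q) l \<zeta> = Comp K X Y' (pt q) w (Comp K X X' Y' \<psi> \<zeta>)"
      unfolding w(3) using K.comp_assoc[of X X' Y' "pt q" \<zeta> \<psi> w] o a w pt_Ob by simp
    also have "\<dots> = Comp K X Y' (pt q) w (Comp K X Y Y' \<eta> \<phi>)"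
      using a by simp
    also have "\<dots> = Comp K X Y (pt q) (Comp K Y Y' (pt q) w \<eta>) \<phi>"
      using o a w by (simp add: K.comp_assoc pt_Ob)
    finally show ?thesis
      using o a w by (auto simp: open_rel_int_iff intro!: K.comp_closed pt_Ob)
  qed
  then show ?thesis
    using a cont_iff[OF Ob_rel_functor Ob_rel_functor, OF ob] by blast
qed

text \<open>Lets equations involving \<open>\<psi>\<close> be tested on open presheaves.\<close>

lemma open_row:
  assumes "y \<in> fst Y'"
  shows "is_open (X', rel_int X' Y' \<psi>) (snd Y' y) (Comp K X' Y' (pt (snd Y' y)) (coord Y' y) \<psi>)"
  using ob assms by (auto simp: Ob_Arr open_rel_int_iff coord_arr typ_Ob)

text \<open>The rows of \<open>\<psi>\<close> are open, so \<open>\<zeta>\<close> pulls each of them back to a composite with \<open>\<phi>\<close>; the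
  left factors of these composites are the rows of \<open>\<eta>\<close>.\<close>

lemma rel_functor_full:
  assumes "\<zeta> \<in> arr I (X, rel_int X Y \<phi>) (X', rel_int X' Y' \<psi>)"
  shows "\<exists>\<eta>. (\<zeta>, \<eta>) \<in> arr (Arr K) (X, Y, \<phi>) (X', Y', \<psi>)"
proof -
  note o = ob[unfolded Ob_Arr] and c = assms[unfolded cont_iff[OF Ob_rel_functor Ob_rel_functor, OF ob]]
  have "\<exists>w \<in> arr K Y (pt (snd Y' y)).
      Comp K X X' (pt (snd Y' y)) (Comp K X' Y' (pt (snd Y' y)) (coord Y' y) \<psi>) \<zeta>
      = Comp K X Y (pt (snd Y' y)) w \<phi>" if "y \<in> fst Y'" for y
    using c open_row[OF that] o open_rel_int_iff by blast
  then obtain h where h: "h y \<in> arr K Y (pt (snd Y' y))"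
    "Comp K X X' (pt (snd Y' y)) (Comp K X' Y' (pt (snd Y' y)) (coord Y' y) \<psi>) \<zeta>
      = Comp K X Y (pt (snd Y' y)) (h y) \<phi>" if "y \<in> fst Y'" for y
    by metis
  obtain \<eta> where \<eta>: "\<eta> \<in> arr K Y Y'"
    "\<And>y. y \<in> fst Y' \<Longrightarrow> Comp K Y Y' (pt (snd Y' y)) (coord Y' y) \<eta> = h y"
    using ex_tuple[of Y Y' h] o h(1) by blast
  have "Comp K X X' Y' \<psi> \<zeta> = Comp K X Y Y' \<eta> \<phi>"
  proof (rule coord_eqI)
    show "Comp K X Y' (pt (snd Y' y)) (coord Y' y) (Comp K X X' Y' \<psi> \<zeta>)
        = Comp K X Y' (pt (snd Y' y)) (coord Y' y) (Comp K X Y Y' \<eta> \<phi>)" if y: "y \<in> fst Y'" for y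
    proof -
      have p: "pt (snd Y' y) \<in> Ob K" "coord Y' y \<in> arr K Y' (pt (snd Y' y))"
        using o y by (auto intro!: pt_Ob typ_Ob coord_arr)
      then have "Comp K X Y' (pt (snd Y' y)) (coord Y' y) (Comp K X X' Y' \<psi> \<zeta>)
          = Comp K X Y (pt (snd Y' y)) (h y) \<phi>"
        using o c h(2)[OF y] by (simp add: K.comp_assoc)
      also have "\<dots> = Comp K X Y' (pt (snd Y' y)) (coord Y' y) (Comp K X Y Y' \<eta> \<phi>)"
        using o p \<eta> y by (simp add: K.comp_assoc)
      finally show ?thesis .
    qed
  qed (use o c \<eta> in \<open>auto intro!: K.comp_closed\<close>)
  then show ?thesis
    using o c \<eta> by (auto simp: arr_Arr)
qed

text \<open>Open presheaves factor through \<open>\<psi>\<close>, so the composite of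
  \<open>\<psi>\<close> and \<open>\<zeta>\<close> determines all pullbacks. Conversely, the rows of
  \<open>\<psi>\<close> are open and their pullbacks are the rows of that composite.\<close>

lemma rel_functor_cong:
  assumes "(\<zeta>, \<eta>) \<in> arr (Arr K) (X, Y, \<phi>) (X', Y', \<psi>)" "(\<zeta>', \<eta>') \<in> arr (Arr K) (X, Y, \<phi>) (X', Y', \<psi>)"
  shows "(\<zeta>, \<zeta>') \<in> open_cong Q (X, rel_int X Y \<phi>) (X', rel_int X' Y' \<psi>) \<longleftrightarrow>
    Comp K X X' Y' \<psi> \<zeta> = Comp K X X' Y' \<psi> \<zeta>'"
proof -
  note o = ob[unfolded Ob_Arr] and a = assms[unfolded arr_Arr]
  have assoc: "Comp K X X' (pt q) (Comp K X' Y' (pt q) w \<psi>) z = Comp K X Y' (pt q) w (Comp K X X' Y' \<psi> z)"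
    if "q \<in> Ob Q" "w \<in> arr K Y' (pt q)" "z \<in> arr K X X'" for q w z
    using o that by (simp add: K.comp_assoc pt_Ob)
  have "(\<forall>q l. is_open (X', rel_int X' Y' \<psi>) q l \<longrightarrow>
      Comp K X X' (pt q) l \<zeta> = Comp K X X' (pt q) l \<zeta>') \<longleftrightarrow>
    Comp K X X' Y' \<psi> \<zeta> = Comp K X X' Y' \<psi> \<zeta>'" (is "?L \<longleftrightarrow> ?R")
  proof
    assume L: ?L
    show ?R
    proof (rule coord_eqI)
      show "Comp K X Y' (pt (snd Y' y)) (coord Y' y) (Comp K X X' Y' \<psi> \<zeta>)
          = Comp K X Y' (pt (snd Y' y)) (coord Y' y) (Comp K X X' Y' \<psi> \<zeta>')" if y: "y \<in> fst Y'" for y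
        using L open_row[OF y] assoc[of "snd Y' y" "coord Y' y"] o a y typ_Ob coord_arr by metis
    qed (use o a in \<open>auto intro!: K.comp_closed\<close>)
  next
    assume ?R
    then show ?L
      using assoc o a by (auto simp: open_rel_int_iff)
  qed
  then show ?thesis
    using open_cong_cont_iff[OF Ob_rel_functor Ob_rel_functor, OF ob] rel_functor_arr assms by blast
qed

end

text \<open>Joins are preserved because joins of squares are componentwise and joins of continuous
  relations are those of relations.\<close>

lemma rel_functor_hom: "is_quantaloid_hom (Arr K) I rel_functor"
proof -
  have "is_functor (Arr K) I rel_functor"
    unfolding is_functor_def
  proof (intro conjI ballI)
    fix p assume p: "p \<in> Ob (Arr K)"
    then show "omap rel_functor p \<in> Ob I"
      by (cases p) (simp add: Ob_rel_functor)
    show "amap rel_functor p p (One (Arr K) p) = One I (omap rel_functor p)"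
      by (cases p) (simp add: One_Arr One_IntRel)
    fix q u assume q: "q \<in> Ob (Arr K)" and u: "u \<in> arr (Arr K) p q"
    then show "amap rel_functor p q u \<in> arr I (omap rel_functor p) (omap rel_functor q)"
      using p by (cases p; cases q; cases u) (simp add: rel_functor_arr)
    fix r v assume "r \<in> Ob (Arr K)" "v \<in> arr (Arr K) q r"
    show "amap rel_functor p r (Comp (Arr K) p q r v u)
        = Comp I (omap rel_functor p) (omap rel_functor q) (omap rel_functor r)
          (amap rel_functor q r v) (amap rel_functor p q u)"
      by (cases p; cases q; cases r; cases u; cases v) (simp add: Comp_Arr Comp_IntRel)
  qed
  moreover have "fst (\<Squnion>\<^bsub>Hom (Arr K) (X, Y, \<phi>) (X', Y', \<psi>)\<^esub> T)
      = \<Squnion>\<^bsub>Hom I (X, rel_int X Y \<phi>) (X', rel_int X' Y' \<psi>)\<^esub> (fst ` T)"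
    if ob: "(X, Y, \<phi>) \<in> Ob (Arr K)" "(X', Y', \<psi>) \<in> Ob (Arr K)"
      and T: "T \<subseteq> arr (Arr K) (X, Y, \<phi>) (X', Y', \<psi>)" for X Y \<phi> X' Y' \<psi> T
  proof -
    have "fst ` T \<subseteq> arr I (X, rel_int X Y \<phi>) (X', rel_int X' Y' \<psi>)"
      using rel_functor_arr[OF ob] T by fastforce
    then show ?thesis
      using Sup_IntRel[OF Ob_rel_functor Ob_rel_functor, OF ob] K.Sup_Arr[OF ob T] by simp
  qed
  ultimately show ?thesis
    by (auto simp: is_quantaloid_hom_def)
qed

lemma equivalent_Diag_IntRel_o:
  "equivalent_quantaloids (Diag K)
    (IntRel_o Q :: (('u, 'o, 'a) int_space, ('u, 'a) qrel set) qtld)"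
  unfolding Diag_def IntRel_o_def
proof (rule equivalent_Quot[OF K.quantaloid_congruence_diag quantaloid_congruence_open rel_functor_hom])
  show "\<exists>p \<in> Ob (Arr K). omap rel_functor p = S" if S_Ob: "S \<in> Ob I" for S
  proof -
    obtain X a where S: "S = (X, a)" "X \<in> Ob K" "interior_operator Q X a"
      using S_Ob Ob_IntRel by (metis surj_pair)
    then obtain Y \<phi> where "Y \<in> Ob K" "\<phi> \<in> arr K X Y" "rel_int X Y \<phi> = a"
      using ex_rel_int by blast
    with S show ?thesis
      by (intro bexI[of _ "(X, Y, \<phi>)"]) (auto simp: Ob_Arr)
  qed
next
  fix p q v
  assume "p \<in> Ob (Arr K)" "q \<in> Ob (Arr K)" "v \<in> arr I (omap rel_functor p) (omap rel_functor q)"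
  then show "\<exists>u \<in> arr (Arr K) p q. amap rel_functor p q u = v"
    using rel_functor_full by (cases p; cases q) force
next
  fix p q u v
  assume "p \<in> Ob (Arr K)" "q \<in> Ob (Arr K)" "u \<in> arr (Arr K) p q" "v \<in> arr (Arr K) p q"
  then show "(amap rel_functor p q u, amap rel_functor p q v)
      \<in> open_cong Q (omap rel_functor p) (omap rel_functor q) \<longleftrightarrow> (u, v) \<in> diag_cong K p q"
    by (cases p; cases q; cases u; cases v) (simp add: rel_functor_cong K.diag_cong_iff)
qed

end

theorem theorem7p3:
  fixes Q :: "('o, 'a) qtld"
  assumes "universe TYPE('u)"
    and "small_quantaloid TYPE('u) Q"
  shows "equivalent_quantaloids
           (Diag (QRel Q :: (('u, 'o) oset, ('u, 'a) qrel) qtld))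
           (IntRel_o Q :: (('u, 'o, 'a) int_space, ('u, 'a) qrel set) qtld)"
  using assms by (intro rel_universe.equivalent_Diag_IntRel_o rel_universe.intro)

end
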